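(* Let $U:\mathbb{R}^d\to\mathbb{R}$ be a continuously differentiable function with $\nabla U(0)=0$ and suppose there are constants $0<m\le L$ such that $$\frac m2|x-y|^2\le U(y)-U(x)-\langle\nabla U(x),y-x\rangle\le\frac L2|x-y|^2,\qquad x,y\in\mathbb{R}^d .$$ Let $K\ge1$ be an integer. Let $\eta_0\in(0,1)$ be a constant depending only on $m$ and $L$ such that, for every $\eta\in(0,\eta_0)$, the PRLMC chain with step size $\eta$ has a unique stationary distribution $\pi_\eta$, with $$\pi_\eta(|x|^2):=\int_{\mathbb{R}^d}|x|^2\pi_\eta(\mathrm dx)\le\frac dm\{2+4\eta^2L^2(2-1/K)+L^2(1-1/K)\}.$$ Let $\pi(\mathrm dx)=Z^{-1}e^{-U(x)}\mathrm dx$ with $Z=\int_{\mathbb{R}^d}e^{-U(x)}\mathrm dx$. Then for every $\eta\in\big(0,\eta_0\wedge\frac{2}{m+L}\big)$, $$W_2(\pi_\eta,\pi)\le\frac Lm\,\eta^{1/2}\Big[\big(2d+4\eta^2Ld+8L^2\eta^2d\big)^{1/2}+\sqrt{4-2/K}\,\big(\eta L^2\pi_\eta(|x|^2)/3+d\big)^{1/2}\Big].$$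
   Context: PRLMC (Poisson randomized midpoint Langevin Monte Carlo) with step size $\eta>0$ and integer parameter $K\ge1$ is the Markov chain on $\mathbb{R}^d$ $$\tilde X_{k+1}=\tilde X_k-\eta\nabla U(\tilde X_k)+\eta\sum_{i=0}^{K-1}H_{k,i}\big(\nabla U(\tilde X_k)-\nabla U(\hat X_{k,i})\big)+\sqrt{2\eta}\,\xi_{k+1},\qquad k\ge0,$$ $$\hat X_{k,i}=\tilde X_k-\frac{i\eta}{K}\nabla U(\tilde X_k)+\sqrt{\frac{2i\eta}{K}}\,\xi_{k,i},\qquad 0\le i\le K-1,$$ where $(H_{k,i})$ are i.i.d. Bernoulli random variables with parameter $1/K$, $(\xi_{k+1})$ and $(\xi_{k,i})$ are i.i.d. standard Gaussian vectors in $\mathbb{R}^d$, all these variables being independent of each other and of $\tilde X_0$. A constant $\eta_0$ as in the claim exists. $W_2$ is the 2-Wasserstein distance $W_2(\mu,\nu)=\big(\inf_{\lambda\in\Pi(\mu,\nu)}\int|x-y|^2\lambda(\mathrm dx,\mathrm dy)\big)^{1/2}$, with $\Pi(\mu,\nu)$ the set of couplings of $\mu$ and $\nu$; $a\wedge b=\min\{a,b\}$. *)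

theory Defs
  imports "HOL-Probability.Probability"
begin

definition std_gaussian :: "'a::euclidean_space measure" where
  "std_gaussian = density lborel
     (\<lambda>x. ennreal (exp (- (norm x)\<^sup>2 / 2) / sqrt (2 * pi) ^ DIM('a)))"

text \<open>The innovations of a single step are triples \<open>(H, z, \<xi>)\<close>: \<open>H i\<close> is \<open>H\<^sub>k\<^sub>,\<^sub>i\<close>, \<open>z i\<close> is
  \<open>\<xi>\<^sub>k\<^sub>,\<^sub>i\<close> (both for \<open>i < K\<close>) and \<open>\<xi>\<close> is \<open>\<xi>\<^sub>k\<^sub>+\<^sub>1\<close>. The product measure expresses that they are all
  independent of each other.\<close>

definition prlmc_noise ::
  "nat \<Rightarrow> ((nat \<Rightarrow> bool) \<times> (nat \<Rightarrow> 'a::euclidean_space) \<times> 'a) measure" where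
  "prlmc_noise K =
     (\<Pi>\<^sub>M i\<in>{..<K}. measure_pmf (bernoulli_pmf (1 / real K)))
     \<Otimes>\<^sub>M (\<Pi>\<^sub>M i\<in>{..<K}. std_gaussian) \<Otimes>\<^sub>M std_gaussian"

text \<open>Below, \<open>g\<close> stands for the gradient of the potential and \<open>\<eta>\<close> for the step size.\<close>

definition prlmc_midpoint ::
  "('a::euclidean_space \<Rightarrow> 'a) \<Rightarrow> real \<Rightarrow> nat \<Rightarrow> 'a \<Rightarrow> nat \<Rightarrow> 'a \<Rightarrow> 'a" where
  "prlmc_midpoint g \<eta> K x i z =
     x - (real i * \<eta> / real K) *\<^sub>R g x + sqrt (2 * real i * \<eta> / real K) *\<^sub>R z"

definition prlmc_step ::
  "('a::euclidean_space \<Rightarrow> 'a) \<Rightarrow> real \<Rightarrow> nat \<Rightarrow> 'a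
     \<Rightarrow> (nat \<Rightarrow> bool) \<times> (nat \<Rightarrow> 'a) \<times> 'a \<Rightarrow> 'a" where
  "prlmc_step g \<eta> K x = (\<lambda>(H, z, \<xi>).
     x - \<eta> *\<^sub>R g x
       + \<eta> *\<^sub>R (\<Sum>i<K. of_bool (H i) *\<^sub>R (g x - g (prlmc_midpoint g \<eta> K x i (z i))))
       + sqrt (2 * \<eta>) *\<^sub>R \<xi>)"

text \<open>The transition kernel: the law of the next state, given that the current one is \<open>x\<close> and that
  the innovations are independent of it.\<close>

definition prlmc_kernel ::
  "('a::euclidean_space \<Rightarrow> 'a) \<Rightarrow> real \<Rightarrow> nat \<Rightarrow> 'a \<Rightarrow> 'a measure" where
  "prlmc_kernel g \<eta> K x = distr (prlmc_noise K) borel (prlmc_step g \<eta> K x)"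

definition stationary_distribution ::
  "('a::topological_space \<Rightarrow> 'a measure) \<Rightarrow> 'a measure \<Rightarrow> bool" where
  "stationary_distribution P \<mu> \<longleftrightarrow>
     prob_space \<mu> \<and> sets \<mu> = sets borel \<and> \<mu> \<bind> P = \<mu>"

definition gibbs_measure :: "('a::euclidean_space \<Rightarrow> real) \<Rightarrow> 'a measure" where
  "gibbs_measure U = density lborel
     (\<lambda>x. ennreal (exp (- U x) / (\<integral>y. exp (- U y) \<partial>lborel)))"

definition couplings ::
  "'a::euclidean_space measure \<Rightarrow> 'a measure \<Rightarrow> ('a \<times> 'a) measure set" where
  "couplings \<mu> \<nu> = {\<gamma>. sets \<gamma> = sets (borel \<Otimes>\<^sub>M borel)
     \<and> distr \<gamma> borel fst = \<mu> \<and> distr \<gamma> borel snd = \<nu>}"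

definition ennreal_sqrt :: "ennreal \<Rightarrow> ennreal" where
  "ennreal_sqrt c = (if c = \<top> then \<top> else ennreal (sqrt (enn2real c)))"

text \<open>The distance takes values in \<open>[0, \<infinity>]\<close>, so that an upper bound on it by a real number includes
  its finiteness.\<close>

definition wasserstein2 :: "'a::euclidean_space measure \<Rightarrow> 'a measure \<Rightarrow> ennreal" where
  "wasserstein2 \<mu> \<nu> = ennreal_sqrt
     (INF \<gamma>\<in>couplings \<mu> \<nu>. \<integral>\<^sup>+ p. ennreal ((norm (fst p - snd p))\<^sup>2) \<partial>\<gamma>)"

end

theory Submission
  imports Defs
begin

text \<open>The proof compares a step of the chain with the Langevin dynamics started from the Gibbs measure
  \<open>\<pi>\<close> and run for the time \<open>\<eta>\<close> with the same Gaussian noise. The Langevin dynamics is represented in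
  discrete time by random walk Metropolis with proposals \<open>x + c z\<close>, \<open>z\<close> standard Gaussian, for small
  \<open>c\<close>: this chain leaves \<open>\<pi>\<close> exactly invariant (\<open>gibbs_rwm_invariant\<close>). A proposal is rejected with probability about
  \<open>c (z \<bullet> \<nabla>U x)\<^sup>+\<close>, and the average of the moves lost in this way is \<open>c\<^sup>2 / 2\<close> times the gradient, so that
  a Metropolis step is an Euler step of the Langevin dynamics over the time \<open>c\<^sup>2 / 2\<close> up to an error with mean
  and variance of order \<open>c\<^sup>3\<close> (\<open>rwm_error_bounds\<close>). Over the time \<open>\<eta>\<close> there are \<open>2 \<eta> / c\<^sup>2\<close>
  steps. The means add up to order \<open>c\<close>, and so do the variances, because the fluctuations of different
  steps are orthogonal (\<open>l2_norm_add_noise\<close>). All of this vanishes as \<open>c\<close> tends to \<open>0\<close>.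

  Let \<open>X\<close> be the stationary Metropolis chain in this time scale, in dimension \<open>d\<close>. By convexity,
  \<open>E[(X\<^sub>0 - X\<^sub>t) \<bullet> \<nabla>U X\<^sub>t] \<le> E[U X\<^sub>0 - U X\<^sub>t] = 0\<close>, so the drift does not increase the mean-square
  displacement, and \<open>E|X\<^sub>t - X\<^sub>0|\<^sup>2 \<le> 2 d t\<close> in the limit (\<open>chain_displacement_step\<close>). As \<open>\<nabla>U\<close> is
  \<open>L\<close>-Lipschitz, \<open>X\<^sub>\<eta>\<close> differs from \<open>X\<^sub>0 - \<eta> \<nabla>U X\<^sub>0 + sqrt (2 \<eta>) \<xi>\<close> by at most
  \<open>L \<eta> sqrt (2 \<eta> d)\<close> in \<open>L\<^sup>2\<close> (\<open>chain_langevin_error\<close>). Here \<open>\<xi>\<close> is the normalised sum of the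
  Gaussian variables of the chain, which is standard Gaussian and independent of \<open>X\<^sub>0\<close>
  (\<open>nn_integral_chain_noise\<close>).

  Now let \<open>(Y\<^sub>0, X\<^sub>0)\<close> be any coupling of \<open>\<pi>\<^sub>\<eta>\<close> and \<open>\<pi>\<close>, and let \<open>\<xi>\<close> drive the step from \<open>Y\<^sub>0\<close>
  to \<open>Y\<^sub>1\<close> as well. In \<open>Y\<^sub>1 - X\<^sub>\<eta>\<close> the noise cancels. The gradient steps contract the distance by the factor
  \<open>1 - m \<eta>\<close> (\<open>gradient_step_contraction\<close>), and two errors remain: the one above, and \<open>\<eta>\<close> times the sum over
  the selected midpoints, whose second moment is bounded by \<open>nn_integral_midpoint_sum_le\<close>. Both \<open>\<pi>\<^sub>\<eta>\<close>
  and \<open>\<pi>\<close> are stationary, so \<open>(Y\<^sub>1, X\<^sub>\<eta>)\<close> is again a coupling of the two (\<open>coupled_step\<close>). Hence the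
  Wasserstein distance \<open>W\<close> satisfies \<open>W \<le> (1 - m \<eta>) W + E\<close> with \<open>E\<close> the sum of the two errors, that is
  \<open>W \<le> E / (m \<eta>)\<close> (\<open>wasserstein2_le_of_contraction\<close>), which implies the claim.\<close>

section \<open>Square-integrable vector-valued functions\<close>

definition square_integrable :: "'s measure \<Rightarrow> ('s \<Rightarrow> 'b::euclidean_space) \<Rightarrow> bool" where
  "square_integrable M f \<longleftrightarrow> f \<in> borel_measurable M \<and> integrable M (\<lambda>x. (norm (f x))\<^sup>2)"

definition l2_norm :: "'s measure \<Rightarrow> ('s \<Rightarrow> 'b::euclidean_space) \<Rightarrow> real" where
  "l2_norm M f = sqrt (\<integral>x. (norm (f x))\<^sup>2 \<partial>M)"

lemma square_integrableD [dest]: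
  assumes "square_integrable M f"
  shows "f \<in> borel_measurable M" "integrable M (\<lambda>x. (norm (f x))\<^sup>2)"
  using assms by (auto simp: square_integrable_def)

lemma l2_norm_nonneg [simp]: "0 \<le> l2_norm M f"
  by (simp add: l2_norm_def)

lemma l2_norm_power2: "(l2_norm M f)\<^sup>2 = (\<integral>x. (norm (f x))\<^sup>2 \<partial>M)"
  by (simp add: l2_norm_def)

lemma square_integrable_bound:
  assumes "f \<in> borel_measurable M" "integrable M g" "\<And>x. x \<in> space M \<Longrightarrow> (norm (f x))\<^sup>2 \<le> g x"
  shows "square_integrable M f"
  unfolding square_integrable_def
proof
  show "integrable M (\<lambda>x. (norm (f x))\<^sup>2)"
    by (rule Bochner_Integration.integrable_bound[OF assms(2)])
       (use assms in \<open>auto intro!: AE_I2 order_trans[OF assms(3)]\<close>)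
qed (use assms in auto)

lemma power2_norm_add_le:
  fixes a b :: "'b::real_inner"
  shows "(norm (a + b))\<^sup>2 \<le> 2 * (norm a)\<^sup>2 + 2 * (norm b)\<^sup>2"
proof -
  have "0 \<le> (norm (a - b))\<^sup>2"
    by simp
  then show ?thesis
    by (simp add: power2_norm_eq_inner inner_add_left inner_add_right inner_diff_left
        inner_diff_right inner_commute)
qed

lemma square_integrable_add:
  assumes "square_integrable M f" "square_integrable M g"
  shows "square_integrable M (\<lambda>x. f x + g x)"
proof (rule square_integrable_bound)
  show "integrable M (\<lambda>x. 2 * (norm (f x))\<^sup>2 + 2 * (norm (g x))\<^sup>2)"
    using assms by (intro Bochner_Integration.integrable_add integrable_mult_right) auto
qed (use assms power2_norm_add_le in \<open>auto intro!: borel_measurable_add\<close>)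

lemma square_integrable_scaleR:
  assumes "square_integrable M f"
  shows "square_integrable M (\<lambda>x. c *\<^sub>R f x)"
  using assms by (auto simp: square_integrable_def power_mult_distrib)

lemma square_integrable_diff:
  assumes "square_integrable M f" "square_integrable M g"
  shows "square_integrable M (\<lambda>x. f x - g x)"
  using square_integrable_add[OF assms(1) square_integrable_scaleR[OF assms(2), of "-1"]] by simp

lemma square_integrable_inner:
  assumes "square_integrable M f" "square_integrable M g"
  shows "integrable M (\<lambda>x. f x \<bullet> g x)"
proof (rule Bochner_Integration.integrable_bound)
  show "integrable M (\<lambda>x. (norm (f x))\<^sup>2 + (norm (g x))\<^sup>2)"
    using assms by (intro Bochner_Integration.integrable_add) auto
  show "AE x in M. norm (f x \<bullet> g x) \<le> norm ((norm (f x))\<^sup>2 + (norm (g x))\<^sup>2)"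
  proof (rule AE_I2)
    fix x
    have "\<bar>f x \<bullet> g x\<bar> \<le> norm (f x) * norm (g x)"
      by (rule Cauchy_Schwarz_ineq2)
    also have "\<dots> \<le> (norm (f x))\<^sup>2 + (norm (g x))\<^sup>2"
      using sum_squares_bound[of "norm (f x)" "norm (g x)"]
        mult_nonneg_nonneg[OF norm_ge_zero[of "f x"] norm_ge_zero[of "g x"]] by linarith
    finally show "norm (f x \<bullet> g x) \<le> norm ((norm (f x))\<^sup>2 + (norm (g x))\<^sup>2)"
      by simp
  qed
qed (use assms in \<open>auto intro!: borel_measurable_inner\<close>)

lemma l2_norm_cauchy_schwarz:
  assumes f: "square_integrable M f" and g: "square_integrable M g"
  shows "(\<integral>x. f x \<bullet> g x \<partial>M) \<le> l2_norm M f * l2_norm M g"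
proof -
  define a b where "a = l2_norm M f" and "b = l2_norm M g"
  have [simp]: "0 \<le> a" "0 \<le> b"
    by (auto simp: a_def b_def)
  have int: "integrable M (\<lambda>x. f x \<bullet> g x)"
    by (rule square_integrable_inner[OF f g])
  \<comment> \<open>Integrating the weighted arithmetic-geometric mean inequality; the weight \<open>(b + e) / (a + e)\<close>
      is optimal up to \<open>e\<close> and harmless when one of the norms vanishes.\<close>
  have bound: "(\<integral>x. f x \<bullet> g x \<partial>M) \<le> (a + e) * (b + e)" if "e > 0" for e
  proof -
    define t where "t = (b + e) / (a + e)"
    have t: "t > 0"
      using that by (simp add: t_def add_nonneg_pos)
    have pw: "2 * (f x \<bullet> g x) \<le> t * (norm (f x))\<^sup>2 + (norm (g x))\<^sup>2 / t" for x
    proof -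
      have "0 \<le> (norm (t *\<^sub>R f x - g x))\<^sup>2"
        by simp
      also have "\<dots> = t * (t * (norm (f x))\<^sup>2 - 2 * (f x \<bullet> g x)) + (norm (g x))\<^sup>2"
        unfolding power2_norm_eq_inner
        by (simp add: inner_diff_left inner_diff_right inner_commute algebra_simps)
      finally show ?thesis
        using t by (simp add: field_simps)
    qed
    have "2 * (\<integral>x. f x \<bullet> g x \<partial>M) = (\<integral>x. 2 * (f x \<bullet> g x) \<partial>M)"
      by simp
    also have "\<dots> \<le> (\<integral>x. t * (norm (f x))\<^sup>2 + (norm (g x))\<^sup>2 / t \<partial>M)"
      using square_integrableD(2)[OF f] square_integrableD(2)[OF g] int pw
      by (intro integral_mono) auto
    also have "\<dots> = t * a\<^sup>2 + b\<^sup>2 / t"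
      using square_integrableD(2)[OF f] square_integrableD(2)[OF g]
      by (subst Bochner_Integration.integral_add) (auto simp: a_def b_def l2_norm_power2)
    also have "\<dots> \<le> t * (a + e)\<^sup>2 + (b + e)\<^sup>2 / t"
      using t that by (intro add_mono mult_left_mono divide_right_mono power_mono) auto
    also have "\<dots> = 2 * ((a + e) * (b + e))"
    proof -
      have "a + e \<noteq> 0" "b + e \<noteq> 0"
        using that add_nonneg_pos[of a e] add_nonneg_pos[of b e] by auto
      then show ?thesis
        by (simp add: t_def power2_eq_square)
    qed
    finally show ?thesis by simp
  qed
  have "((\<lambda>e. (a + e) * (b + e)) \<longlongrightarrow> (a + 0) * (b + 0)) (at_right 0)"
    by (intro tendsto_intros)
  then have "(\<integral>x. f x \<bullet> g x \<partial>M) \<le> (a + 0) * (b + 0)"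
    by (rule tendsto_lowerbound) (auto simp: eventually_at_right_less bound
        intro: eventually_mono[OF eventually_at_right_less])
  then show ?thesis by (simp add: a_def b_def)
qed

lemma l2_norm_triangle:
  assumes f: "square_integrable M f" and g: "square_integrable M g"
  shows "l2_norm M (\<lambda>x. f x + g x) \<le> l2_norm M f + l2_norm M g"
proof (rule power2_le_imp_le)
  have "(l2_norm M (\<lambda>x. f x + g x))\<^sup>2 = (\<integral>x. (norm (f x))\<^sup>2 + 2 * (f x \<bullet> g x) + (norm (g x))\<^sup>2 \<partial>M)"
    by (simp add: l2_norm_power2 power2_norm_eq_inner inner_add_left inner_add_right inner_commute
        algebra_simps)
  also have "\<dots> = (l2_norm M f)\<^sup>2 + 2 * (\<integral>x. f x \<bullet> g x \<partial>M) + (l2_norm M g)\<^sup>2"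
    using f g square_integrable_inner[OF f g]
    by (simp add: l2_norm_power2 square_integrableD)
  also have "\<dots> \<le> (l2_norm M f + l2_norm M g)\<^sup>2"
    using l2_norm_cauchy_schwarz[OF f g] by (simp add: power2_eq_square algebra_simps)
  finally show "(l2_norm M (\<lambda>x. f x + g x))\<^sup>2 \<le> (l2_norm M f + l2_norm M g)\<^sup>2" .
qed simp

lemma l2_norm_scaleR: "l2_norm M (\<lambda>x. c *\<^sub>R f x) = \<bar>c\<bar> * l2_norm M f"
  by (simp add: l2_norm_def power_mult_distrib real_sqrt_mult)

lemma l2_norm_mono:
  assumes g: "square_integrable M g" and f: "f \<in> borel_measurable M"
    and "\<And>x. x \<in> space M \<Longrightarrow> norm (f x) \<le> norm (g x)"
  shows "l2_norm M f \<le> l2_norm M g"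
  unfolding l2_norm_def
  by (rule real_sqrt_le_mono, rule integral_mono_AE')
     (use assms in \<open>auto intro!: AE_I2 power_mono\<close>)

lemma square_integrable_mono:
  assumes g: "square_integrable M g" and f: "f \<in> borel_measurable M"
    and "\<And>x. x \<in> space M \<Longrightarrow> norm (f x) \<le> norm (g x)"
  shows "square_integrable M f"
  by (rule square_integrable_bound[OF f square_integrableD(2)[OF g]])
     (use assms in \<open>auto intro!: power_mono\<close>)

lemma square_integrable_distr:
  assumes "f \<in> measurable M N" "g \<in> borel_measurable N"
  shows "square_integrable (distr M N f) g \<longleftrightarrow> square_integrable M (\<lambda>x. g (f x))"
  using assms by (auto simp: square_integrable_def integrable_distr_eq)

lemma l2_norm_distr:
  assumes "f \<in> measurable M N" "g \<in> borel_measurable N"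
  shows "l2_norm (distr M N f) g = l2_norm M (\<lambda>x. g (f x))"
  using assms by (simp add: l2_norm_def integral_distr)

lemma integral_le_of_nn_integral_le:
  assumes [measurable]: "f \<in> borel_measurable M" and nonneg: "\<And>x. 0 \<le> f x"
    and le: "(\<integral>\<^sup>+x. ennreal (f x) \<partial>M) \<le> ennreal B" and B: "0 \<le> B"
  shows "integrable M f \<and> (\<integral>x. f x \<partial>M) \<le> B"
proof
  show "integrable M f"
    using le nonneg by (intro integrableI_nonneg) (auto intro: le_less_trans)
  then have "ennreal (\<integral>x. f x \<partial>M) \<le> ennreal B"
    using le nonneg by (subst nn_integral_eq_integral[symmetric]) auto
  then show "(\<integral>x. f x \<partial>M) \<le> B"
    using B by simp
qed

lemma distr_pair_snd:
  assumes "prob_space M" "prob_space N"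
  shows "distr (M \<Otimes>\<^sub>M N) N snd = N"
proof -
  interpret M: prob_space M by fact
  interpret N: prob_space N by fact
  interpret P: pair_sigma_finite M N ..
  have "distr (M \<Otimes>\<^sub>M N) N snd = distr (distr (N \<Otimes>\<^sub>M M) (M \<Otimes>\<^sub>M N) (\<lambda>(x, y). (y, x))) N snd"
    by (simp only: P.distr_pair_swap[symmetric])
  also have "\<dots> = distr (N \<Otimes>\<^sub>M M) N fst"
    by (subst distr_distr) (auto simp: comp_def split_beta')
  also have "\<dots> = N"
    by (rule M.distr_pair_fst)
  finally show ?thesis .
qed

text \<open>The mean of \<open>e\<close> given the first component adds up linearly with \<open>f\<close>, whereas its fluctuation
  only adds up quadratically, because it is orthogonal to \<open>f\<close>. This is what makes local errors of
  small conditional mean accumulate slowly along a Markov chain.\<close>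

lemma l2_norm_add_noise:
  fixes f :: "'s \<Rightarrow> 'b::euclidean_space" and e :: "'s \<times> 't \<Rightarrow> 'b"
  assumes M: "prob_space M" and R: "prob_space R"
    and f: "square_integrable M f" and e: "square_integrable (M \<Otimes>\<^sub>M R) e"
  defines "ebar \<equiv> \<lambda>x. \<integral>r. e (x, r) \<partial>R"
  shows "(\<integral>p. (norm (f (fst p) + e p))\<^sup>2 \<partial>(M \<Otimes>\<^sub>M R)) =
      (\<integral>x. (norm (f x))\<^sup>2 \<partial>M) + 2 * (\<integral>x. f x \<bullet> ebar x \<partial>M) + (\<integral>p. (norm (e p))\<^sup>2 \<partial>(M \<Otimes>\<^sub>M R))"
proof -
  interpret M: prob_space M by (rule M)
  interpret R: prob_space R by (rule R)
  interpret P: pair_prob_space M R ..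
  have [measurable]: "f \<in> borel_measurable M" "e \<in> borel_measurable (M \<Otimes>\<^sub>M R)"
    using f e by auto
  have distr_fst: "distr (M \<Otimes>\<^sub>M R) M fst = M"
    by (rule R.distr_pair_fst)
  have f1: "square_integrable (M \<Otimes>\<^sub>M R) (\<lambda>p. f (fst p))"
    using f square_integrable_distr[of fst "M \<Otimes>\<^sub>M R" M f] distr_fst by simp
  have sq_f: "(\<integral>p. (norm (f (fst p)))\<^sup>2 \<partial>(M \<Otimes>\<^sub>M R)) = (\<integral>x. (norm (f x))\<^sup>2 \<partial>M)"
    using integral_distr[of fst "M \<Otimes>\<^sub>M R" M "\<lambda>x. (norm (f x))\<^sup>2"] distr_fst by simp
  have int_e: "integrable (M \<Otimes>\<^sub>M R) e"
  proof (rule Bochner_Integration.integrable_bound)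
    show "integrable (M \<Otimes>\<^sub>M R) (\<lambda>p. 1 + (norm (e p))\<^sup>2)"
      using e by (intro Bochner_Integration.integrable_add) auto
    show "AE p in M \<Otimes>\<^sub>M R. norm (e p) \<le> norm (1 + (norm (e p))\<^sup>2)"
    proof (rule AE_I2)
      fix p
      have "0 \<le> (norm (e p) - 1)\<^sup>2" by simp
      then show "norm (e p) \<le> norm (1 + (norm (e p))\<^sup>2)"
        by (simp add: power2_eq_square algebra_simps) (smt (verit) norm_ge_zero)
    qed
  qed simp
  have int_fe: "integrable (M \<Otimes>\<^sub>M R) (\<lambda>p. f (fst p) \<bullet> e p)"
    by (rule square_integrable_inner[OF f1 e])
  have "(\<integral>p. f (fst p) \<bullet> e p \<partial>(M \<Otimes>\<^sub>M R)) = (\<integral>x. (\<integral>r. f x \<bullet> e (x, r) \<partial>R) \<partial>M)"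
    using int_fe by (subst P.integral_fst'[symmetric]) auto
  also have "\<dots> = (\<integral>x. f x \<bullet> ebar x \<partial>M)"
  proof (rule integral_cong_AE)
    have "AE x in M. integrable R (\<lambda>r. e (x, r))"
      using int_e by (rule P.AE_integrable_fst')
    then show "AE x in M. (\<integral>r. f x \<bullet> e (x, r) \<partial>R) = f x \<bullet> ebar x"
      by eventually_elim (simp add: ebar_def)
  qed (auto simp: ebar_def)
  finally have cross: "(\<integral>p. f (fst p) \<bullet> e p \<partial>(M \<Otimes>\<^sub>M R)) = (\<integral>x. f x \<bullet> ebar x \<partial>M)" .
  have "(\<integral>p. (norm (f (fst p) + e p))\<^sup>2 \<partial>(M \<Otimes>\<^sub>M R)) =
      (\<integral>p. (norm (f (fst p)))\<^sup>2 + 2 * (f (fst p) \<bullet> e p) + (norm (e p))\<^sup>2 \<partial>(M \<Otimes>\<^sub>M R))"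
    by (simp add: power2_norm_eq_inner inner_add_left inner_add_right inner_commute algebra_simps)
  also have "\<dots> = (\<integral>p. (norm (f (fst p)))\<^sup>2 \<partial>(M \<Otimes>\<^sub>M R)) + 2 * (\<integral>p. f (fst p) \<bullet> e p \<partial>(M \<Otimes>\<^sub>M R))
      + (\<integral>p. (norm (e p))\<^sup>2 \<partial>(M \<Otimes>\<^sub>M R))"
    using f1 e int_fe by (simp add: square_integrableD)
  finally show ?thesis
    by (simp add: sq_f cross)
qed

text \<open>Deterministic errors \<open>a\<close> add up linearly, orthogonal ones of variance \<open>\<delta>\<close> in the square. The bound
  survives a step because \<open>(A + sqrt (k \<delta>))\<^sup>2 + \<delta> \<le> (A + sqrt ((k + 1) \<delta>))\<^sup>2\<close> for \<open>A \<ge> 0\<close>.\<close>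

lemma error_accumulation:
  fixes \<rho> :: "nat \<Rightarrow> real"
  assumes "\<rho> 0 \<le> 0" and a: "0 \<le> a" and d: "0 \<le> \<delta>" and nonneg: "\<And>k. 0 \<le> \<rho> k"
    and step: "\<And>k. k < n \<Longrightarrow> (\<rho> (Suc k))\<^sup>2 \<le> (\<rho> k + a)\<^sup>2 + \<delta>"
  shows "k \<le> n \<Longrightarrow> \<rho> k \<le> real k * a + sqrt (real k * \<delta>)"
proof (induction k)
  case 0
  then show ?case using assms by simp
next
  case (Suc k)
  define A where "A = real (Suc k) * a"
  have A: "0 \<le> A" using a by (simp add: A_def)
  have IH: "\<rho> k + a \<le> A + sqrt (real k * \<delta>)"
    using Suc by (simp add: A_def algebra_simps)
  have "(\<rho> (Suc k))\<^sup>2 \<le> (\<rho> k + a)\<^sup>2 + \<delta>"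
    using Suc.prems by (intro step) simp
  also have "\<dots> \<le> (A + sqrt (real k * \<delta>))\<^sup>2 + \<delta>"
    using nonneg[of k] a IH by (intro add_right_mono power_mono) auto
  also have "\<dots> = A\<^sup>2 + 2 * A * sqrt (real k * \<delta>) + real (Suc k) * \<delta>"
    using d by (simp add: power2_sum algebra_simps)
  also have "\<dots> \<le> A\<^sup>2 + 2 * A * sqrt (real (Suc k) * \<delta>) + real (Suc k) * \<delta>"
    using A d by (intro add_mono mult_left_mono order_refl real_sqrt_le_mono mult_right_mono) auto
  also have "\<dots> = (A + sqrt (real (Suc k) * \<delta>))\<^sup>2"
    using d by (simp add: power2_sum del: of_nat_Suc)
  finally show ?case
    using A d by (intro power2_le_imp_le[of "\<rho> (Suc k)"]) (auto simp: A_def)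
qed

section \<open>The standard Gaussian measure\<close>

lemma nn_integral_lborel_affine:
  fixes f :: "'a::euclidean_space \<Rightarrow> ennreal"
  assumes [measurable]: "f \<in> borel_measurable borel" and c: "c \<noteq> 0"
  shows "(\<integral>\<^sup>+x. f x \<partial>lborel) = ennreal (\<bar>c\<bar> ^ DIM('a)) * (\<integral>\<^sup>+x. f (t + c *\<^sub>R x) \<partial>lborel)"
  by (subst lborel_affine[OF c, of t])
     (simp add: nn_integral_density nn_integral_distr nn_integral_cmult)

lemma integral_lborel_prod:
  fixes f :: "'a::euclidean_space \<Rightarrow> real \<Rightarrow> real"
  assumes "\<And>b. b \<in> Basis \<Longrightarrow> integrable lborel (f b)"
  shows "(\<integral>x. (\<Prod>b\<in>Basis. f b (x \<bullet> b)) \<partial>lborel) = (\<Prod>b\<in>Basis. (\<integral>t. f b t \<partial>lborel))"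
proof -
  interpret product_sigma_finite "\<lambda>_::'a. lborel::real measure"
    by standard
  have [measurable]: "\<And>b. b \<in> Basis \<Longrightarrow> f b \<in> borel_measurable borel"
    using assms by (auto dest: borel_measurable_integrable)
  have "(\<integral>x. (\<Prod>b\<in>Basis. f b (x \<bullet> b)) \<partial>lborel) =
      (\<integral>x. (\<Prod>b\<in>Basis. f b ((\<Sum>i\<in>Basis. x i *\<^sub>R i) \<bullet> b)) \<partial>(\<Pi>\<^sub>M b\<in>Basis. lborel))"
    by (subst lborel_eq, subst integral_distr) measurable
  also have "\<dots> = (\<integral>x. (\<Prod>b\<in>Basis. f b (x b)) \<partial>(\<Pi>\<^sub>M b\<in>Basis. lborel))"
    by (intro Bochner_Integration.integral_cong refl prod.cong) auto
  also have "\<dots> = (\<Prod>b\<in>Basis. (\<integral>t. f b t \<partial>lborel))"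
    by (intro product_integral_prod) (auto simp: assms)
  finally show ?thesis .
qed

definition gaussian_density :: "'a::euclidean_space \<Rightarrow> real" where
  "gaussian_density x = exp (- (norm x)\<^sup>2 / 2) / sqrt (2 * pi) ^ DIM('a)"

lemma gaussian_density_nonneg [simp]: "0 \<le> gaussian_density x"
  by (simp add: gaussian_density_def)

lemma gaussian_density_minus [simp]: "gaussian_density (- x) = gaussian_density x"
  by (simp add: gaussian_density_def)

lemma borel_measurable_gaussian_density [measurable]: "gaussian_density \<in> borel_measurable borel"
  unfolding gaussian_density_def[abs_def] by measurable

lemma gaussian_density_prod:
  fixes x :: "'a::euclidean_space"
  shows "gaussian_density x = (\<Prod>b\<in>Basis. std_normal_density (x \<bullet> b))"
proof -
  have "- (norm x)\<^sup>2 / 2 = (\<Sum>b\<in>Basis. - (x \<bullet> b)\<^sup>2 / 2)"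
    by (subst power2_norm_eq_inner, subst euclidean_inner)
       (simp add: power2_eq_square sum_negf sum_divide_distrib)
  then show ?thesis
    by (simp add: gaussian_density_def std_normal_density_def exp_sum prod_dividef)
qed

lemma std_gaussian_density: "std_gaussian = density lborel (\<lambda>x. ennreal (gaussian_density x))"
  by (simp add: std_gaussian_def gaussian_density_def)

lemma space_std_gaussian [simp]: "space std_gaussian = UNIV"
  by (simp add: std_gaussian_def)

lemma sets_std_gaussian [simp, measurable_cong]: "sets std_gaussian = sets borel"
  by (simp add: std_gaussian_def)

lemma nn_integral_gaussian_density:
  "(\<integral>\<^sup>+x. ennreal (gaussian_density (x::'a::euclidean_space)) \<partial>lborel) = 1"
proof -
  have "(\<integral>\<^sup>+(x::'a). ennreal (gaussian_density x) \<partial>lborel)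
      = (\<integral>\<^sup>+(x::'a). (\<Prod>b\<in>Basis. ennreal (std_normal_density (x \<bullet> b))) \<partial>lborel)"
    by (simp add: gaussian_density_prod prod_ennreal)
  also have "\<dots> = (\<Prod>b\<in>(Basis::'a set). (\<integral>\<^sup>+x. ennreal (std_normal_density x) \<partial>lborel))"
    by (rule nn_integral_lborel_prod) auto
  also have "\<dots> = 1"
    by (simp add: nn_integral_eq_integral)
  finally show ?thesis .
qed

lemma prob_space_std_gaussian: "prob_space std_gaussian"
  by standard (simp add: std_gaussian_density emeasure_density nn_integral_gaussian_density)

lemma nn_integral_std_gaussian:
  assumes [measurable]: "f \<in> borel_measurable borel"
  shows "(\<integral>\<^sup>+x. f x \<partial>std_gaussian) = (\<integral>\<^sup>+x. ennreal (gaussian_density x) * f x \<partial>lborel)"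
  by (simp add: std_gaussian_density nn_integral_density)

lemma integral_std_gaussian:
  fixes f :: "'a::euclidean_space \<Rightarrow> 'b::euclidean_space"
  assumes [measurable]: "f \<in> borel_measurable borel"
  shows "(\<integral>x. f x \<partial>std_gaussian) = (\<integral>x. gaussian_density x *\<^sub>R f x \<partial>lborel)"
  by (simp add: std_gaussian_density integral_density)

lemma integrable_std_gaussian:
  fixes f :: "'a::euclidean_space \<Rightarrow> 'b::euclidean_space"
  assumes [measurable]: "f \<in> borel_measurable borel"
  shows "integrable std_gaussian f \<longleftrightarrow> integrable lborel (\<lambda>x. gaussian_density x *\<^sub>R f x)"
  by (simp add: std_gaussian_density integrable_density)

lemma distr_std_gaussian_minus:
  "distr std_gaussian borel uminus = (std_gaussian :: 'a::euclidean_space measure)"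
proof (rule measure_eqI)
  fix A :: "'a set" assume "A \<in> sets (distr std_gaussian borel uminus)"
  then have [measurable]: "A \<in> sets borel" by simp
  have "emeasure (distr std_gaussian borel uminus) A = (\<integral>\<^sup>+x. indicator A (- x) \<partial>std_gaussian)"
    by (subst nn_integral_indicator[symmetric], simp, subst nn_integral_distr) auto
  also have "\<dots> = (\<integral>\<^sup>+x. ennreal (gaussian_density (- x)) * indicator A (- x) \<partial>lborel)"
    by (subst nn_integral_std_gaussian) auto
  also have "\<dots> = (\<integral>\<^sup>+x. ennreal (gaussian_density x) * indicator A x \<partial>lborel)"
    by (subst nn_integral_lborel_affine[where c="-1" and t=0
          and f="\<lambda>x. ennreal (gaussian_density x) * indicator A x"]) auto
  also have "\<dots> = emeasure std_gaussian A"
    by (subst nn_integral_std_gaussian[symmetric]) auto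
  finally show "emeasure (distr std_gaussian borel uminus) A = emeasure std_gaussian A" .
qed simp

lemma nn_integral_std_gaussian_minus:
  assumes [measurable]: "f \<in> borel_measurable (borel :: 'a::euclidean_space measure)"
  shows "(\<integral>\<^sup>+x. f (- x) \<partial>std_gaussian) = (\<integral>\<^sup>+x. f x \<partial>std_gaussian)"
  by (subst (2) distr_std_gaussian_minus[symmetric], subst nn_integral_distr) auto

lemma integral_std_gaussian_minus:
  fixes f :: "'a::euclidean_space \<Rightarrow> 'b::euclidean_space"
  assumes [measurable]: "f \<in> borel_measurable borel"
  shows "(\<integral>x. f (- x) \<partial>std_gaussian) = (\<integral>x. f x \<partial>std_gaussian)"
  by (subst (2) distr_std_gaussian_minus[symmetric], subst integral_distr) auto

lemma integral_std_gaussian_id: "(\<integral>z. z \<partial>(std_gaussian :: 'a::euclidean_space measure)) = 0"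
proof -
  have "(\<integral>z. - z \<partial>(std_gaussian :: 'a measure)) = (\<integral>z. z \<partial>std_gaussian)"
    by (rule integral_std_gaussian_minus) auto
  moreover have "v = 0" if "- v = v" for v :: 'a
  proof -
    have "2 *\<^sub>R v = v - - v"
      by (simp add: scaleR_2)
    also have "\<dots> = 0"
      unfolding that by simp
    finally show ?thesis by simp
  qed
  ultimately show ?thesis by simp
qed

lemma integrable_exp_neg_norm_power2:
  assumes a: "a > 0"
  shows "integrable lborel (\<lambda>x::'a::euclidean_space. exp (- a * (norm x)\<^sup>2))"
proof (rule integrableI_bounded)
  define c where "c = 1 / sqrt (2 * a)"
  have c: "c > 0" "a * c\<^sup>2 = 1 / 2"
    using a by (auto simp: c_def power_divide)
  have "(\<integral>\<^sup>+(x::'a). ennreal (norm (exp (- a * (norm x)\<^sup>2))) \<partial>lborel)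
      = ennreal (\<bar>c\<bar> ^ DIM('a)) * (\<integral>\<^sup>+(x::'a). ennreal (exp (- a * (norm (0 + c *\<^sub>R x))\<^sup>2)) \<partial>lborel)"
    using c by (subst nn_integral_lborel_affine[where c=c and t=0]) auto
  also have "(\<integral>\<^sup>+(x::'a). ennreal (exp (- a * (norm (0 + c *\<^sub>R x))\<^sup>2)) \<partial>lborel)
      = (\<integral>\<^sup>+(x::'a). ennreal (sqrt (2 * pi) ^ DIM('a)) * ennreal (gaussian_density x) \<partial>lborel)"
  proof (intro nn_integral_cong)
    fix x :: 'a
    have "- a * (norm (0 + c *\<^sub>R x))\<^sup>2 = - (a * c\<^sup>2) * (norm x)\<^sup>2"
      by (simp add: power_mult_distrib)
    then have "exp (- a * (norm (0 + c *\<^sub>R x))\<^sup>2) = sqrt (2 * pi) ^ DIM('a) * gaussian_density x"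
      by (simp add: c gaussian_density_def)
    then show "ennreal (exp (- a * (norm (0 + c *\<^sub>R x))\<^sup>2))
        = ennreal (sqrt (2 * pi) ^ DIM('a)) * ennreal (gaussian_density x)"
      by (simp add: ennreal_mult)
  qed
  also have "\<dots> = ennreal (sqrt (2 * pi) ^ DIM('a))"
    by (simp add: nn_integral_cmult nn_integral_gaussian_density)
  also have "ennreal (\<bar>c\<bar> ^ DIM('a)) * \<dots> < \<infinity>"
    by (simp add: ennreal_mult_less_top)
  finally show "(\<integral>\<^sup>+(x::'a). ennreal (norm (exp (- a * (norm x)\<^sup>2))) \<partial>lborel) < \<infinity>" .
qed simp

lemma integrable_poly_exp_neg_norm_power2:
  assumes a: "a > 0"
  shows "integrable lborel (\<lambda>x::'a::euclidean_space. (1 + norm x) ^ k * exp (- a * (norm x)\<^sup>2))"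
proof (rule Bochner_Integration.integrable_bound)
  show "integrable lborel (\<lambda>x::'a. exp ((real k)\<^sup>2 / (2 * a)) * exp (- (a / 2) * (norm x)\<^sup>2))"
    using a by (intro integrable_mult_right integrable_exp_neg_norm_power2) auto
  show "AE x::'a in lborel. norm ((1 + norm x) ^ k * exp (- a * (norm x)\<^sup>2))
      \<le> norm (exp ((real k)\<^sup>2 / (2 * a)) * exp (- (a / 2) * (norm x)\<^sup>2))"
  proof (rule AE_I2)
    fix x :: 'a
    define r where "r = norm x"
    \<comment> \<open>\<open>(1 + r)\<^sup>k\<close> is at most \<open>exp (k r)\<close>; the square is completed so that half of the Gaussian decay
        is left.\<close>
    have "0 \<le> (a * r - real k)\<^sup>2 / (2 * a)"
      using a by simp
    also have "\<dots> = a * r\<^sup>2 / 2 - real k * r + (real k)\<^sup>2 / (2 * a)"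
      using a by (simp add: power2_diff field_simps power2_eq_square)
    finally have *: "real k * r - a * r\<^sup>2 \<le> (real k)\<^sup>2 / (2 * a) - (a / 2) * r\<^sup>2"
      by simp
    have "(1 + r) ^ k \<le> exp r ^ k"
      by (intro power_mono exp_ge_add_one_self) (auto simp: r_def)
    then have "(1 + r) ^ k * exp (- a * r\<^sup>2) \<le> exp (real k * r) * exp (- a * r\<^sup>2)"
      by (intro mult_right_mono) (auto simp: exp_of_nat_mult)
    also have "\<dots> \<le> exp ((real k)\<^sup>2 / (2 * a)) * exp (- (a / 2) * r\<^sup>2)"
      using * by (simp flip: exp_add)
    finally show "norm ((1 + norm x) ^ k * exp (- a * (norm x)\<^sup>2))
      \<le> norm (exp ((real k)\<^sup>2 / (2 * a)) * exp (- (a / 2) * (norm x)\<^sup>2))"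
      by (simp add: r_def)
  qed
qed simp

lemma integrable_std_gaussian_poly:
  "integrable std_gaussian (\<lambda>x::'a::euclidean_space. (1 + norm x) ^ k)"
proof -
  have "integrable lborel (\<lambda>x::'a. inverse (sqrt (2 * pi) ^ DIM('a)) *
      ((1 + norm x) ^ k * exp (- (1/2) * (norm x)\<^sup>2)))"
    by (intro integrable_mult_right integrable_poly_exp_neg_norm_power2) auto
  then show ?thesis
    by (subst integrable_std_gaussian) (auto simp: gaussian_density_def field_simps)
qed

lemma integrable_std_gaussian_growth:
  fixes f :: "'a::euclidean_space \<Rightarrow> 'b::euclidean_space"
  assumes "f \<in> borel_measurable borel" "\<And>x. norm (f x) \<le> C * (1 + norm x) ^ k"
  shows "integrable std_gaussian f"
proof (rule Bochner_Integration.integrable_bound)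
  show "integrable std_gaussian (\<lambda>x::'a. C * (1 + norm x) ^ k)"
    by (intro integrable_mult_right integrable_std_gaussian_poly)
qed (use assms in \<open>auto intro!: AE_I2 order_trans[OF assms(2)]\<close>)

lemma integral_std_gaussian_Basis:
  fixes b c :: "'a::euclidean_space"
  assumes b: "b \<in> Basis" and c: "c \<in> Basis"
  shows "(\<integral>x. (x \<bullet> b) * (x \<bullet> c) \<partial>std_gaussian) = (if b = c then 1 else 0)"
proof -
  define f :: "'a \<Rightarrow> real \<Rightarrow> real" where
    "f i t = std_normal_density t * t ^ (of_bool (i = b) + of_bool (i = c))" for i t
  have *: "gaussian_density x * ((x \<bullet> b) * (x \<bullet> c)) = (\<Prod>i\<in>Basis. f i (x \<bullet> i))" for x
  proof -
    have "(\<Prod>i\<in>Basis. (x \<bullet> i) ^ of_bool (i = j)) = x \<bullet> j" if "j \<in> Basis" for j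
      using that by (subst prod.remove[of _ j]) (auto intro!: prod.neutral)
    then show ?thesis
      using b c by (simp add: f_def gaussian_density_prod prod.distrib power_add)
  qed
  have "(\<integral>x. (x \<bullet> b) * (x \<bullet> c) \<partial>std_gaussian) = (\<integral>x. (\<Prod>i\<in>Basis. f i (x \<bullet> i)) \<partial>lborel)"
    by (simp add: integral_std_gaussian *)
  also have "\<dots> = (\<Prod>i\<in>Basis. (\<integral>t. f i t \<partial>lborel))"
    by (rule integral_lborel_prod) (auto simp only: f_def intro!: integrable_std_normal_moment)
  also have "\<dots> = (if b = c then 1 else 0)"
  proof (cases "b = c")
    case True
    have "(\<integral>t. f i t \<partial>lborel) = 1" for i
      using integral_std_normal_moment_even[of 1] True
      by (cases "i = b") (auto simp: f_def numeral_2_eq_2)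
    then show ?thesis using True by simp
  next
    case False
    have "(\<integral>t. f b t \<partial>lborel) = 0"
      using integral_std_normal_moment_odd[of 0] False by (simp add: f_def)
    then show ?thesis
      using b False by (auto intro!: prod_zero)
  qed
  finally show ?thesis .
qed

lemma std_gaussian_inner_product_bound:
  fixes x v w :: "'a::euclidean_space"
  shows "\<bar>(x \<bullet> v) * (x \<bullet> w)\<bar> \<le> (norm v * norm w) * (1 + norm x) ^ 2"
proof -
  have "\<bar>(x \<bullet> v) * (x \<bullet> w)\<bar> \<le> (norm x * norm v) * (norm x * norm w)"
    by (simp only: abs_mult) (intro mult_mono Cauchy_Schwarz_ineq2; simp)
  also have "\<dots> = (norm v * norm w) * (norm x)\<^sup>2"
    by (simp add: power2_eq_square)
  also have "\<dots> \<le> (norm v * norm w) * (1 + norm x) ^ 2"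
    by (intro mult_left_mono power_mono) auto
  finally show ?thesis .
qed

lemma integral_std_gaussian_inner:
  fixes v w :: "'a::euclidean_space"
  shows "(\<integral>x. (x \<bullet> v) * (x \<bullet> w) \<partial>std_gaussian) = v \<bullet> w"
proof -
  have int: "integrable std_gaussian (\<lambda>x. (x \<bullet> b) * (x \<bullet> c))" for b c :: 'a
    by (rule integrable_std_gaussian_growth[where C="norm b * norm c" and k=2])
       (use std_gaussian_inner_product_bound in auto)
  have *: "(x \<bullet> v) * (x \<bullet> w) = (\<Sum>b\<in>Basis. \<Sum>c\<in>Basis. (v \<bullet> b) * (w \<bullet> c) * ((x \<bullet> b) * (x \<bullet> c)))" for x
    by (subst (1 2) euclidean_inner) (simp add: sum_product mult_ac)
  have "(\<integral>x. (x \<bullet> v) * (x \<bullet> w) \<partial>std_gaussian) =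
      (\<Sum>b\<in>Basis. \<Sum>c\<in>Basis. (v \<bullet> b) * (w \<bullet> c) * (\<integral>x. (x \<bullet> b) * (x \<bullet> c) \<partial>std_gaussian))"
    unfolding * by (simp add: Bochner_Integration.integral_sum int)
  also have "\<dots> = (\<Sum>b\<in>Basis. (v \<bullet> b) * (w \<bullet> b))"
    by (intro sum.cong refl) (simp add: integral_std_gaussian_Basis if_distrib sum.delta' cong: if_cong)
  also have "\<dots> = v \<bullet> w"
    by (rule euclidean_inner[symmetric])
  finally show ?thesis .
qed

lemma integral_std_gaussian_norm_power2:
  "(\<integral>x. (norm x)\<^sup>2 \<partial>(std_gaussian :: 'a::euclidean_space measure)) = DIM('a)"
proof -
  have int: "integrable std_gaussian (\<lambda>x. (x \<bullet> b) * (x \<bullet> c))" for b c :: 'a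
    by (rule integrable_std_gaussian_growth[where C="norm b * norm c" and k=2])
       (use std_gaussian_inner_product_bound in auto)
  have "(\<integral>x. (norm x)\<^sup>2 \<partial>(std_gaussian :: 'a measure))
      = (\<integral>x. (\<Sum>b\<in>Basis. (x \<bullet> b) * (x \<bullet> b)) \<partial>(std_gaussian :: 'a measure))"
    by (simp add: power2_norm_eq_inner flip: euclidean_inner)
  also have "\<dots> = (\<Sum>b\<in>(Basis::'a set). b \<bullet> b)"
    by (simp add: Bochner_Integration.integral_sum int integral_std_gaussian_inner)
  finally show ?thesis by (simp add: inner_Basis)
qed

lemma square_integrable_std_gaussian_id: "square_integrable std_gaussian (\<lambda>x::'a::euclidean_space. x)"
proof -
  have "integrable std_gaussian (\<lambda>x::'a. (norm x)\<^sup>2)"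
    by (rule integrable_std_gaussian_growth[where C=1 and k=2]) (auto intro: power_mono)
  then show ?thesis by (auto simp: square_integrable_def)
qed

lemma integrable_std_gaussian_pos_part:
  fixes v :: "'a::euclidean_space"
  shows "integrable std_gaussian (\<lambda>x. max 0 (x \<bullet> v) *\<^sub>R x)"
proof (rule integrable_std_gaussian_growth[where C="norm v" and k=2])
  show "norm (max 0 (x \<bullet> v) *\<^sub>R x) \<le> norm v * (1 + norm x) ^ 2" for x
  proof -
    have "\<bar>max 0 (x \<bullet> v)\<bar> \<le> norm x * norm v"
      using Cauchy_Schwarz_ineq2[of x v] by (auto simp: max_def)
    then have "norm (max 0 (x \<bullet> v) *\<^sub>R x) \<le> norm x * norm v * norm x"
      by (simp add: mult_right_mono)
    also have "\<dots> = norm v * (norm x)\<^sup>2"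
      by (simp add: power2_eq_square)
    also have "\<dots> \<le> norm v * (1 + norm x) ^ 2"
      by (intro mult_left_mono power_mono) auto
    finally show ?thesis .
  qed
qed simp

text \<open>The covariance of the standard Gaussian is the identity, and by the symmetry \<open>x \<mapsto> - x\<close> each of
  the two half spaces bounded by the hyperplane orthogonal to \<open>v\<close> contributes one half of it.\<close>

lemma integral_std_gaussian_pos_part:
  fixes v :: "'a::euclidean_space"
  shows "(\<integral>x. max 0 (x \<bullet> v) *\<^sub>R x \<partial>std_gaussian) = (1 / 2) *\<^sub>R v"
proof (rule euclidean_eqI)
  fix b :: 'a assume "b \<in> Basis"
  note int = integrable_std_gaussian_pos_part[of v]
  have intb: "integrable std_gaussian (\<lambda>x. max 0 (x \<bullet> v) * (x \<bullet> b))"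
    using integrable_inner_left[OF int, of b] by simp
  have intb': "integrable std_gaussian (\<lambda>x. max 0 (- (x \<bullet> v)) * - (x \<bullet> b))"
    using intb distr_std_gaussian_minus[where ?'a='a]
    by (subst (asm) distr_std_gaussian_minus[symmetric], subst (asm) integrable_distr_eq) auto
  have "v \<bullet> b = (\<integral>x. (x \<bullet> v) * (x \<bullet> b) \<partial>std_gaussian)"
    by (simp add: integral_std_gaussian_inner)
  also have "\<dots> = (\<integral>x. max 0 (x \<bullet> v) * (x \<bullet> b) + max 0 (- (x \<bullet> v)) * - (x \<bullet> b) \<partial>std_gaussian)"
    by (intro Bochner_Integration.integral_cong refl) (auto simp: max_def)
  also have "\<dots> = (\<integral>x. max 0 (x \<bullet> v) * (x \<bullet> b) \<partial>std_gaussian)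
      + (\<integral>x. max 0 (- (x \<bullet> v)) * - (x \<bullet> b) \<partial>std_gaussian)"
    by (rule Bochner_Integration.integral_add[OF intb intb'])
  also have "(\<integral>x. max 0 (- (x \<bullet> v)) * - (x \<bullet> b) \<partial>std_gaussian)
      = (\<integral>x. max 0 (x \<bullet> v) * (x \<bullet> b) \<partial>std_gaussian)"
    using integral_std_gaussian_minus[of "\<lambda>x. max 0 (x \<bullet> v) * (x \<bullet> b)"] by simp
  finally have "(\<integral>x. max 0 (x \<bullet> v) * (x \<bullet> b) \<partial>std_gaussian) = (v \<bullet> b) / 2"
    by simp
  moreover have "(\<integral>x. max 0 (x \<bullet> v) *\<^sub>R x \<partial>std_gaussian) \<bullet> b
      = (\<integral>x. max 0 (x \<bullet> v) * (x \<bullet> b) \<partial>std_gaussian)"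
    using integral_inner_left[OF int, of b] by simp
  ultimately show "(\<integral>x. max 0 (x \<bullet> v) *\<^sub>R x \<partial>std_gaussian) \<bullet> b = ((1 / 2) *\<^sub>R v) \<bullet> b"
    by simp
qed

text \<open>Rotation invariance. In terms of \<open>x\<close> and \<open>w = a x + b y\<close> the joint density factorises into the
  Gaussian density of \<open>w\<close> and a Gaussian density of \<open>x\<close> with centre \<open>a w\<close> and variance \<open>b\<^sup>2\<close>, and the
  latter integrates to one.\<close>

lemma nn_integral_std_gaussian_rotate:
  fixes f :: "'a::euclidean_space \<Rightarrow> ennreal"
  assumes [measurable]: "f \<in> borel_measurable borel" and b: "b > 0" and ab: "a\<^sup>2 + b\<^sup>2 = 1"
  shows "(\<integral>\<^sup>+x. \<integral>\<^sup>+y. f (a *\<^sub>R x + b *\<^sub>R y) \<partial>std_gaussian \<partial>std_gaussian) = (\<integral>\<^sup>+w. f w \<partial>std_gaussian)"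
proof -
  let ?C = "ennreal (\<bar>1/b\<bar> ^ DIM('a))"
  let ?g = "\<lambda>x::'a. ennreal (gaussian_density x)"
  let ?h = "\<lambda>v u. ?g ((v - a *\<^sub>R u) /\<^sub>R b)"
  have split: "?g x * ?h w x = ?g w * ?h x w" for x w
  proof -
    have "b\<^sup>2 * (norm x)\<^sup>2 + (norm (w - a *\<^sub>R x))\<^sup>2 = b\<^sup>2 * (norm w)\<^sup>2 + (norm (x - a *\<^sub>R w))\<^sup>2"
    proof -
      have "a * (a * t) + b * (b * t) = t" for t
        using ab by (metis (no_types) distrib_right mult.assoc mult_1 power2_eq_square)
      from this[of "x \<bullet> x"] this[of "w \<bullet> w"] show ?thesis
        unfolding power2_norm_eq_inner
        by (simp add: inner_diff_left inner_diff_right inner_commute algebra_simps power2_eq_square)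
    qed
    moreover have norm_inv: "(norm (v /\<^sub>R b))\<^sup>2 = (norm v)\<^sup>2 / b\<^sup>2" for v :: 'a
      using b by (simp add: power_mult_distrib divide_inverse power_inverse mult.commute)
    ultimately have "(norm x)\<^sup>2 + (norm ((w - a *\<^sub>R x) /\<^sub>R b))\<^sup>2 = (norm w)\<^sup>2 + (norm ((x - a *\<^sub>R w) /\<^sub>R b))\<^sup>2"
      unfolding norm_inv using b by (simp add: field_simps)
    then have "gaussian_density x * gaussian_density ((w - a *\<^sub>R x) /\<^sub>R b)
        = gaussian_density w * gaussian_density ((x - a *\<^sub>R w) /\<^sub>R b)"
      by (simp add: gaussian_density_def add_divide_distrib[symmetric] flip: exp_add)
    then show ?thesis by (simp flip: ennreal_mult)
  qed
  have inner: "?g x * (\<integral>\<^sup>+y. f (a *\<^sub>R x + b *\<^sub>R y) \<partial>std_gaussian)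
      = (\<integral>\<^sup>+w. ?C * (?g w * ?h x w * f w) \<partial>lborel)" for x
  proof -
    have "(\<integral>\<^sup>+y. f (a *\<^sub>R x + b *\<^sub>R y) \<partial>std_gaussian) = (\<integral>\<^sup>+y. ?g y * f (a *\<^sub>R x + b *\<^sub>R y) \<partial>lborel)"
      by (subst nn_integral_std_gaussian) auto
    also have "\<dots> = ?C * (\<integral>\<^sup>+w. ?g (((-a/b) *\<^sub>R x) + (1/b) *\<^sub>R w) *
        f (a *\<^sub>R x + b *\<^sub>R (((-a/b) *\<^sub>R x) + (1/b) *\<^sub>R w)) \<partial>lborel)"
      using b by (subst nn_integral_lborel_affine[where c="1/b" and t="(-a/b) *\<^sub>R x"]) auto
    also have "\<dots> = ?C * (\<integral>\<^sup>+w. ?h w x * f w \<partial>lborel)"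
      using b by (intro arg_cong2[where f="(*)"] refl nn_integral_cong arg_cong2[where f="(*)"]
          arg_cong[where f="?g"] arg_cong[where f=f])
        (auto simp: algebra_simps divide_inverse)
    finally have "?g x * (\<integral>\<^sup>+y. f (a *\<^sub>R x + b *\<^sub>R y) \<partial>std_gaussian)
       = (\<integral>\<^sup>+w. ?g x * (?C * (?h w x * f w)) \<partial>lborel)"
      by (simp add: nn_integral_cmult)
    also have "\<dots> = (\<integral>\<^sup>+w. ?C * (?g x * ?h w x * f w) \<partial>lborel)"
      by (intro nn_integral_cong) (simp only: mult_ac)
    also have "\<dots> = (\<integral>\<^sup>+w. ?C * (?g w * ?h x w * f w) \<partial>lborel)"
      using split by (intro nn_integral_cong) metis
    finally show ?thesis .
  qed
  have "(\<integral>\<^sup>+x. \<integral>\<^sup>+y. f (a *\<^sub>R x + b *\<^sub>R y) \<partial>std_gaussian \<partial>std_gaussian)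
     = (\<integral>\<^sup>+x. ?g x * (\<integral>\<^sup>+y. f (a *\<^sub>R x + b *\<^sub>R y) \<partial>std_gaussian) \<partial>lborel)"
    by (rule nn_integral_std_gaussian)
       (intro sigma_finite_measure.borel_measurable_nn_integral[OF
           prob_space_imp_sigma_finite[OF prob_space_std_gaussian]], measurable)
  also have "\<dots> = (\<integral>\<^sup>+x. \<integral>\<^sup>+w. ?C * (?g w * ?h x w * f w) \<partial>lborel \<partial>lborel)"
    by (simp add: inner)
  also have "\<dots> = (\<integral>\<^sup>+w. \<integral>\<^sup>+x. ?C * (?g w * ?h x w * f w) \<partial>lborel \<partial>lborel)"
    by (rule lborel_pair.Fubini') measurable
  also have "\<dots> = (\<integral>\<^sup>+w. ?g w * f w * (?C * (\<integral>\<^sup>+x. ?h x w \<partial>lborel)) \<partial>lborel)"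
  proof (intro nn_integral_cong)
    fix w :: 'a
    have "(\<integral>\<^sup>+x. ?C * (?g w * ?h x w * f w) \<partial>lborel)
        = (\<integral>\<^sup>+x. (?g w * f w * ?C) * ?h x w \<partial>lborel)"
      by (intro nn_integral_cong) (simp only: mult_ac)
    also have "\<dots> = (?g w * f w * ?C) * (\<integral>\<^sup>+x. ?h x w \<partial>lborel)"
      by (rule nn_integral_cmult) measurable
    finally show "(\<integral>\<^sup>+x. ?C * (?g w * ?h x w * f w) \<partial>lborel)
        = ?g w * f w * (?C * (\<integral>\<^sup>+x. ?h x w \<partial>lborel))"
      by (simp only: mult.assoc)
  qed
  also have "\<dots> = (\<integral>\<^sup>+w. ?g w * f w \<partial>lborel)"
  proof (intro nn_integral_cong)
    fix w :: 'a
    have "(1::ennreal) = ?C * (\<integral>\<^sup>+x. ?g ((-a/b) *\<^sub>R w + (1/b) *\<^sub>R x) \<partial>lborel)"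
      using b by (subst nn_integral_gaussian_density[symmetric],
          subst nn_integral_lborel_affine[where c="1/b" and t="(-a/b) *\<^sub>R w"]) auto
    also have "(\<integral>\<^sup>+x. ?g ((-a/b) *\<^sub>R w + (1/b) *\<^sub>R x) \<partial>lborel) = (\<integral>\<^sup>+x. ?h x w \<partial>lborel)"
      by (intro nn_integral_cong arg_cong[where f="?g"]) (auto simp: algebra_simps divide_inverse)
    finally show "?g w * f w * (?C * (\<integral>\<^sup>+x. ?h x w \<partial>lborel))
        = ?g w * f w"
      by simp
  qed
  also have "\<dots> = (\<integral>\<^sup>+w. f w \<partial>std_gaussian)"
    by (simp add: nn_integral_std_gaussian)
  finally show ?thesis .
qed

section \<open>Strongly convex potentials with Lipschitz gradient\<close>

text \<open>The value of \<open>\<phi>\<close> at the point \<open>z = y + (g x - g y) / M\<close> is bounded from below by the tangent at \<open>x\<close>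
  and from above by the parabola at \<open>y\<close>; this \<open>z\<close> makes the comparison sharpest. Adding the
  result to the one with \<open>x\<close> and \<open>y\<close> exchanged eliminates the values of \<open>\<phi>\<close>.\<close>

lemma gradient_cocoercive:
  fixes \<phi> :: "'a::euclidean_space \<Rightarrow> real"
  assumes M: "M > 0"
    and lo: "\<And>x y. 0 \<le> \<phi> y - \<phi> x - g x \<bullet> (y - x)"
    and up: "\<And>x y. \<phi> y - \<phi> x - g x \<bullet> (y - x) \<le> M / 2 * (norm (x - y))\<^sup>2"
  shows "(norm (g x - g y))\<^sup>2 \<le> M * ((g x - g y) \<bullet> (x - y))"
proof -
  have half: "g x \<bullet> (y - x) + (norm (g x - g y))\<^sup>2 / (2 * M) \<le> \<phi> y - \<phi> x" for x y
  proof -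
    define w z where "w = g x - g y" and "z = y + (1 / M) *\<^sub>R w"
    have "(norm (y - z))\<^sup>2 = (norm w)\<^sup>2 / M\<^sup>2"
      using M by (simp add: z_def power_divide)
    then have "\<phi> z - \<phi> y \<le> g y \<bullet> (z - y) + (norm w)\<^sup>2 / (2 * M)"
      using up[of z y] M by (simp add: power2_eq_square)
    moreover have "g x \<bullet> (z - x) \<le> \<phi> z - \<phi> x"
      using lo[of z x] by simp
    moreover have "g x \<bullet> (z - x) - g y \<bullet> (z - y) = g x \<bullet> (y - x) + (norm w)\<^sup>2 / M"
      by (simp add: z_def w_def power2_norm_eq_inner inner_diff_left inner_diff_right
          inner_add_right diff_divide_distrib)
    moreover have "(norm w)\<^sup>2 / (2 * M) = (norm w)\<^sup>2 / M / 2"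
      by simp
    ultimately show ?thesis
      unfolding w_def by linarith
  qed
  from half[where x=x and y=y] half[where x=y and y=x] show ?thesis
    using M by (simp add: norm_minus_commute inner_diff_left inner_diff_right field_simps)
qed

locale strongly_convex_smooth =
  fixes U :: "'a::euclidean_space \<Rightarrow> real" and g :: "'a \<Rightarrow> 'a" and m L :: real
  assumes U_measurable [measurable]: "U \<in> borel_measurable borel"
    and m_pos: "0 < m" and m_le_L: "m \<le> L"
    and g_0 [simp]: "g 0 = 0"
    and lower: "\<And>x y. m / 2 * (norm (x - y))\<^sup>2 \<le> U y - U x - g x \<bullet> (y - x)"
    and upper: "\<And>x y. U y - U x - g x \<bullet> (y - x) \<le> L / 2 * (norm (x - y))\<^sup>2"
begin

lemma L_pos: "0 < L"
  using m_pos m_le_L by simp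

lemma convex_lower: "0 \<le> U y - U x - g x \<bullet> (y - x)"
  using lower[of x y] m_pos by (smt (verit) divide_nonneg_pos mult_nonneg_nonneg zero_le_power2)

lemma gradient_lipschitz: "norm (g x - g y) \<le> L * norm (x - y)"
proof (cases "g x = g y")
  case False
  have "(norm (g x - g y))\<^sup>2 \<le> L * ((g x - g y) \<bullet> (x - y))"
    by (rule gradient_cocoercive[OF L_pos convex_lower upper])
  also have "\<dots> \<le> L * (norm (g x - g y) * norm (x - y))"
    using L_pos norm_cauchy_schwarz[of "g x - g y" "x - y"] by simp
  finally have "norm (g x - g y) * norm (g x - g y) \<le> norm (g x - g y) * (L * norm (x - y))"
    by (simp add: power2_eq_square mult_ac)
  then show ?thesis
    using False by simp
qed (use L_pos in simp)

lemma norm_gradient_le: "norm (g x) \<le> L * norm x"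
  using gradient_lipschitz[of x 0] by simp

lemma continuous_gradient: "continuous_on UNIV g"
proof (rule continuous_on_subset[OF lipschitz_on_continuous_on])
  show "L-lipschitz_on UNIV g"
    using L_pos gradient_lipschitz by (intro lipschitz_onI) (auto simp: dist_norm)
qed simp

lemma gradient_measurable [measurable]: "g \<in> borel_measurable borel"
  by (rule borel_measurable_continuous_onI[OF continuous_gradient])

lemma step_size_bounds:
  assumes "0 < \<eta>" "\<eta> < 2 / (m + L)"
  shows "\<eta> * (m + L) < 2" and "m * \<eta> < 1"
proof -
  show *: "\<eta> * (m + L) < 2"
    using assms m_pos L_pos by (simp add: field_simps)
  have "\<eta> * m \<le> \<eta> * L"
    using m_le_L assms by (intro mult_left_mono) auto
  then show "m * \<eta> < 1"
    using * by (simp add: distrib_left mult.commute)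
qed

text \<open>Cocoercivity is applied to the convex function \<open>U - m / 2 |x|\<^sup>2\<close>, whose gradient is Lipschitz
  with any constant above \<open>L - m\<close>; the step size restriction says that \<open>2 (1 - m \<eta>) / \<eta>\<close> is one.\<close>

lemma gradient_step_contraction:
  assumes \<eta>: "0 < \<eta>" "\<eta> < 2 / (m + L)"
  shows "norm (x - y - \<eta> *\<^sub>R (g x - g y)) \<le> (1 - m * \<eta>) * norm (x - y)"
proof -
  note mL = step_size_bounds(1)[OF \<eta>] and m\<eta> = step_size_bounds(2)[OF \<eta>]
  define M where "M = 2 * (1 - m * \<eta>) / \<eta>"
  have M: "M > 0" "L - m \<le> M"
    using m\<eta> \<eta> mL by (auto simp: M_def field_simps)
  define \<phi> where "\<phi> x = U x - m / 2 * (norm x)\<^sup>2" for x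
  have eq: "\<phi> y - \<phi> x - (g x - m *\<^sub>R x) \<bullet> (y - x)
      = U y - U x - g x \<bullet> (y - x) - m / 2 * (norm (x - y))\<^sup>2" for x y
    unfolding \<phi>_def power2_norm_eq_inner
    by (simp add: inner_diff_left inner_diff_right inner_commute algebra_simps)
  define w where "w = (g x - m *\<^sub>R x) - (g y - m *\<^sub>R y)"
  have "(norm w)\<^sup>2 \<le> M * (w \<bullet> (x - y))"
    unfolding w_def
  proof (rule gradient_cocoercive[OF M(1), where \<phi>=\<phi>])
    fix x y
    show "0 \<le> \<phi> y - \<phi> x - (g x - m *\<^sub>R x) \<bullet> (y - x)"
      using lower[of x y] by (simp add: eq)
    have "(L - m) / 2 * (norm (x - y))\<^sup>2 \<le> M / 2 * (norm (x - y))\<^sup>2"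
      using M(2) by (intro mult_right_mono) auto
    then show "\<phi> y - \<phi> x - (g x - m *\<^sub>R x) \<bullet> (y - x) \<le> M / 2 * (norm (x - y))\<^sup>2"
      unfolding eq using upper[where x=x and y=y]
      by (simp add: diff_divide_distrib left_diff_distrib)
  qed
  then have w: "\<eta> * (norm w)\<^sup>2 \<le> 2 * (1 - m * \<eta>) * (w \<bullet> (x - y))"
    using \<eta> by (simp add: M_def field_simps)
  have "x - y - \<eta> *\<^sub>R (g x - g y) = (1 - m * \<eta>) *\<^sub>R (x - y) - \<eta> *\<^sub>R w"
    by (simp add: w_def algebra_simps)
  then have "(norm (x - y - \<eta> *\<^sub>R (g x - g y)))\<^sup>2 = (norm ((1 - m * \<eta>) *\<^sub>R (x - y) - \<eta> *\<^sub>R w))\<^sup>2"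
    by simp
  also have "\<dots> = ((1 - m * \<eta>) * norm (x - y))\<^sup>2 - \<eta> * (2 * (1 - m * \<eta>) * (w \<bullet> (x - y)) - \<eta> * (norm w)\<^sup>2)"
  proof -
    have "(norm (a *\<^sub>R u - \<eta> *\<^sub>R w))\<^sup>2 = (a * norm u)\<^sup>2 - \<eta> * (2 * a * (w \<bullet> u) - \<eta> * (norm w)\<^sup>2)" for a u
      unfolding power_mult_distrib power2_norm_eq_inner
      by (simp add: inner_diff_left inner_diff_right inner_commute algebra_simps power2_eq_square)
    then show ?thesis .
  qed
  also have "\<dots> \<le> ((1 - m * \<eta>) * norm (x - y))\<^sup>2"
    using w \<eta> by simp
  finally show ?thesis
    by (rule power2_le_imp_le) (use m\<eta> in auto)
qed

lemma U_lower_quadratic: "U 0 + m / 2 * (norm x)\<^sup>2 \<le> U x"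
  using lower[of 0 x] by simp

lemma U_upper_quadratic: "U x \<le> U 0 + L / 2 * (norm x)\<^sup>2"
  using upper[where x=0 and y=x] by simp

section \<open>The Gibbs measure\<close>

lemma integrable_poly_exp_neg_U: "integrable lborel (\<lambda>x. (1 + norm x) ^ k * exp (- U x))"
proof (rule Bochner_Integration.integrable_bound)
  show "integrable lborel (\<lambda>x::'a. exp (- U 0) * ((1 + norm x) ^ k * exp (- (m / 2) * (norm x)\<^sup>2)))"
    using m_pos by (intro integrable_mult_right integrable_poly_exp_neg_norm_power2) auto
  show "AE x in lborel. norm ((1 + norm x) ^ k * exp (- U x))
      \<le> norm (exp (- U 0) * ((1 + norm x) ^ k * exp (- (m / 2) * (norm x)\<^sup>2)))"
  proof (rule AE_I2)
    fix x
    have "(1 + norm x) ^ k * exp (- U x) \<le> (1 + norm x) ^ k * exp (- U 0 - (m / 2) * (norm x)\<^sup>2)"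
      using U_lower_quadratic[of x] by (intro mult_left_mono) auto
    also have "exp (- U 0 - (m / 2) * (norm x)\<^sup>2) = exp (- U 0) * exp (- (m / 2) * (norm x)\<^sup>2)"
      by (simp flip: exp_add)
    finally show "norm ((1 + norm x) ^ k * exp (- U x))
        \<le> norm (exp (- U 0) * ((1 + norm x) ^ k * exp (- (m / 2) * (norm x)\<^sup>2)))"
      by (simp add: mult_ac)
  qed
qed simp

definition Z :: real where "Z = (\<integral>y. exp (- U y) \<partial>lborel)"

definition gibbs_density :: "'a \<Rightarrow> real" where "gibbs_density x = exp (- U x) / Z"

lemma gibbs_density_measurable [measurable]: "gibbs_density \<in> borel_measurable borel"
  unfolding gibbs_density_def[abs_def] by measurable

lemma integrable_exp_neg_U: "integrable lborel (\<lambda>x. exp (- U x))"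
  using integrable_poly_exp_neg_U[of 0] by simp

lemma Z_pos: "0 < Z"
proof -
  have "Z \<noteq> 0"
  proof
    assume "Z = 0"
    then have "AE x in lborel. exp (- U x) = 0"
      unfolding Z_def using integrable_exp_neg_U
      by (subst (asm) integral_nonneg_eq_0_iff_AE) auto
    then have "AE x in (lborel :: 'a measure). False"
      by simp
    then have "emeasure lborel (UNIV :: 'a set) = 0"
      by (subst (asm) AE_iff_measurable[of UNIV]) auto
    then show False
      by simp
  qed
  moreover have "0 \<le> Z"
    unfolding Z_def by (intro integral_nonneg_AE) auto
  ultimately show ?thesis by simp
qed

lemma gibbs_density_pos: "0 < gibbs_density x"
  using Z_pos by (simp add: gibbs_density_def)

lemma gibbs_density_nonneg [simp]: "0 \<le> gibbs_density x"
  using gibbs_density_pos[of x] by simp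

abbreviation gibbs :: "'a measure" where "gibbs \<equiv> gibbs_measure U"

lemma gibbs_eq_density: "gibbs = density lborel (\<lambda>x. ennreal (gibbs_density x))"
  by (simp add: gibbs_measure_def gibbs_density_def Z_def)

lemma space_gibbs [simp]: "space gibbs = UNIV"
  by (simp add: gibbs_measure_def)

lemma sets_gibbs [simp, measurable_cong]: "sets gibbs = sets borel"
  by (simp add: gibbs_measure_def)

lemma nn_integral_gibbs:
  assumes [measurable]: "f \<in> borel_measurable borel"
  shows "(\<integral>\<^sup>+x. f x \<partial>gibbs) = (\<integral>\<^sup>+x. ennreal (gibbs_density x) * f x \<partial>lborel)"
  by (simp add: gibbs_eq_density nn_integral_density)

lemma prob_space_gibbs: "prob_space gibbs"
proof
  have "integrable lborel gibbs_density"
    unfolding gibbs_density_def[abs_def] using integrable_exp_neg_U by simp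
  then have "(\<integral>\<^sup>+x. ennreal (gibbs_density x) \<partial>lborel) = ennreal (\<integral>x. gibbs_density x \<partial>lborel)"
    by (intro nn_integral_eq_integral) auto
  also have "\<dots> = 1"
    using Z_pos by (simp add: gibbs_density_def Z_def)
  finally show "emeasure gibbs (space gibbs) = 1"
    by (simp add: gibbs_eq_density emeasure_density)
qed

lemma integrable_gibbs_growth:
  fixes f :: "'a \<Rightarrow> 'b::euclidean_space"
  assumes [measurable]: "f \<in> borel_measurable borel" and f: "\<And>x. norm (f x) \<le> C * (1 + norm x) ^ k"
  shows "integrable gibbs f"
proof (rule Bochner_Integration.integrable_bound)
  have "integrable lborel (\<lambda>x. C / Z * ((1 + norm x) ^ k * exp (- U x)))"
    by (intro integrable_mult_right integrable_poly_exp_neg_U)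
  then show "integrable gibbs (\<lambda>x::'a. C * (1 + norm x) ^ k)"
    unfolding gibbs_eq_density
    by (subst integrable_density) (use Z_pos in \<open>auto simp: gibbs_density_def field_simps\<close>)
qed (use assms in \<open>auto intro!: AE_I2 order_trans[OF f]\<close>)

lemma integrable_gibbs_U: "integrable gibbs U"
proof (rule integrable_gibbs_growth)
  fix x
  have "\<bar>U x\<bar> \<le> \<bar>U 0\<bar> + L / 2 * (norm x)\<^sup>2"
    using U_lower_quadratic[of x] U_upper_quadratic[of x] m_pos
    by (smt (verit) divide_nonneg_pos mult_nonneg_nonneg zero_le_power2)
  also have "\<dots> \<le> \<bar>U 0\<bar> * (1 + norm x)\<^sup>2 + L / 2 * (1 + norm x)\<^sup>2"
    using L_pos by (intro add_mono mult_left_mono power_mono)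
      (auto simp: mult_le_cancel_left1 intro!: one_le_power)
  also have "\<dots> = (\<bar>U 0\<bar> + L / 2) * (1 + norm x) ^ 2"
    by (simp add: algebra_simps)
  finally show "norm (U x) \<le> (\<bar>U 0\<bar> + L / 2) * (1 + norm x) ^ 2"
    by simp
qed simp

lemma square_integrable_gibbs_id: "square_integrable gibbs (\<lambda>x. x)"
proof -
  have "integrable gibbs (\<lambda>x. (norm x)\<^sup>2)"
    by (rule integrable_gibbs_growth[where C=1 and k=2]) (auto intro: power_mono)
  then show ?thesis by (auto simp: square_integrable_def)
qed

end

section \<open>Random walk Metropolis\<close>

abbreviation unit_uniform :: "real measure" where
  "unit_uniform \<equiv> uniform_measure lborel {0..1}"

lemma prob_space_unit_uniform: "prob_space unit_uniform"
  by (rule prob_space_uniform_measure) auto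

lemma emeasure_unit_uniform_atMost:
  assumes "0 \<le> a"
  shows "emeasure unit_uniform {..a} = ennreal (min 1 a)"
proof -
  have "{0..1} \<inter> {..a} = {0..min 1 a}"
    using assms by auto
  then show ?thesis
    using assms by (simp add: emeasure_uniform_measure divide_ennreal_def)
qed

lemma emeasure_unit_uniform_greaterThan:
  assumes "0 \<le> a"
  shows "emeasure unit_uniform {a<..} = ennreal (1 - min 1 a)"
proof -
  have "{0..1} \<inter> {a<..} = {min 1 a<..1}"
    using assms by auto
  then show ?thesis
    using assms by (simp add: emeasure_uniform_measure divide_ennreal_def)
qed

lemma nn_integral_unit_uniform_threshold:
  assumes "0 \<le> a"
  shows "(\<integral>\<^sup>+u. (if u \<le> a then A else B) \<partial>unit_uniform)
    = ennreal (min 1 a) * A + ennreal (1 - min 1 a) * B"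
proof -
  interpret prob_space unit_uniform by (rule prob_space_unit_uniform)
  have "(\<integral>\<^sup>+u. (if u \<le> a then A else B) \<partial>unit_uniform)
      = (\<integral>\<^sup>+u. A * indicator {..a} u + B * indicator {a<..} u \<partial>unit_uniform)"
    by (intro nn_integral_cong) (auto simp: indicator_def)
  also have "\<dots> = A * emeasure unit_uniform {..a} + B * emeasure unit_uniform {a<..}"
    by (subst nn_integral_add) (auto simp: nn_integral_cmult simp del: emeasure_uniform_measure)
  finally show ?thesis
    using assms by (simp add: emeasure_unit_uniform_greaterThan emeasure_unit_uniform_atMost
        mult.commute del: emeasure_uniform_measure)
qed

lemma integral_unit_uniform_threshold:
  fixes v w :: "'b::euclidean_space"
  assumes "0 \<le> a"
  shows "(\<integral>u. (if u \<le> a then v else w) \<partial>unit_uniform) = min 1 a *\<^sub>R v + (1 - min 1 a) *\<^sub>R w"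
proof -
  interpret prob_space unit_uniform by (rule prob_space_unit_uniform)
  have le: "measure unit_uniform {..a} = min 1 a"
    using emeasure_unit_uniform_atMost[OF assms] assms
    by (simp add: measure_def del: emeasure_uniform_measure)
  have gr: "measure unit_uniform {a<..} = 1 - min 1 a"
    using emeasure_unit_uniform_greaterThan[OF assms] assms
    by (simp add: measure_def del: emeasure_uniform_measure)
  have "(\<integral>u. (if u \<le> a then v else w) \<partial>unit_uniform)
      = (\<integral>u. indicator {..a} u *\<^sub>R v + indicator {a<..} u *\<^sub>R w \<partial>unit_uniform)"
    by (intro Bochner_Integration.integral_cong) (auto simp: indicator_def)
  also have "\<dots> = measure unit_uniform {..a} *\<^sub>R v + measure unit_uniform {a<..} *\<^sub>R w"
    by (subst Bochner_Integration.integral_add)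
       (auto intro!: integrable_scaleR_left integrable_real_indicator simp: less_top[symmetric]
         simp del: emeasure_uniform_measure measure_uniform_measure)
  finally show ?thesis by (simp add: le gr)
qed

definition rwm_noise :: "('a::euclidean_space \<times> real) measure" where
  "rwm_noise = std_gaussian \<Otimes>\<^sub>M unit_uniform"

lemma sets_rwm_noise [simp, measurable_cong]: "sets rwm_noise = sets (borel \<Otimes>\<^sub>M borel)"
  unfolding rwm_noise_def by (intro sets_pair_measure_cong) auto

lemma space_rwm_noise [simp]: "space rwm_noise = UNIV"
  by (simp add: rwm_noise_def space_pair_measure)

lemma prob_space_rwm_noise: "prob_space rwm_noise"
  unfolding rwm_noise_def
  by (intro prob_space_pair prob_space_std_gaussian prob_space_unit_uniform)

lemma nn_integral_rwm_noise:
  assumes [measurable]: "(\<lambda>(z, u). F z u) \<in> borel_measurable (borel \<Otimes>\<^sub>M borel)"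
  shows "(\<integral>\<^sup>+r. F (fst r) (snd r) \<partial>rwm_noise) = (\<integral>\<^sup>+z. \<integral>\<^sup>+u. F z u \<partial>unit_uniform \<partial>std_gaussian)"
proof -
  interpret prob_space unit_uniform by (rule prob_space_unit_uniform)
  have "(\<lambda>(z, u). F z u) \<in> borel_measurable (std_gaussian \<Otimes>\<^sub>M unit_uniform)"
    by measurable
  from nn_integral_fst[OF this, symmetric] show ?thesis
    by (simp add: rwm_noise_def split_beta')
qed

lemma distr_fst_rwm_noise: "distr rwm_noise borel fst = std_gaussian"
proof -
  interpret prob_space unit_uniform by (rule prob_space_unit_uniform)
  have "distr rwm_noise borel fst = distr (std_gaussian \<Otimes>\<^sub>M unit_uniform) std_gaussian fst"
    unfolding rwm_noise_def by (rule distr_cong) auto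
  then show ?thesis
    by (simp only: distr_pair_fst)
qed

context strongly_convex_smooth
begin

abbreviation gaussian :: "'a measure" where "gaussian \<equiv> std_gaussian"

abbreviation noise :: "('a \<times> real) measure" where "noise \<equiv> rwm_noise"

definition accept_prob :: "real \<Rightarrow> 'a \<Rightarrow> 'a \<Rightarrow> real" where
  "accept_prob c x z = min 1 (exp (U x - U (x + c *\<^sub>R z)))"

definition rwm_step :: "real \<Rightarrow> 'a \<Rightarrow> 'a \<times> real \<Rightarrow> 'a" where
  "rwm_step c x r =
    (if snd r \<le> exp (U x - U (x + c *\<^sub>R fst r)) then x + c *\<^sub>R fst r else x)"

lemma accept_prob_bounds [simp]: "0 \<le> accept_prob c x z" "accept_prob c x z \<le> 1"
  by (auto simp: accept_prob_def)

lemma measurable_accept_prob [measurable]: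
  "(\<lambda>(x, z). accept_prob c x z) \<in> borel_measurable (borel \<Otimes>\<^sub>M borel)"
  unfolding accept_prob_def by measurable

lemma measurable_rwm_step [measurable]:
  "(\<lambda>(x, r). rwm_step c x r) \<in> borel_measurable (borel \<Otimes>\<^sub>M (borel \<Otimes>\<^sub>M borel))"
  unfolding rwm_step_def by measurable

lemma nn_integral_rwm_step:
  assumes [measurable]: "f \<in> borel_measurable borel"
  shows "(\<integral>\<^sup>+r. f (rwm_step c x r) \<partial>rwm_noise) = (\<integral>\<^sup>+z. ennreal (accept_prob c x z) * f (x + c *\<^sub>R z)
      + ennreal (1 - accept_prob c x z) * f x \<partial>std_gaussian)"
proof -
  have "(\<integral>\<^sup>+r. f (rwm_step c x r) \<partial>rwm_noise) = (\<integral>\<^sup>+r. (\<lambda>z u. if u \<le> exp (U x - U (x + c *\<^sub>R z))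
      then f (x + c *\<^sub>R z) else f x) (fst r) (snd r) \<partial>rwm_noise)"
    by (intro nn_integral_cong) (auto simp: rwm_step_def)
  also have "\<dots> = (\<integral>\<^sup>+z. \<integral>\<^sup>+u. (if u \<le> exp (U x - U (x + c *\<^sub>R z))
      then f (x + c *\<^sub>R z) else f x) \<partial>unit_uniform \<partial>std_gaussian)"
    by (rule nn_integral_rwm_noise) measurable
  finally show ?thesis
    by (simp add: nn_integral_unit_uniform_threshold accept_prob_def)
qed

text \<open>Detailed balance: the density of an accepted move from \<open>x\<close> to \<open>y\<close> is the minimum of the Gibbs
  densities at \<open>x\<close> and \<open>y\<close> times a symmetric Gaussian density.\<close>

lemma nn_integral_accepted:
  assumes [measurable]: "f \<in> borel_measurable borel"
  shows "(\<integral>\<^sup>+x. \<integral>\<^sup>+z. ennreal (accept_prob c x z) * f (x + c *\<^sub>R z) \<partial>std_gaussian \<partial>gibbs)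
       = (\<integral>\<^sup>+x. \<integral>\<^sup>+z. ennreal (accept_prob c x z) * f x \<partial>std_gaussian \<partial>gibbs)"
proof -
  interpret G: prob_space gaussian by (rule prob_space_std_gaussian)
  interpret P: pair_sigma_finite "lborel :: 'a measure" gaussian ..
  define k where "k x z = ennreal (min (gibbs_density x) (gibbs_density (x + c *\<^sub>R z)))" for x z
  have [measurable]: "(\<lambda>(x, z). k x z) \<in> borel_measurable (borel \<Otimes>\<^sub>M borel)"
    unfolding k_def by measurable
  have k: "ennreal (gibbs_density x) * ennreal (accept_prob c x z) = k x z" for x z
  proof -
    have "gibbs_density x * accept_prob c x z = min (gibbs_density x) (gibbs_density (x + c *\<^sub>R z))"
      using Z_pos min_mult_distrib_left[of "gibbs_density x" 1 "exp (U x - U (x + c *\<^sub>R z))"]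
        gibbs_density_pos[of x]
      by (simp add: accept_prob_def gibbs_density_def exp_diff exp_minus field_simps)
    then show ?thesis by (simp add: k_def flip: ennreal_mult)
  qed
  have swap: "(\<integral>\<^sup>+x. \<integral>\<^sup>+z. ennreal (accept_prob c x z) * h x z \<partial>std_gaussian \<partial>gibbs)
      = (\<integral>\<^sup>+z. \<integral>\<^sup>+x. k x z * h x z \<partial>lborel \<partial>std_gaussian)"
    if [measurable]: "(\<lambda>(x, z). h x z) \<in> borel_measurable (borel \<Otimes>\<^sub>M borel)" for h
  proof -
    have "(\<integral>\<^sup>+x. \<integral>\<^sup>+z. ennreal (accept_prob c x z) * h x z \<partial>std_gaussian \<partial>gibbs)
        = (\<integral>\<^sup>+x. \<integral>\<^sup>+z. k x z * h x z \<partial>std_gaussian \<partial>lborel)"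
      by (subst nn_integral_gibbs)
         (auto simp: nn_integral_cmult[symmetric] mult.assoc[symmetric] k)
    also have "\<dots> = (\<integral>\<^sup>+z. \<integral>\<^sup>+x. k x z * h x z \<partial>lborel \<partial>std_gaussian)"
      by (rule P.Fubini'[symmetric]) measurable
    finally show ?thesis .
  qed
  have "(\<integral>\<^sup>+x. \<integral>\<^sup>+z. ennreal (accept_prob c x z) * f (x + c *\<^sub>R z) \<partial>std_gaussian \<partial>gibbs)
      = (\<integral>\<^sup>+z. \<integral>\<^sup>+x. k x z * f (x + c *\<^sub>R z) \<partial>lborel \<partial>std_gaussian)"
    by (rule swap) measurable
  also have "\<dots> = (\<integral>\<^sup>+z. \<integral>\<^sup>+x. k x (- z) * f x \<partial>lborel \<partial>std_gaussian)"
  proof (rule nn_integral_cong)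
    fix z :: 'a
    have "(\<integral>\<^sup>+x. k x (- z) * f x \<partial>lborel) = (\<integral>\<^sup>+x. k (c *\<^sub>R z + x) (- z) * f (c *\<^sub>R z + x) \<partial>lborel)"
      by (subst lborel_distr_plus[symmetric, of "c *\<^sub>R z"], subst nn_integral_distr) auto
    also have "\<dots> = (\<integral>\<^sup>+x. k x z * f (x + c *\<^sub>R z) \<partial>lborel)"
      by (intro nn_integral_cong) (simp add: k_def add.commute min.commute)
    finally show "(\<integral>\<^sup>+x. k x z * f (x + c *\<^sub>R z) \<partial>lborel) = (\<integral>\<^sup>+x. k x (- z) * f x \<partial>lborel)" ..
  qed
  also have "\<dots> = (\<integral>\<^sup>+z. \<integral>\<^sup>+x. k x z * f x \<partial>lborel \<partial>std_gaussian)"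
    by (rule nn_integral_std_gaussian_minus[where f="\<lambda>z. \<integral>\<^sup>+x. k x z * f x \<partial>lborel"]) measurable
  also have "\<dots> = (\<integral>\<^sup>+x. \<integral>\<^sup>+z. ennreal (accept_prob c x z) * f x \<partial>std_gaussian \<partial>gibbs)"
    by (rule swap[symmetric]) measurable
  finally show ?thesis .
qed

lemma gibbs_rwm_invariant:
  "distr (gibbs \<Otimes>\<^sub>M rwm_noise) borel (\<lambda>(x, r). rwm_step c x r) = gibbs"
proof (rule measure_eqI)
  interpret R: prob_space noise by (rule prob_space_rwm_noise)
  interpret G: prob_space gaussian by (rule prob_space_std_gaussian)
  fix A assume "A \<in> sets (distr (gibbs \<Otimes>\<^sub>M rwm_noise) borel (\<lambda>(x, r). rwm_step c x r))"
  then have [measurable]: "A \<in> sets borel" by simp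
  let ?f = "indicator A :: 'a \<Rightarrow> ennreal"
  have "emeasure (distr (gibbs \<Otimes>\<^sub>M rwm_noise) borel (\<lambda>(x, r). rwm_step c x r)) A
      = (\<integral>\<^sup>+p. ?f (case p of (x, r) \<Rightarrow> rwm_step c x r) \<partial>(gibbs \<Otimes>\<^sub>M rwm_noise))"
    by (subst nn_integral_indicator[symmetric], simp, subst nn_integral_distr) auto
  also have "\<dots> = (\<integral>\<^sup>+x. \<integral>\<^sup>+r. ?f (rwm_step c x r) \<partial>rwm_noise \<partial>gibbs)"
    by (subst R.nn_integral_fst[symmetric]) auto
  also have "\<dots> = (\<integral>\<^sup>+x. (\<integral>\<^sup>+z. ennreal (accept_prob c x z) * ?f (x + c *\<^sub>R z) \<partial>std_gaussian)
      + (\<integral>\<^sup>+z. ennreal (1 - accept_prob c x z) * ?f x \<partial>std_gaussian) \<partial>gibbs)"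
    by (simp add: nn_integral_rwm_step nn_integral_add)
  also have "\<dots> = (\<integral>\<^sup>+x. (\<integral>\<^sup>+z. ennreal (accept_prob c x z) * ?f (x + c *\<^sub>R z) \<partial>std_gaussian) \<partial>gibbs)
      + (\<integral>\<^sup>+x. (\<integral>\<^sup>+z. ennreal (1 - accept_prob c x z) * ?f x \<partial>std_gaussian) \<partial>gibbs)"
    by (rule nn_integral_add) measurable
  also have "\<dots> = (\<integral>\<^sup>+x. (\<integral>\<^sup>+z. ennreal (accept_prob c x z) * ?f x \<partial>std_gaussian) \<partial>gibbs)
      + (\<integral>\<^sup>+x. (\<integral>\<^sup>+z. ennreal (1 - accept_prob c x z) * ?f x \<partial>std_gaussian) \<partial>gibbs)"
    by (simp only: nn_integral_accepted[of ?f c] borel_measurable_indicator \<open>A \<in> sets borel\<close>)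
  also have "\<dots> = (\<integral>\<^sup>+x. (\<integral>\<^sup>+z. ennreal (accept_prob c x z) * ?f x \<partial>std_gaussian)
      + (\<integral>\<^sup>+z. ennreal (1 - accept_prob c x z) * ?f x \<partial>std_gaussian) \<partial>gibbs)"
    by (rule nn_integral_add[symmetric]) measurable
  also have "\<dots> = (\<integral>\<^sup>+x. (\<integral>\<^sup>+z. ?f x \<partial>gaussian) \<partial>gibbs)"
    by (simp add: nn_integral_add[symmetric] distrib_right[symmetric] flip: ennreal_plus)
  also have "\<dots> = emeasure gibbs A"
    using G.emeasure_space_1 by simp
  finally show "emeasure (distr (gibbs \<Otimes>\<^sub>M rwm_noise) borel (\<lambda>(x, r). rwm_step c x r)) A = emeasure gibbs A" .
qed simp

end

lemma one_minus_exp_neg_approx: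
  fixes t :: real
  assumes "0 \<le> t"
  shows "\<bar>(1 - exp (- t)) - t\<bar> \<le> t\<^sup>2"
proof -
  have "1 - t \<le> exp (- t)"
    using exp_ge_add_one_self[of "- t"] by simp
  moreover have "exp (- t) \<le> 1 - t + t\<^sup>2"
  proof -
    have "exp (- t) \<le> 1 / (1 + t)"
      using exp_ge_add_one_self[of t] assms by (simp add: exp_minus field_simps)
    also have "\<dots> \<le> 1 - t + t\<^sup>2"
      using assms by (simp add: field_simps power2_eq_square)
    finally show ?thesis .
  qed
  ultimately show ?thesis by simp
qed

lemma power_le_power_one_plus:
  fixes n :: real
  assumes "0 \<le> n" "j \<le> k"
  shows "n ^ j \<le> (1 + n) ^ k"
proof -
  have "n ^ j \<le> (1 + n) ^ j"
    using assms by (intro power_mono) auto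
  also have "\<dots> \<le> (1 + n) ^ k"
    using assms by (intro power_increasing) auto
  finally show ?thesis .
qed

text \<open>One constant for all Gaussian moments up to the order five, the highest one in the error expansions
  below.\<close>

definition gauss5 :: "'a::euclidean_space itself \<Rightarrow> real" where
  "gauss5 _ = (\<integral>z. (1 + norm z) ^ 5 \<partial>(std_gaussian :: 'a measure))"

context strongly_convex_smooth
begin

lemma gauss5_nonneg: "0 \<le> gauss5 TYPE('a)"
  unfolding gauss5_def by (intro integral_nonneg_AE) auto

text \<open>The acceptance probability is \<open>exp (- t)\<close>, where \<open>t\<close> is the positive part of the increment of \<open>U\<close>,
  and \<open>q\<close> bounds the deviation of this increment from its linear part.\<close>

lemma rejection_bounds:
  fixes x z :: 'a and c :: real
  assumes c: "0 < c"
  defines "q \<equiv> L / 2 * c\<^sup>2 * (norm z)\<^sup>2"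
  shows rejection_prob_le: "1 - accept_prob c x z \<le> c * norm (g x) * norm z + q"
    and rejection_prob_approx: "\<bar>(1 - accept_prob c x z) - max 0 (z \<bullet> (c *\<^sub>R g x))\<bar>
      \<le> 2 * c\<^sup>2 * (norm (g x))\<^sup>2 * (norm z)\<^sup>2 + 2 * q\<^sup>2 + q"
proof -
  define \<Delta> t where "\<Delta> = U (x + c *\<^sub>R z) - U x" and "t = max 0 \<Delta>"
  have q: "0 \<le> q" using L_pos by (simp add: q_def)
  have \<Delta>: "z \<bullet> (c *\<^sub>R g x) \<le> \<Delta>" "\<Delta> \<le> z \<bullet> (c *\<^sub>R g x) + q"
    using convex_lower[where x=x and y="x + c *\<^sub>R z"] upper[where x=x and y="x + c *\<^sub>R z"]
    by (auto simp: \<Delta>_def q_def inner_commute power_mult_distrib)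
  have inner: "z \<bullet> (c *\<^sub>R g x) \<le> c * norm (g x) * norm z"
    using norm_cauchy_schwarz[of z "c *\<^sub>R g x"] c by (simp add: mult_ac)
  have t: "0 \<le> t" "t \<le> c * norm (g x) * norm z + q"
  proof -
    have "0 \<le> c * norm (g x) * norm z + q"
      using c q by simp
    moreover have "\<Delta> \<le> c * norm (g x) * norm z + q"
      using \<Delta>(2) inner by linarith
    ultimately show "0 \<le> t" "t \<le> c * norm (g x) * norm z + q"
      by (auto simp: t_def)
  qed
  have \<alpha>: "accept_prob c x z = exp (- t)"
    by (auto simp: accept_prob_def t_def \<Delta>_def max_def min_def)
  show "1 - accept_prob c x z \<le> c * norm (g x) * norm z + q"
    using exp_ge_add_one_self[of "- t"] t by (simp add: \<alpha>)
  have "t\<^sup>2 \<le> (c * norm (g x) * norm z + q)\<^sup>2"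
    using t by (intro power_mono) auto
  also have "\<dots> \<le> 2 * (c * norm (g x) * norm z)\<^sup>2 + 2 * q\<^sup>2"
    using power2_norm_add_le[of "c * norm (g x) * norm z" q] by simp
  finally have "t\<^sup>2 \<le> 2 * c\<^sup>2 * (norm (g x))\<^sup>2 * (norm z)\<^sup>2 + 2 * q\<^sup>2"
    by (simp add: power_mult_distrib)
  moreover have "\<bar>t - max 0 (z \<bullet> (c *\<^sub>R g x))\<bar> \<le> q"
    using \<Delta> q by (auto simp: t_def)
  ultimately show "\<bar>(1 - accept_prob c x z) - max 0 (z \<bullet> (c *\<^sub>R g x))\<bar>
      \<le> 2 * c\<^sup>2 * (norm (g x))\<^sup>2 * (norm z)\<^sup>2 + 2 * q\<^sup>2 + q"
    using one_minus_exp_neg_approx[OF t(1)] unfolding \<alpha> by linarith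
qed

lemma norm_rwm_step_diff_le:
  assumes "0 \<le> c"
  shows "norm (rwm_step c x r - x) \<le> c * norm (fst r)"
  using assms by (auto simp: rwm_step_def)

text \<open>The deviation from the Euler step \<open>x - (c\<^sup>2 / 2) \<nabla>U x + c z\<close> of the Langevin dynamics, where \<open>z\<close> is
  the Gaussian variable that the Metropolis step proposes with.\<close>

definition rwm_error :: "real \<Rightarrow> 'a \<Rightarrow> 'a \<times> real \<Rightarrow> 'a" where
  "rwm_error c x r = rwm_step c x r - x + (c\<^sup>2 / 2) *\<^sub>R g x - c *\<^sub>R fst r"

definition rwm_mean_error :: "real \<Rightarrow> 'a \<Rightarrow> 'a" where
  "rwm_mean_error c x = (\<integral>r. rwm_error c x r \<partial>rwm_noise)"

abbreviation rwm_error_variance :: "real \<Rightarrow> real" where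
  "rwm_error_variance c \<equiv> \<integral>(x, r). (norm (rwm_error c x r))\<^sup>2 \<partial>(gibbs \<Otimes>\<^sub>M rwm_noise)"

lemma measurable_rwm_error [measurable]:
  "(\<lambda>(x, r). rwm_error c x r) \<in> borel_measurable (borel \<Otimes>\<^sub>M (borel \<Otimes>\<^sub>M borel))"
  unfolding rwm_error_def by measurable

lemma measurable_rwm_mean_error [measurable]: "rwm_mean_error c \<in> borel_measurable borel"
proof -
  interpret prob_space noise by (rule prob_space_rwm_noise)
  have "(\<lambda>x. \<integral>r. (case (x, r) of (x, r) \<Rightarrow> rwm_error c x r) \<partial>rwm_noise) \<in> borel_measurable borel"
    by (rule borel_measurable_lebesgue_integral) measurable
  then show ?thesis
    by (simp add: rwm_mean_error_def[abs_def])
qed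

lemma rwm_error_cases:
  "rwm_error c x r = (if snd r \<le> exp (U x - U (x + c *\<^sub>R fst r))
    then (c\<^sup>2 / 2) *\<^sub>R g x else (c\<^sup>2 / 2) *\<^sub>R g x - c *\<^sub>R fst r)"
  by (simp add: rwm_error_def rwm_step_def)

lemma norm_rwm_error_le:
  assumes "0 \<le> c"
  shows "norm (rwm_error c x r) \<le> c\<^sup>2 / 2 * norm (g x) + c * norm (fst r)"
  using assms norm_triangle_ineq4[of "(c\<^sup>2 / 2) *\<^sub>R g x" "c *\<^sub>R fst r"]
  by (auto simp: rwm_error_cases)

lemma integrable_rwm_noise_fst:
  fixes f :: "'a \<Rightarrow> 'b::euclidean_space"
  assumes "integrable std_gaussian f"
  shows "integrable rwm_noise (\<lambda>r. f (fst r))"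
proof -
  have "f \<in> borel_measurable borel"
    using borel_measurable_integrable[OF assms] by simp
  moreover have "integrable (distr rwm_noise borel fst) f"
    using assms by (simp add: distr_fst_rwm_noise)
  ultimately show ?thesis
    by (intro integrable_distr[where M'=borel and T=fst]) measurable
qed

lemma integrable_rwm_error:
  assumes c: "0 \<le> c"
  shows "integrable rwm_noise (rwm_error c x)"
proof (rule Bochner_Integration.integrable_bound)
  interpret prob_space noise by (rule prob_space_rwm_noise)
  have "integrable std_gaussian (\<lambda>z::'a. norm z)"
    by (rule integrable_std_gaussian_growth[where C=1 and k=1]) auto
  then have "integrable rwm_noise (\<lambda>r::'a \<times> real. norm (fst r))"
    by (rule integrable_rwm_noise_fst)
  then show "integrable rwm_noise (\<lambda>r::'a \<times> real. c\<^sup>2 / 2 * norm (g x) + c * norm (fst r))"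
    by (intro Bochner_Integration.integrable_add integrable_mult_right) auto
  show "AE r in rwm_noise. norm (rwm_error c x r) \<le> norm (c\<^sup>2 / 2 * norm (g x) + c * norm (fst r))"
    using norm_rwm_error_le[OF c, of x] c by (intro AE_I2) (auto intro: order_trans)
qed measurable

text \<open>The proposed move times the error of the linearised rejection probability.\<close>

definition drift_defect :: "real \<Rightarrow> 'a \<Rightarrow> 'a \<Rightarrow> 'a" where
  "drift_defect c x z = (c * (max 0 (z \<bullet> (c *\<^sub>R g x)) - (1 - accept_prob c x z))) *\<^sub>R z"

text \<open>To first order in \<open>c\<close>, a proposal \<open>x + c z\<close> is rejected with probability \<open>c (z \<bullet> g x)\<^sup>+\<close>.
  Averaging the lost moves \<open>c z\<close> yields \<open>c\<^sup>2 / 2\<close> times the gradient, by the half-space covariance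
  identity. So rejection makes up the drift of the Langevin dynamics over a time \<open>c\<^sup>2 / 2\<close>.\<close>

lemma rwm_mean_error_eq:
  assumes c: "0 < c"
  shows "rwm_mean_error c x = (\<integral>z. drift_defect c x z \<partial>std_gaussian)"
    and "integrable std_gaussian (drift_defect c x)"
proof -
  interpret G: prob_space gaussian by (rule prob_space_std_gaussian)
  interpret R: prob_space unit_uniform by (rule prob_space_unit_uniform)
  interpret P: pair_prob_space gaussian unit_uniform ..
  let ?h = "c\<^sup>2 / 2"
  have rej: "integrable std_gaussian (\<lambda>z. ((1 - accept_prob c x z) * c) *\<^sub>R z)"
  proof (rule integrable_std_gaussian_growth[where C=c and k=1])
    fix z
    have "\<bar>1 - accept_prob c x z\<bar> \<le> 1"
      using accept_prob_bounds(1)[of c x z] accept_prob_bounds(2)[of c x z] by linarith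
    then have "norm (((1 - accept_prob c x z) * c) *\<^sub>R z) \<le> 1 * c * norm z"
      using c by (simp add: abs_mult mult_right_mono)
    also have "\<dots> \<le> c * (1 + norm z) ^ 1"
      using c by simp
    finally show "norm (((1 - accept_prob c x z) * c) *\<^sub>R z) \<le> c * (1 + norm z) ^ 1" .
  qed measurable
  have posc: "integrable std_gaussian (\<lambda>z. c *\<^sub>R (max 0 (z \<bullet> (c *\<^sub>R g x)) *\<^sub>R z))"
    by (intro integrable_scaleR_right) (rule integrable_std_gaussian_pos_part)
  have E: "drift_defect c x z = c *\<^sub>R (max 0 (z \<bullet> (c *\<^sub>R g x)) *\<^sub>R z) - ((1 - accept_prob c x z) * c) *\<^sub>R z" for z
    by (simp add: drift_defect_def algebra_simps)
  show "integrable std_gaussian (drift_defect c x)"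
    unfolding E[abs_def] using posc rej by simp
  have "rwm_mean_error c x = (\<integral>p. rwm_error c x p \<partial>(std_gaussian \<Otimes>\<^sub>M unit_uniform))"
    by (simp add: rwm_mean_error_def rwm_noise_def)
  also have "\<dots> = (\<integral>z. (\<integral>u. rwm_error c x (z, u) \<partial>unit_uniform) \<partial>std_gaussian)"
    using integrable_rwm_error[of c x] c
    by (subst P.integral_fst'[symmetric]) (auto simp: rwm_noise_def)
  also have "\<dots> = (\<integral>z. ?h *\<^sub>R g x - ((1 - accept_prob c x z) * c) *\<^sub>R z \<partial>std_gaussian)"
  proof (intro Bochner_Integration.integral_cong refl)
    fix z
    have mix: "\<alpha> *\<^sub>R v + (1 - \<alpha>) *\<^sub>R (v - c *\<^sub>R z) = v - ((1 - \<alpha>) * c) *\<^sub>R z" for \<alpha> and v :: 'a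
      by (simp add: scaleR_diff_right scaleR_diff_left left_diff_distrib)
    show "(\<integral>u. rwm_error c x (z, u) \<partial>unit_uniform) = ?h *\<^sub>R g x - ((1 - accept_prob c x z) * c) *\<^sub>R z"
      unfolding mix[symmetric]
      by (simp add: rwm_error_cases integral_unit_uniform_threshold accept_prob_def[symmetric]
          cong: if_cong)
  qed
  also have "\<dots> = ?h *\<^sub>R g x - (\<integral>z. ((1 - accept_prob c x z) * c) *\<^sub>R z \<partial>std_gaussian)"
    using rej G.prob_space by (subst Bochner_Integration.integral_diff) auto
  also have "?h *\<^sub>R g x = (\<integral>z. c *\<^sub>R (max 0 (z \<bullet> (c *\<^sub>R g x)) *\<^sub>R z) \<partial>std_gaussian)"
    by (subst integral_scaleR_right) (simp add: integral_std_gaussian_pos_part power2_eq_square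
        del: inner_scaleR_right)
  also have "(\<integral>z. c *\<^sub>R (max 0 (z \<bullet> (c *\<^sub>R g x)) *\<^sub>R z) \<partial>std_gaussian)
      - (\<integral>z. ((1 - accept_prob c x z) * c) *\<^sub>R z \<partial>std_gaussian) = (\<integral>z. drift_defect c x z \<partial>std_gaussian)"
    unfolding E using posc rej by (rule Bochner_Integration.integral_diff[symmetric])
  finally show "rwm_mean_error c x = (\<integral>z. drift_defect c x z \<partial>std_gaussian)" .
qed

lemma norm_rwm_mean_error_le:
  assumes c: "0 < c" "c \<le> 1"
  shows "norm (rwm_mean_error c x) \<le> c ^ 3 * ((2 * (norm (g x))\<^sup>2 + L\<^sup>2 / 2 + L / 2) * gauss5 TYPE('a))"
proof -
  let ?K = "2 * (norm (g x))\<^sup>2 + L\<^sup>2 / 2 + L / 2"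
  have "norm (rwm_mean_error c x) \<le> (\<integral>z. norm (drift_defect c x z) \<partial>std_gaussian)"
    unfolding rwm_mean_error_eq(1)[OF c(1)] by (rule integral_norm_bound)
  also have "\<dots> \<le> (\<integral>z. c ^ 3 * (?K * (1 + norm z) ^ 5) \<partial>gaussian)"
  proof (rule integral_mono)
    fix z :: 'a
    define n where "n = norm z"
    have n: "0 \<le> n" by (simp add: n_def)
    have pw: "n ^ j \<le> (1 + n) ^ 5" if "j \<le> 5" for j
      using n that by (intro power_le_power_one_plus) auto
    define q where "q = L / 2 * c\<^sup>2 * n\<^sup>2"
    have q4: "2 * q\<^sup>2 \<le> c\<^sup>2 * (L\<^sup>2 / 2 * n ^ 4)"
    proof -
      have "2 * q\<^sup>2 = c\<^sup>2 * (c\<^sup>2 * (L\<^sup>2 / 2 * n ^ 4))"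
        by (simp add: q_def power_mult_distrib power_divide field_simps flip: power_mult)
      also have "\<dots> \<le> c\<^sup>2 * (1 * (L\<^sup>2 / 2 * n ^ 4))"
        using c n by (intro mult_left_mono mult_right_mono power_le_one) auto
      finally show ?thesis by simp
    qed
    have "norm (drift_defect c x z) = \<bar>(1 - accept_prob c x z) - max 0 (z \<bullet> (c *\<^sub>R g x))\<bar> * (c * n)"
      using c by (simp add: drift_defect_def abs_mult n_def abs_minus_commute mult_ac)
    also have "\<dots> \<le> (2 * c\<^sup>2 * (norm (g x))\<^sup>2 * n\<^sup>2 + 2 * q\<^sup>2 + q) * (c * n)"
      using rejection_prob_approx[OF c(1), of x z] c
      by (intro mult_right_mono) (auto simp: n_def q_def)
    also have "\<dots> \<le> (2 * c\<^sup>2 * (norm (g x))\<^sup>2 * n\<^sup>2 + c\<^sup>2 * (L\<^sup>2 / 2 * n ^ 4) + q) * (c * n)"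
      using q4 c n by (intro mult_right_mono) auto
    also have "\<dots> = c ^ 3 * (2 * (norm (g x))\<^sup>2 * n ^ 3 + L\<^sup>2 / 2 * n ^ 5 + L / 2 * n ^ 3)"
      by (simp add: q_def algebra_simps power2_eq_square power3_eq_cube eval_nat_numeral)
    also have "\<dots> \<le> c ^ 3 * (2 * (norm (g x))\<^sup>2 * (1 + n) ^ 5 + L\<^sup>2 / 2 * (1 + n) ^ 5 + L / 2 * (1 + n) ^ 5)"
      using c L_pos by (intro mult_left_mono add_mono pw) auto
    also have "\<dots> = c ^ 3 * (?K * (1 + norm z) ^ 5)"
      by (simp add: n_def distrib_right)
    finally show "norm (drift_defect c x z) \<le> c ^ 3 * (?K * (1 + norm z) ^ 5)" .
  next
    show "integrable std_gaussian (\<lambda>z. norm (drift_defect c x z))"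
      by (rule integrable_norm[OF rwm_mean_error_eq(2)[OF c(1)]])
  qed (intro integrable_mult_right integrable_std_gaussian_poly)
  also have "\<dots> = c ^ 3 * (?K * gauss5 TYPE('a))"
    by (simp add: gauss5_def)
  finally show ?thesis .
qed

text \<open>The error is of order \<open>c\<^sup>2\<close> on acceptance and of order \<open>c\<close> on rejection, which has a probability of
  order \<open>c\<close>.\<close>

lemma nn_integral_rwm_error_power2_le:
  assumes c: "0 < c" "c \<le> 1"
  shows "(\<integral>\<^sup>+r. ennreal ((norm (rwm_error c x r))\<^sup>2) \<partial>rwm_noise)
    \<le> ennreal (c ^ 3 * ((norm (g x))\<^sup>2 / 2 + (2 * norm (g x) + L) * gauss5 TYPE('a)))"
proof -
  interpret G: prob_space gaussian by (rule prob_space_std_gaussian)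
  let ?h = "c\<^sup>2 / 2"
  let ?A = "(norm (?h *\<^sub>R g x))\<^sup>2" and ?B = "\<lambda>z. (norm (?h *\<^sub>R g x - c *\<^sub>R z))\<^sup>2"
  have "(\<integral>\<^sup>+r. ennreal ((norm (rwm_error c x r))\<^sup>2) \<partial>rwm_noise)
    = (\<integral>\<^sup>+r. (\<lambda>z u. if u \<le> exp (U x - U (x + c *\<^sub>R z)) then ennreal ?A else ennreal (?B z))
        (fst r) (snd r) \<partial>rwm_noise)"
    by (intro nn_integral_cong) (auto simp: rwm_error_cases)
  also have "\<dots> = (\<integral>\<^sup>+z. \<integral>\<^sup>+u. (if u \<le> exp (U x - U (x + c *\<^sub>R z)) then ennreal ?A else ennreal (?B z))
        \<partial>unit_uniform \<partial>std_gaussian)"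
    by (rule nn_integral_rwm_noise) measurable
  also have "\<dots> = (\<integral>\<^sup>+z. ennreal (accept_prob c x z * ?A + (1 - accept_prob c x z) * ?B z) \<partial>std_gaussian)"
  proof (rule nn_integral_cong)
    fix z :: 'a
    have "0 \<le> 1 - accept_prob c x z" by simp
    then show "(\<integral>\<^sup>+u. (if u \<le> exp (U x - U (x + c *\<^sub>R z)) then ennreal ?A else ennreal (?B z)) \<partial>unit_uniform)
        = ennreal (accept_prob c x z * ?A + (1 - accept_prob c x z) * ?B z)"
      by (simp add: nn_integral_unit_uniform_threshold accept_prob_def[symmetric] ennreal_mult
          del: power_mult_distrib norm_scaleR)
  qed
  also have "\<dots> \<le> (\<integral>\<^sup>+z. ennreal (c ^ 3 * ((norm (g x))\<^sup>2 / 2 + (2 * norm (g x) + L) * (1 + norm z) ^ 5)) \<partial>gaussian)"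
  proof (intro nn_integral_mono ennreal_leI)
    fix z :: 'a
    define n \<gamma> \<alpha> where "n = norm z" and "\<gamma> = norm (g x)" and "\<alpha> = accept_prob c x z"
    have n: "0 \<le> n" "0 \<le> \<gamma>" by (auto simp: n_def \<gamma>_def)
    have \<alpha>: "0 \<le> \<alpha>" "\<alpha> \<le> 1" by (auto simp: \<alpha>_def)
    have A: "?A = c ^ 4 / 4 * \<gamma>\<^sup>2"
      using c by (simp add: \<gamma>_def power_mult_distrib power_divide flip: power_mult)
    have B: "?B z \<le> 2 * (c ^ 4 / 4 * \<gamma>\<^sup>2) + 2 * (c\<^sup>2 * n\<^sup>2)"
    proof -
      have "(norm (- (c *\<^sub>R z)))\<^sup>2 = c\<^sup>2 * n\<^sup>2"
        by (simp add: n_def power_mult_distrib)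
      then show ?thesis
        using power2_norm_add_le[of "?h *\<^sub>R g x" "- (c *\<^sub>R z)"] unfolding A by simp
    qed
    have pw: "n ^ j \<le> (1 + n) ^ 5" if "j \<le> 5" for j
      using n that by (intro power_le_power_one_plus) auto
    have c43: "c ^ 4 \<le> c ^ 3"
      using c by (intro power_decreasing) auto
    have "\<alpha> * ?A + (1 - \<alpha>) * ?B z \<le> \<alpha> * (2 * (c ^ 4 / 4 * \<gamma>\<^sup>2)) + (1 - \<alpha>) * (2 * (c ^ 4 / 4 * \<gamma>\<^sup>2) + 2 * (c\<^sup>2 * n\<^sup>2))"
    proof (intro add_mono mult_left_mono B)
      show "?A \<le> 2 * (c ^ 4 / 4 * \<gamma>\<^sup>2)"
        unfolding A by simp
    qed (use \<alpha> in auto)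
    also have "\<dots> = c ^ 4 * (\<gamma>\<^sup>2 / 2) + (1 - \<alpha>) * (2 * (c\<^sup>2 * n\<^sup>2))"
      by (simp add: field_simps)
    also have "\<dots> \<le> c ^ 3 * (\<gamma>\<^sup>2 / 2) + (c * \<gamma> * n + L / 2 * c\<^sup>2 * n\<^sup>2) * (2 * (c\<^sup>2 * n\<^sup>2))"
      using rejection_prob_le[OF c(1), of x z] c43
      by (intro add_mono mult_right_mono) (auto simp: \<alpha>_def n_def \<gamma>_def)
    also have "\<dots> = c ^ 3 * (\<gamma>\<^sup>2 / 2 + 2 * \<gamma> * n ^ 3) + c ^ 4 * (L * n ^ 4)"
      by (simp add: algebra_simps eval_nat_numeral)
    also have "\<dots> \<le> c ^ 3 * (\<gamma>\<^sup>2 / 2 + 2 * \<gamma> * n ^ 3) + c ^ 3 * (L * n ^ 4)"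
      using c43 L_pos n by (intro add_left_mono mult_right_mono) auto
    also have "\<dots> \<le> c ^ 3 * (\<gamma>\<^sup>2 / 2 + 2 * \<gamma> * (1 + n) ^ 5) + c ^ 3 * (L * (1 + n) ^ 5)"
      using c n L_pos by (intro add_mono mult_left_mono pw) auto
    also have "\<dots> = c ^ 3 * (\<gamma>\<^sup>2 / 2 + (2 * \<gamma> + L) * (1 + n) ^ 5)"
      by (simp add: algebra_simps)
    finally show "accept_prob c x z * ?A + (1 - accept_prob c x z) * ?B z
        \<le> c ^ 3 * ((norm (g x))\<^sup>2 / 2 + (2 * norm (g x) + L) * (1 + norm z) ^ 5)"
      by (simp add: n_def \<gamma>_def \<alpha>_def)
  qed
  also have "\<dots> = ennreal (\<integral>z. c ^ 3 * ((norm (g x))\<^sup>2 / 2 + (2 * norm (g x) + L) * (1 + norm z) ^ 5) \<partial>gaussian)"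
    using c L_pos by (intro nn_integral_eq_integral)
      (auto intro!: AE_I2 integrable_mult_right Bochner_Integration.integrable_add integrable_std_gaussian_poly)
  also have "(\<integral>z. c ^ 3 * ((norm (g x))\<^sup>2 / 2 + (2 * norm (g x) + L) * (1 + norm z) ^ 5) \<partial>gaussian)
      = c ^ 3 * ((norm (g x))\<^sup>2 / 2 + (2 * norm (g x) + L) * gauss5 TYPE('a))"
    using G.prob_space by (simp add: integrable_std_gaussian_poly gauss5_def)
  finally show ?thesis .
qed

text \<open>Per unit of time there are of order \<open>c\<^sup>-\<^sup>2\<close> steps, so mean errors of order \<open>c\<^sup>3\<close> add up to one of
  order \<open>c\<close>, and fluctuations of variance \<open>c\<^sup>3\<close> to one of variance \<open>c\<close>.\<close>

lemma rwm_error_bounds: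
  obtains C where "0 \<le> C"
    and "\<And>c. 0 < c \<Longrightarrow> c \<le> 1 \<Longrightarrow> square_integrable gibbs (rwm_mean_error c)"
    and "\<And>c. 0 < c \<Longrightarrow> c \<le> 1 \<Longrightarrow> l2_norm gibbs (rwm_mean_error c) \<le> C * c ^ 3"
    and "\<And>c. 0 < c \<Longrightarrow> c \<le> 1 \<Longrightarrow> square_integrable (gibbs \<Otimes>\<^sub>M rwm_noise) (\<lambda>(x, r). rwm_error c x r)"
    and "\<And>c. 0 < c \<Longrightarrow> c \<le> 1 \<Longrightarrow>
      rwm_error_variance c \<le> C * c ^ 3"
proof -
  interpret R: prob_space noise by (rule prob_space_rwm_noise)
  define K where "K x = (2 * (norm (g x))\<^sup>2 + L\<^sup>2 / 2 + L / 2) * gauss5 TYPE('a)" for x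
  define V where "V x = (norm (g x))\<^sup>2 / 2 + (2 * norm (g x) + L) * gauss5 TYPE('a)" for x
  have gb: "norm (g x) \<le> L * (1 + norm x)" for x
    using norm_gradient_le[of x] L_pos by (simp add: distrib_left)
  have g2: "(norm (g x))\<^sup>2 \<le> L\<^sup>2 * (1 + norm x)\<^sup>2" for x
    using power_mono[OF gb[of x], of 2] by (simp add: power_mult_distrib)
  have one: "1 \<le> (1 + norm x) ^ k" for x :: 'a and k
    by (intro one_le_power) auto
  have K_le: "K x \<le> ((2 * L\<^sup>2 + L\<^sup>2 / 2 + L / 2) * gauss5 TYPE('a)) * (1 + norm x) ^ 2" for x
  proof -
    have "K x \<le> (2 * (L\<^sup>2 * (1 + norm x)\<^sup>2) + L\<^sup>2 / 2 * (1 + norm x)\<^sup>2 + L / 2 * (1 + norm x)\<^sup>2) * gauss5 TYPE('a)"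
      unfolding K_def using g2[of x] one[of x 2] L_pos gauss5_nonneg
      by (intro mult_right_mono add_mono mult_left_mono)
         (auto simp: mult_le_cancel_left1)
    then show ?thesis by (simp add: algebra_simps)
  qed
  have K0: "0 \<le> K x" for x
    using L_pos gauss5_nonneg by (simp add: K_def)
  have V0: "0 \<le> V x" for x
    using L_pos gauss5_nonneg by (simp add: V_def)
  have K_meas [measurable]: "K \<in> borel_measurable borel"
    unfolding K_def[abs_def] by measurable
  have V_meas [measurable]: "V \<in> borel_measurable borel"
    unfolding V_def[abs_def] by measurable
  have V_le: "V x \<le> (L\<^sup>2 / 2 + (2 * L + L) * gauss5 TYPE('a)) * (1 + norm x) ^ 2" for x
  proof -
    have lin: "norm (g x) \<le> L * (1 + norm x)\<^sup>2"
    proof -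
      have "L * (1 + norm x) \<le> L * (1 + norm x)\<^sup>2"
        using L_pos by (intro mult_left_mono self_le_power) auto
      then show ?thesis using gb[of x] by simp
    qed
    have "V x \<le> L\<^sup>2 * (1 + norm x)\<^sup>2 / 2 + (2 * (L * (1 + norm x)\<^sup>2) + L * (1 + norm x)\<^sup>2) * gauss5 TYPE('a)"
      unfolding V_def using g2[of x] lin one[of x 2] L_pos gauss5_nonneg
      by (intro add_mono mult_right_mono mult_left_mono divide_right_mono)
         (auto simp: mult_le_cancel_left1)
    then show ?thesis by (simp add: algebra_simps)
  qed
  have K_sq: "square_integrable gibbs K"
    unfolding square_integrable_def
  proof
    show "integrable gibbs (\<lambda>x. (norm (K x))\<^sup>2)"
    proof (rule integrable_gibbs_growth)
      show "norm ((norm (K x))\<^sup>2) \<le> ((2 * L\<^sup>2 + L\<^sup>2 / 2 + L / 2) * gauss5 TYPE('a))\<^sup>2 * (1 + norm x) ^ 4" for x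
        using power_mono[OF K_le[of x] K0, of 2] by (simp add: power_mult_distrib flip: power_mult)
    qed measurable
  qed measurable
  have V_int: "integrable gibbs V"
    by (rule integrable_gibbs_growth[OF _ order_trans[OF _ V_le]]) (use V0 in auto)
  define C where "C = l2_norm gibbs K + (\<integral>x. V x \<partial>gibbs)"
  have V_nonneg: "0 \<le> (\<integral>x. V x \<partial>gibbs)"
    using V0 by (intro integral_nonneg_AE) auto
  show thesis
  proof (rule that)
    show "0 \<le> C"
      using V_nonneg by (simp add: C_def)
    fix c :: real assume c: "0 < c" "c \<le> 1"
    have K_sq': "square_integrable gibbs (\<lambda>x. c ^ 3 *\<^sub>R K x)"
      by (rule square_integrable_scaleR[OF K_sq])
    have mean: "norm (rwm_mean_error c x) \<le> norm (c ^ 3 *\<^sub>R K x)" for x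
      using norm_rwm_mean_error_le[OF c, of x] K0[of x] c by (simp add: K_def[symmetric])
    show "square_integrable gibbs (rwm_mean_error c)"
      by (rule square_integrable_mono[OF K_sq']) (use mean in auto)
    have "l2_norm gibbs (rwm_mean_error c) \<le> l2_norm gibbs (\<lambda>x. c ^ 3 *\<^sub>R K x)"
      by (rule l2_norm_mono[OF K_sq']) (use mean in auto)
    also have "\<dots> = l2_norm gibbs K * c ^ 3"
      using c by (simp only: l2_norm_scaleR) simp
    also have "\<dots> \<le> C * c ^ 3"
      using c V_nonneg by (intro mult_right_mono) (auto simp: C_def)
    finally show "l2_norm gibbs (rwm_mean_error c) \<le> C * c ^ 3" .
    have "(\<integral>\<^sup>+p. ennreal (case p of (x, r) \<Rightarrow> (norm (rwm_error c x r))\<^sup>2) \<partial>(gibbs \<Otimes>\<^sub>M rwm_noise))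
        = (\<integral>\<^sup>+x. \<integral>\<^sup>+r. ennreal ((norm (rwm_error c x r))\<^sup>2) \<partial>rwm_noise \<partial>gibbs)"
      by (subst R.nn_integral_fst[symmetric]) auto
    also have "\<dots> \<le> (\<integral>\<^sup>+x. ennreal (c ^ 3 * V x) \<partial>gibbs)"
      unfolding V_def by (intro nn_integral_mono nn_integral_rwm_error_power2_le c)
    also have "\<dots> = ennreal (\<integral>x. c ^ 3 * V x \<partial>gibbs)"
      using V_int V0 c by (intro nn_integral_eq_integral) auto
    also have "(\<integral>x. c ^ 3 * V x \<partial>gibbs) \<le> C * c ^ 3"
    proof -
      have "c ^ 3 * (\<integral>x. V x \<partial>gibbs) \<le> c ^ 3 * C"
        using c by (intro mult_left_mono) (auto simp: C_def)
      then show ?thesis by (simp add: mult.commute)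
    qed
    finally have "(\<integral>\<^sup>+p. ennreal (case p of (x, r) \<Rightarrow> (norm (rwm_error c x r))\<^sup>2) \<partial>(gibbs \<Otimes>\<^sub>M rwm_noise))
        \<le> ennreal (C * c ^ 3)"
      by (simp add: ennreal_leI)
    from integral_le_of_nn_integral_le[OF _ _ this] \<open>0 \<le> C\<close> c
    have *: "integrable (gibbs \<Otimes>\<^sub>M rwm_noise) (\<lambda>(x, r). (norm (rwm_error c x r))\<^sup>2) \<and>
        rwm_error_variance c \<le> C * c ^ 3"
      by (auto simp: split_beta')
    then show "rwm_error_variance c \<le> C * c ^ 3"
      by simp
    show "square_integrable (gibbs \<Otimes>\<^sub>M rwm_noise) (\<lambda>(x, r). rwm_error c x r)"
      using * by (auto simp: square_integrable_def split_beta')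
  qed
qed

end

section \<open>The stationary Metropolis chain and its driving noise\<close>

text \<open>The first pair is the initial coupling; its first component is the starting point of another process,
  which the chain does not move, and its second component is the starting point of the chain. The second pair
  consists of the present state of the chain and the sum of the Gaussian variables used so far. The
  initial values are kept in order to compare with them and to state independence of the noise.\<close>

type_synonym 'b coupled_state = "('b \<times> 'b) \<times> ('b \<times> 'b)"

abbreviation coupled_space :: "'b::euclidean_space coupled_state measure" where
  "coupled_space \<equiv> (borel \<Otimes>\<^sub>M borel) \<Otimes>\<^sub>M (borel \<Otimes>\<^sub>M borel)"

abbreviation start :: "'b coupled_state \<Rightarrow> 'b" where "start \<omega> \<equiv> snd (fst \<omega>)"

abbreviation current :: "'b coupled_state \<Rightarrow> 'b" where "current \<omega> \<equiv> fst (snd \<omega>)"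

abbreviation noise_sum :: "'b coupled_state \<Rightarrow> 'b" where "noise_sum \<omega> \<equiv> snd (snd \<omega>)"

abbreviation displacement :: "'b::real_vector coupled_state \<Rightarrow> 'b" where
  "displacement \<equiv> \<lambda>\<omega>. current \<omega> - start \<omega>"

locale coupled_chain = strongly_convex_smooth U g m L
  for U :: "'a::euclidean_space \<Rightarrow> real" and g m L +
  fixes \<gamma> :: "('a \<times> 'a) measure"
  assumes prob_coupling: "prob_space \<gamma>"
    and sets_coupling [measurable_cong]: "sets \<gamma> = sets (borel \<Otimes>\<^sub>M borel)"
    and coupling_snd: "distr \<gamma> borel snd = gibbs_measure U"
begin

definition chain_step :: "real \<Rightarrow> 'a coupled_state \<times> ('a \<times> real) \<Rightarrow> 'a coupled_state" where
  "chain_step c p = (fst (fst p), (rwm_step c (current (fst p)) (snd p), noise_sum (fst p) + fst (snd p)))"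

primrec chain :: "real \<Rightarrow> nat \<Rightarrow> 'a coupled_state measure" where
  "chain c 0 = distr \<gamma> coupled_space (\<lambda>p. (p, (snd p, 0)))"
| "chain c (Suc k) = distr (chain c k \<Otimes>\<^sub>M rwm_noise) coupled_space (chain_step c)"

lemma sets_chain [simp, measurable_cong]: "sets (chain c k) = sets coupled_space"
  by (cases k) auto

lemma space_chain [simp]: "space (chain c k) = UNIV"
  using sets_eq_imp_space_eq[OF sets_chain, of c k] by (simp add: space_pair_measure)

lemma measurable_rwm_step_current [measurable]:
  "(\<lambda>p. rwm_step c (current (fst p)) (snd p))
    \<in> borel_measurable (coupled_space \<Otimes>\<^sub>M (borel \<Otimes>\<^sub>M borel))"
  using measurable_compose[of "\<lambda>p. (current (fst p), snd p)"
      "coupled_space \<Otimes>\<^sub>M (borel \<Otimes>\<^sub>M borel)" "borel \<Otimes>\<^sub>M (borel \<Otimes>\<^sub>M borel)" "\<lambda>(x, r). rwm_step c x r" borel]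
  by simp

lemma measurable_chain_step [measurable]:
  "chain_step c \<in> measurable (coupled_space \<Otimes>\<^sub>M (borel \<Otimes>\<^sub>M borel)) coupled_space"
  unfolding chain_step_def[abs_def] by measurable

lemma prob_space_chain: "prob_space (chain c k)"
proof (induction k)
  case 0
  then show ?case
    using prob_coupling by (simp add: prob_space.prob_space_distr)
next
  case (Suc k)
  then show ?case
    by (auto intro!: prob_space.prob_space_distr prob_space_pair prob_space_rwm_noise)
qed

lemma chain_noise_pair:
  assumes X: "X \<in> borel_measurable (chain c k)"
  shows "distr (chain c k \<Otimes>\<^sub>M noise) (borel \<Otimes>\<^sub>M (borel \<Otimes>\<^sub>M borel)) (\<lambda>p. (X (fst p), snd p))
    = distr (chain c k) borel X \<Otimes>\<^sub>M noise"
proof -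
  have "distr (chain c k) borel X \<Otimes>\<^sub>M distr noise (borel \<Otimes>\<^sub>M borel) (\<lambda>r. r)
    = distr (chain c k \<Otimes>\<^sub>M noise) (borel \<Otimes>\<^sub>M (borel \<Otimes>\<^sub>M borel)) (\<lambda>(x, y). (X x, y))"
    using X prob_space_rwm_noise
    by (intro pair_measure_distr) (auto intro!: prob_space_imp_sigma_finite prob_space.prob_space_distr)
  moreover have "distr noise (borel \<Otimes>\<^sub>M borel) (\<lambda>r. r) = noise"
    by (rule distr_id2) simp
  ultimately show ?thesis
    by (simp add: split_beta')
qed

lemma chain_current: "distr (chain c k) borel current = gibbs"
proof (induction k)
  case 0
  show ?case
    by (simp add: distr_distr comp_def coupling_snd)
next
  case (Suc k)
  have "distr (chain c (Suc k)) borel current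
      = distr (chain c k \<Otimes>\<^sub>M rwm_noise) borel (\<lambda>p. (\<lambda>(x, r). rwm_step c x r) (current (fst p), snd p))"
    by (simp add: distr_distr comp_def chain_step_def)
  also have "\<dots> = distr (distr (chain c k \<Otimes>\<^sub>M rwm_noise) (borel \<Otimes>\<^sub>M (borel \<Otimes>\<^sub>M borel))
      (\<lambda>p. (current (fst p), snd p))) borel (\<lambda>(x, r). rwm_step c x r)"
    by (subst distr_distr) (auto simp: comp_def)
  also have "\<dots> = distr (gibbs \<Otimes>\<^sub>M rwm_noise) borel (\<lambda>(x, r). rwm_step c x r)"
    by (subst chain_noise_pair) (auto simp: Suc.IH)
  also have "\<dots> = gibbs"
    by (rule gibbs_rwm_invariant)
  finally show ?case .
qed

lemma chain_coupling: "distr (chain c k) (borel \<Otimes>\<^sub>M borel) fst = \<gamma>"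
proof (induction k)
  case 0
  show ?case
    by (simp add: distr_distr comp_def distr_id2 sets_coupling)
next
  case (Suc k)
  interpret R: prob_space noise by (rule prob_space_rwm_noise)
  have "distr (chain c (Suc k)) (borel \<Otimes>\<^sub>M borel) fst
      = distr (chain c k \<Otimes>\<^sub>M noise) (borel \<Otimes>\<^sub>M borel) (\<lambda>p. fst (fst p))"
    by (simp add: distr_distr comp_def chain_step_def)
  also have "\<dots> = distr (distr (chain c k \<Otimes>\<^sub>M noise) (chain c k) fst) (borel \<Otimes>\<^sub>M borel) fst"
    by (subst distr_distr) (auto simp: comp_def)
  also have "\<dots> = \<gamma>"
    by (simp only: R.distr_pair_fst Suc.IH)
  finally show ?case .
qed

lemma chain_start: "distr (chain c k) borel start = gibbs"
proof -
  have "distr (chain c k) borel start = distr (distr (chain c k) (borel \<Otimes>\<^sub>M borel) fst) borel snd"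
    by (subst distr_distr) (auto simp: comp_def)
  then show ?thesis
    by (simp add: chain_coupling coupling_snd)
qed

text \<open>The noise that has driven the chain is independent of the initial coupling, so it can drive a step of
  another chain from the other starting point. By induction the noise after \<open>k\<close> steps is \<open>sqrt k\<close> times a
  standard Gaussian; rotation invariance absorbs the next variable.\<close>

lemma nn_integral_chain_noise:
  assumes f [measurable]: "(\<lambda>(p, z). f p z) \<in> borel_measurable ((borel \<Otimes>\<^sub>M borel) \<Otimes>\<^sub>M borel)"
  shows "(\<integral>\<^sup>+\<omega>. f (fst \<omega>) (noise_sum \<omega>) \<partial>chain c k)
    = (\<integral>\<^sup>+p. \<integral>\<^sup>+z. f p (sqrt (real k) *\<^sub>R z) \<partial>std_gaussian \<partial>\<gamma>)"
  using f
proof (induction k arbitrary: f)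
  case 0
  note [measurable] = 0
  interpret G: prob_space gaussian by (rule prob_space_std_gaussian)
  show ?case
    using G.emeasure_space_1 by (simp add: nn_integral_distr)
next
  case (Suc k)
  note [measurable] = Suc.prems
  interpret G: prob_space gaussian by (rule prob_space_std_gaussian)
  interpret R: prob_space noise by (rule prob_space_rwm_noise)
  define F where "F p s = (\<integral>\<^sup>+z. f p (s + z) \<partial>std_gaussian)" for p s
  have F: "(\<lambda>(p, s). F p s) \<in> borel_measurable ((borel \<Otimes>\<^sub>M borel) \<Otimes>\<^sub>M borel)"
    unfolding F_def by measurable
  have sum_noise: "(\<integral>\<^sup>+r. f p (s + fst r) \<partial>rwm_noise) = F p s" for p s
  proof -
    have "(\<lambda>z. (p, s + z)) \<in> measurable borel ((borel \<Otimes>\<^sub>M borel) \<Otimes>\<^sub>M borel)"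
      by (intro measurable_Pair measurable_const borel_measurable_add) (auto simp: space_pair_measure)
    from measurable_compose[OF this Suc.prems]
    have [measurable]: "(\<lambda>z. f p (s + z)) \<in> borel_measurable borel"
      by simp
    show ?thesis
      unfolding F_def distr_fst_rwm_noise[symmetric]
      by (subst nn_integral_distr) auto
  qed
  have "(\<integral>\<^sup>+\<omega>. f (fst \<omega>) (noise_sum \<omega>) \<partial>chain c (Suc k))
      = (\<integral>\<^sup>+q. f (fst (fst q)) (noise_sum (fst q) + fst (snd q)) \<partial>(chain c k \<Otimes>\<^sub>M rwm_noise))"
    by (simp add: nn_integral_distr chain_step_def)
  also have "\<dots> = (\<integral>\<^sup>+\<omega>. \<integral>\<^sup>+r. f (fst \<omega>) (noise_sum \<omega> + fst r) \<partial>rwm_noise \<partial>chain c k)"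
    by (subst R.nn_integral_fst[symmetric]) auto
  also have "\<dots> = (\<integral>\<^sup>+\<omega>. F (fst \<omega>) (noise_sum \<omega>) \<partial>chain c k)"
    by (simp only: sum_noise)
  also have "\<dots> = (\<integral>\<^sup>+p. \<integral>\<^sup>+z. F p (sqrt (real k) *\<^sub>R z) \<partial>std_gaussian \<partial>\<gamma>)"
    by (rule Suc.IH[OF F])
  also have "\<dots> = (\<integral>\<^sup>+p. \<integral>\<^sup>+z. f p (sqrt (real (Suc k)) *\<^sub>R z) \<partial>std_gaussian \<partial>\<gamma>)"
  proof (rule nn_integral_cong)
    fix p :: "'a \<times> 'a"
    define b a where "b = 1 / sqrt (real (Suc k))" and "a = sqrt (real k) * b"
    have b: "b > 0" "sqrt (real (Suc k)) * b = 1"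
      by (auto simp: b_def)
    have ab: "a\<^sup>2 + b\<^sup>2 = 1"
    proof -
      have "a\<^sup>2 + b\<^sup>2 = (real k + 1) * b\<^sup>2"
        by (simp add: a_def power_mult_distrib distrib_right)
      also have "\<dots> = 1"
        by (simp add: b_def power_divide)
      finally show ?thesis .
    qed
    have "(\<lambda>z::'a. (p, sqrt (real (Suc k)) *\<^sub>R z)) \<in> measurable borel ((borel \<Otimes>\<^sub>M borel) \<Otimes>\<^sub>M borel)"
      by (intro measurable_Pair measurable_const borel_measurable_scaleR) (auto simp: space_pair_measure)
    from measurable_compose[OF this Suc.prems]
    have [measurable]: "(\<lambda>z. f p (sqrt (real (Suc k)) *\<^sub>R z)) \<in> borel_measurable borel"
      by simp
    have "F p (sqrt (real k) *\<^sub>R z) = (\<integral>\<^sup>+z'. f p (sqrt (real (Suc k)) *\<^sub>R (a *\<^sub>R z + b *\<^sub>R z')) \<partial>std_gaussian)" for z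
    proof -
      have "sqrt (real (Suc k)) *\<^sub>R (a *\<^sub>R z + b *\<^sub>R z') = sqrt (real k) *\<^sub>R z + z'" for z'
      proof -
        have "sqrt (real (Suc k)) * a = sqrt (real k)"
          using b(2) by (simp only: a_def mult.left_commute[of _ "sqrt (real k)"] mult_1_right)
        then show ?thesis
          by (simp only: scaleR_add_right scaleR_scaleR b(2) scaleR_one)
      qed
      then show ?thesis by (simp add: F_def)
    qed
    then have "(\<integral>\<^sup>+z. F p (sqrt (real k) *\<^sub>R z) \<partial>std_gaussian)
       = (\<integral>\<^sup>+z. \<integral>\<^sup>+z'. f p (sqrt (real (Suc k)) *\<^sub>R (a *\<^sub>R z + b *\<^sub>R z')) \<partial>std_gaussian \<partial>std_gaussian)"
      by simp
    also have "\<dots> = (\<integral>\<^sup>+z. f p (sqrt (real (Suc k)) *\<^sub>R z) \<partial>std_gaussian)"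
      by (rule nn_integral_std_gaussian_rotate[OF _ b(1) ab,
            where f="\<lambda>z. f p (sqrt (real (Suc k)) *\<^sub>R z)"]) measurable
    finally show "(\<integral>\<^sup>+z. F p (sqrt (real k) *\<^sub>R z) \<partial>std_gaussian)
        = (\<integral>\<^sup>+z. f p (sqrt (real (Suc k)) *\<^sub>R z) \<partial>std_gaussian)" .
  qed
  finally show ?case .
qed

lemma square_integrable_current:
  assumes "square_integrable gibbs f"
  shows "square_integrable (chain c k) (\<lambda>\<omega>. f (current \<omega>))"
  using assms square_integrable_distr[of current "chain c k" borel f]
  by (auto simp: chain_current dest!: square_integrableD(1))

lemma square_integrable_start:
  assumes "square_integrable gibbs f"
  shows "square_integrable (chain c k) (\<lambda>\<omega>. f (start \<omega>))"
  using assms square_integrable_distr[of start "chain c k" borel f]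
  by (auto simp: chain_start dest!: square_integrableD(1))

lemma l2_norm_current:
  assumes "f \<in> borel_measurable borel"
  shows "l2_norm (chain c k) (\<lambda>\<omega>. f (current \<omega>)) = l2_norm gibbs f"
  using assms l2_norm_distr[of current "chain c k" borel f] by (simp add: chain_current)

lemma square_integrable_gradient: "square_integrable gibbs g"
  by (rule square_integrable_mono[OF square_integrable_scaleR[OF square_integrable_gibbs_id, of L]])
     (use norm_gradient_le L_pos in auto)

lemma square_integrable_noise_sum: "square_integrable (chain c k) noise_sum"
  unfolding square_integrable_def
proof
  have "(\<integral>\<^sup>+\<omega>. ennreal ((norm (noise_sum \<omega>))\<^sup>2) \<partial>chain c k)
      = (\<integral>\<^sup>+p. \<integral>\<^sup>+z. ennreal ((norm (sqrt (real k) *\<^sub>R z))\<^sup>2) \<partial>gaussian \<partial>\<gamma>)"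
    by (rule nn_integral_chain_noise) measurable
  also have "(\<integral>\<^sup>+z. ennreal ((norm (sqrt (real k) *\<^sub>R z))\<^sup>2) \<partial>gaussian)
      = ennreal (\<integral>z. (norm (sqrt (real k) *\<^sub>R z))\<^sup>2 \<partial>gaussian)"
    using square_integrableD(2)[OF square_integrable_scaleR[OF square_integrable_std_gaussian_id, of "sqrt (real k)"]]
    by (intro nn_integral_eq_integral) auto
  also have "(\<integral>\<^sup>+p. \<dots> \<partial>\<gamma>) < \<infinity>"
    using prob_space.emeasure_space_1[OF prob_coupling] by simp
  finally show "integrable (chain c k) (\<lambda>\<omega>. (norm (noise_sum \<omega>))\<^sup>2)"
    by (intro integrableI_nonneg) auto
qed measurable

lemma square_integrable_mean_error:
  assumes "0 < c" "c \<le> 1"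
  shows "square_integrable gibbs (rwm_mean_error c)"
  using rwm_error_bounds assms by metis

text \<open>The drift does not increase the mean-square displacement: by convexity
  \<open>(start - current) \<bullet> g current\<close> is at most \<open>U start - U current\<close>, which has mean zero because the
  chain is stationary.\<close>

lemma chain_displacement_step:
  assumes c: "0 < c" "c \<le> 1"
  shows "(l2_norm (chain c (Suc k)) displacement)\<^sup>2
    \<le> (l2_norm (chain c k) displacement + l2_norm gibbs (rwm_mean_error c))\<^sup>2
      + c\<^sup>2 * DIM('a)"
proof -
  interpret R: prob_space noise by (rule prob_space_rwm_noise)
  interpret M: prob_space "chain c k" by (rule prob_space_chain)
  let ?M = "chain c k" and ?R = noise
  define f where "f \<omega> = current \<omega> - start \<omega>" for \<omega> :: "'a coupled_state"
  define e where "e p = rwm_step c (current (fst p)) (snd p) - current (fst p)" for p :: "'a coupled_state \<times> 'a \<times> real"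
  let ?V = "\<integral>p. (norm (e p))\<^sup>2 \<partial>(?M \<Otimes>\<^sub>M ?R)"
  let ?me = "\<lambda>\<omega>::'a coupled_state. rwm_mean_error c (current \<omega>)"
  have e_meas [measurable]: "e \<in> borel_measurable (?M \<Otimes>\<^sub>M ?R)"
    unfolding e_def by measurable
  have f_sq: "square_integrable ?M f"
    unfolding f_def
    by (intro square_integrable_diff square_integrable_current[where f="\<lambda>x. x"]
        square_integrable_start[where f="\<lambda>x. x"] square_integrable_gibbs_id)
  have me_sq: "square_integrable ?M ?me"
    by (intro square_integrable_current square_integrable_mean_error c)
  have g_sq: "square_integrable ?M (\<lambda>\<omega>. g (current \<omega>))"
    by (intro square_integrable_current square_integrable_gradient)
  have distr_z: "distr (?M \<Otimes>\<^sub>M ?R) borel (\<lambda>p. fst (snd p)) = std_gaussian"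
  proof -
    have "distr (?M \<Otimes>\<^sub>M ?R) borel (\<lambda>p. fst (snd p)) = distr (distr (?M \<Otimes>\<^sub>M ?R) ?R snd) borel fst"
      by (subst distr_distr) (auto simp: comp_def)
    also have "distr (?M \<Otimes>\<^sub>M ?R) ?R snd = ?R"
      by (rule distr_pair_snd[OF prob_space_chain prob_space_rwm_noise])
    finally show ?thesis by (simp add: distr_fst_rwm_noise)
  qed
  have z_sq: "square_integrable (?M \<Otimes>\<^sub>M ?R) (\<lambda>p. c *\<^sub>R fst (snd p))"
  proof (rule square_integrable_scaleR)
    have "square_integrable (distr (?M \<Otimes>\<^sub>M ?R) borel (\<lambda>p. fst (snd p))) (\<lambda>z. z)"
      unfolding distr_z by (rule square_integrable_std_gaussian_id)
    then show "square_integrable (?M \<Otimes>\<^sub>M ?R) (\<lambda>p. fst (snd p))"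
      by (subst (asm) square_integrable_distr) auto
  qed
  have e_le: "norm (e p) \<le> norm (c *\<^sub>R fst (snd p))" for p
    using norm_rwm_step_diff_le[of c "current (fst p)" "snd p"] c by (simp add: e_def)
  have e_sq: "square_integrable (?M \<Otimes>\<^sub>M ?R) e"
    by (rule square_integrable_mono[OF z_sq e_meas]) (rule e_le)
  have e_norm: "?V \<le> c\<^sup>2 * DIM('a)"
  proof -
    have "?V = (l2_norm (?M \<Otimes>\<^sub>M ?R) e)\<^sup>2"
      by (simp add: l2_norm_power2)
    also have "\<dots> \<le> (l2_norm (?M \<Otimes>\<^sub>M ?R) (\<lambda>p. c *\<^sub>R fst (snd p)))\<^sup>2"
      by (intro power_mono l2_norm_mono[OF z_sq e_meas] e_le) auto
    also have "\<dots> = c\<^sup>2 * (l2_norm std_gaussian (\<lambda>z::'a. z))\<^sup>2"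
    proof -
      have "l2_norm (?M \<Otimes>\<^sub>M ?R) (\<lambda>p. fst (snd p)) = l2_norm std_gaussian (\<lambda>z::'a. z)"
        unfolding distr_z[symmetric] by (subst l2_norm_distr) auto
      then show ?thesis
        by (simp only: l2_norm_scaleR power_mult_distrib power2_abs)
    qed
    also have "\<dots> = c\<^sup>2 * DIM('a)"
      by (simp add: l2_norm_power2 integral_std_gaussian_norm_power2)
    finally show ?thesis .
  qed
  have ebar: "(\<integral>r. e (\<omega>, r) \<partial>?R) = ?me \<omega> - (c\<^sup>2 / 2) *\<^sub>R g (current \<omega>)" for \<omega>
  proof -
    have int_id: "integrable std_gaussian (\<lambda>z::'a. z)"
      by (rule integrable_std_gaussian_growth[where C=1 and k=1]) auto
    have int_z: "integrable ?R (\<lambda>r. fst r)"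
      by (rule integrable_rwm_noise_fst[OF int_id])
    have "(\<integral>z. z \<partial>distr ?R borel fst) = (\<integral>r. fst r \<partial>?R)"
      by (rule integral_distr) auto
    then have z0: "(\<integral>r. fst r \<partial>?R) = 0"
      by (simp only: distr_fst_rwm_noise integral_std_gaussian_id)
    have "(\<integral>r. e (\<omega>, r) \<partial>?R)
        = (\<integral>r. (rwm_error c (current \<omega>) r - (c\<^sup>2 / 2) *\<^sub>R g (current \<omega>)) + c *\<^sub>R fst r \<partial>?R)"
      by (intro Bochner_Integration.integral_cong refl) (simp add: e_def rwm_error_def)
    also have "\<dots> = (?me \<omega> - (c\<^sup>2 / 2) *\<^sub>R g (current \<omega>)) + c *\<^sub>R (\<integral>r. fst r \<partial>?R)"
    proof -
      have err: "integrable ?R (rwm_error c (current \<omega>))"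
        using c by (intro integrable_rwm_error) simp
      then have "integrable ?R (\<lambda>r. rwm_error c (current \<omega>) r - (c\<^sup>2 / 2) *\<^sub>R g (current \<omega>))"
        by (intro Bochner_Integration.integrable_diff) auto
      moreover have "integrable ?R (\<lambda>r. c *\<^sub>R fst r)"
        using int_z by (rule integrable_scaleR_right)
      ultimately show ?thesis
        using err R.prob_space
        by (simp add: Bochner_Integration.integral_add Bochner_Integration.integral_diff
            rwm_mean_error_def)
    qed
    finally show ?thesis by (simp add: z0)
  qed
  have U_int: "integrable ?M (\<lambda>\<omega>. U (current \<omega>))" "integrable ?M (\<lambda>\<omega>. U (start \<omega>))"
    using integrable_gibbs_U integrable_distr_eq[of current ?M borel U] integrable_distr_eq[of start ?M borel U]
    by (simp_all add: chain_current chain_start)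
  have "0 = (\<integral>\<omega>. U (current \<omega>) - U (start \<omega>) \<partial>?M)"
    using integral_distr[of current ?M borel U] integral_distr[of start ?M borel U] U_int
    by (simp add: chain_current chain_start)
  also have "\<dots> \<le> (\<integral>\<omega>. f \<omega> \<bullet> g (current \<omega>) \<partial>?M)"
  proof (rule integral_mono)
    show "U (current \<omega>) - U (start \<omega>) \<le> f \<omega> \<bullet> g (current \<omega>)" for \<omega>
      using convex_lower[where x="current \<omega>" and y="start \<omega>"]
      by (simp add: f_def inner_diff_left inner_diff_right inner_commute)
  qed (use U_int square_integrable_inner[OF f_sq g_sq] in auto)
  finally have drift: "0 \<le> (\<integral>\<omega>. f \<omega> \<bullet> g (current \<omega>) \<partial>?M)" .
  have cross: "(\<integral>\<omega>. f \<omega> \<bullet> (?me \<omega> - (c\<^sup>2 / 2) *\<^sub>R g (current \<omega>)) \<partial>?M) \<le> l2_norm ?M f * l2_norm gibbs (rwm_mean_error c)"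
  proof -
    have "(\<integral>\<omega>. f \<omega> \<bullet> (?me \<omega> - (c\<^sup>2 / 2) *\<^sub>R g (current \<omega>)) \<partial>?M)
        = (\<integral>\<omega>. f \<omega> \<bullet> ?me \<omega> - (c\<^sup>2 / 2) * (f \<omega> \<bullet> g (current \<omega>)) \<partial>?M)"
      by (simp add: inner_diff_right)
    also have "\<dots> = (\<integral>\<omega>. f \<omega> \<bullet> ?me \<omega> \<partial>?M) - (c\<^sup>2 / 2) * (\<integral>\<omega>. f \<omega> \<bullet> g (current \<omega>) \<partial>?M)"
      using square_integrable_inner[OF f_sq me_sq] square_integrable_inner[OF f_sq g_sq]
      by (subst Bochner_Integration.integral_diff) auto
    also have "\<dots> \<le> (\<integral>\<omega>. f \<omega> \<bullet> ?me \<omega> \<partial>?M)"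
      using drift by simp
    also have "\<dots> \<le> l2_norm ?M f * l2_norm ?M ?me"
      by (rule l2_norm_cauchy_schwarz[OF f_sq me_sq])
    finally show ?thesis
      by (simp add: l2_norm_current)
  qed
  have "(l2_norm (chain c (Suc k)) displacement)\<^sup>2
      = (\<integral>p. (norm (f (fst p) + e p))\<^sup>2 \<partial>(?M \<Otimes>\<^sub>M ?R))"
  proof -
    have "current (chain_step c p) - start (chain_step c p) = f (fst p) + e p" for p
      by (simp add: chain_step_def f_def e_def)
    then show ?thesis
      by (simp add: l2_norm_distr) (simp add: l2_norm_power2)
  qed
  also have "\<dots> = (l2_norm ?M f)\<^sup>2 + 2 * (\<integral>\<omega>. f \<omega> \<bullet> (?me \<omega> - (c\<^sup>2 / 2) *\<^sub>R g (current \<omega>)) \<partial>?M)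
      + ?V"
    using l2_norm_add_noise[OF prob_space_chain prob_space_rwm_noise f_sq e_sq]
    by (simp add: ebar l2_norm_power2)
  also have "\<dots> \<le> (l2_norm ?M f)\<^sup>2 + 2 * (l2_norm ?M f * l2_norm gibbs (rwm_mean_error c)) + c\<^sup>2 * DIM('a)"
    using cross e_norm by simp
  also have "\<dots> \<le> (l2_norm ?M f + l2_norm gibbs (rwm_mean_error c))\<^sup>2 + c\<^sup>2 * DIM('a)"
    by (simp add: power2_sum)
  finally show ?thesis
    by (simp only: f_def[abs_def])
qed

text \<open>\<open>dev k\<close> is the deviation of the chain from one large Euler step over the time \<open>k c\<^sup>2 / 2\<close>. It grows
  by the error of the Metropolis step and by the difference of the gradients at the present state and at
  the start, which the displacement controls.\<close>

lemma chain_error_step: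
  assumes c: "0 < c" "c \<le> 1"
    and sq: "square_integrable (gibbs \<Otimes>\<^sub>M rwm_noise) (\<lambda>(x, r). rwm_error c x r)"
  defines "dev \<equiv> \<lambda>k \<omega>. current \<omega> - start \<omega> + (real k * (c\<^sup>2 / 2)) *\<^sub>R g (start \<omega>) - c *\<^sub>R noise_sum \<omega>"
  shows "(l2_norm (chain c (Suc k)) (dev (Suc k)))\<^sup>2
    \<le> (l2_norm (chain c k) (dev k)
        + (c\<^sup>2 / 2 * L * l2_norm (chain c k) displacement
          + l2_norm gibbs (rwm_mean_error c)))\<^sup>2
      + rwm_error_variance c"
proof -
  let ?M = "chain c k" and ?R = noise
  define grd where "grd \<omega> = - ((c\<^sup>2 / 2) *\<^sub>R (g (current \<omega>) - g (start \<omega>)))" for \<omega> :: "'a coupled_state"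
  define f where "f \<omega> = dev k \<omega> + grd \<omega>" for \<omega>
  define e where "e p = rwm_error c (current (fst p)) (snd p)" for p :: "'a coupled_state \<times> 'a \<times> real"
  let ?V = "\<integral>p. (norm (e p))\<^sup>2 \<partial>(?M \<Otimes>\<^sub>M ?R)"
  let ?me = "\<lambda>\<omega>::'a coupled_state. rwm_mean_error c (current \<omega>)"
  have dev_meas [measurable]: "dev j \<in> borel_measurable coupled_space" for j
    unfolding dev_def by measurable
  have disp_sq: "square_integrable ?M displacement"
    by (intro square_integrable_diff square_integrable_current[where f="\<lambda>x. x"]
        square_integrable_start[where f="\<lambda>x. x"] square_integrable_gibbs_id)
  have dev_sq: "square_integrable ?M (dev k)"
    unfolding dev_def
    by (intro square_integrable_diff square_integrable_add square_integrable_scaleR disp_sq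
        square_integrable_start square_integrable_gradient square_integrable_noise_sum)
  have disp_sq': "square_integrable ?M (\<lambda>\<omega>. (c\<^sup>2 / 2 * L) *\<^sub>R (current \<omega> - start \<omega>))"
    by (rule square_integrable_scaleR[OF disp_sq])
  have grd_le: "norm (grd \<omega>) \<le> norm ((c\<^sup>2 / 2 * L) *\<^sub>R (current \<omega> - start \<omega>))" for \<omega>
  proof -
    have "c\<^sup>2 / 2 * norm (g (current \<omega>) - g (start \<omega>)) \<le> c\<^sup>2 / 2 * (L * norm (current \<omega> - start \<omega>))"
      by (intro mult_left_mono gradient_lipschitz) auto
    then show ?thesis
      using L_pos by (simp add: grd_def abs_mult)
  qed
  have grd_meas: "grd \<in> borel_measurable ?M"
    unfolding grd_def by measurable
  have grd_sq: "square_integrable ?M grd"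
    by (rule square_integrable_mono[OF disp_sq' grd_meas]) (rule grd_le)
  have f_sq: "square_integrable ?M f"
    unfolding f_def by (rule square_integrable_add[OF dev_sq grd_sq])
  have f_norm: "l2_norm ?M f \<le> l2_norm ?M (dev k) + c\<^sup>2 / 2 * L * l2_norm ?M displacement"
  proof -
    have "l2_norm ?M f \<le> l2_norm ?M (dev k) + l2_norm ?M grd"
      unfolding f_def by (rule l2_norm_triangle[OF dev_sq grd_sq])
    also have "l2_norm ?M grd \<le> l2_norm ?M (\<lambda>\<omega>. (c\<^sup>2 / 2 * L) *\<^sub>R (current \<omega> - start \<omega>))"
      by (rule l2_norm_mono[OF disp_sq' grd_meas]) (rule grd_le)
    also have "\<dots> = c\<^sup>2 / 2 * L * l2_norm ?M displacement"
      using L_pos by (simp only: l2_norm_scaleR) (simp add: abs_mult)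
    finally show ?thesis by simp
  qed
  have me_sq: "square_integrable ?M ?me"
    by (intro square_integrable_current square_integrable_mean_error c)
  have pair: "distr (?M \<Otimes>\<^sub>M ?R) (borel \<Otimes>\<^sub>M (borel \<Otimes>\<^sub>M borel)) (\<lambda>p. (current (fst p), snd p)) = gibbs \<Otimes>\<^sub>M ?R"
    by (subst chain_noise_pair) (auto simp: chain_current)
  have e_sq: "square_integrable (?M \<Otimes>\<^sub>M ?R) e"
  proof -
    have "square_integrable (distr (?M \<Otimes>\<^sub>M ?R) (borel \<Otimes>\<^sub>M (borel \<Otimes>\<^sub>M borel))
        (\<lambda>p. (current (fst p), snd p))) (\<lambda>(x, r). rwm_error c x r)"
      unfolding pair by (rule sq)
    then have "square_integrable (?M \<Otimes>\<^sub>M ?R) (\<lambda>p. (\<lambda>(x, r). rwm_error c x r) (current (fst p), snd p))"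
      by (subst (asm) square_integrable_distr) auto
    then show ?thesis
      by (simp only: e_def[abs_def] prod.case)
  qed
  have e_norm: "?V = rwm_error_variance c"
    unfolding pair[symmetric] by (subst integral_distr) (auto simp: e_def)
  have ebar: "(\<integral>r. e (\<omega>, r) \<partial>?R) = ?me \<omega>" for \<omega>
    by (simp add: e_def rwm_mean_error_def)
  have "(l2_norm (chain c (Suc k)) (dev (Suc k)))\<^sup>2 = (\<integral>p. (norm (f (fst p) + e p))\<^sup>2 \<partial>(?M \<Otimes>\<^sub>M ?R))"
  proof -
    have split: "(real (Suc k) * (c\<^sup>2 / 2)) *\<^sub>R v = (c\<^sup>2 / 2) *\<^sub>R v + (real k * (c\<^sup>2 / 2)) *\<^sub>R v" for v :: 'a
      by (simp only: of_nat_Suc distrib_right scaleR_add_left mult_1_left)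
    have alg: "r - st + (h *\<^sub>R gs + A) - c *\<^sub>R (s + z)
        = x - st + A - c *\<^sub>R s + - (h *\<^sub>R (gx - gs)) + (r - x + h *\<^sub>R gx - c *\<^sub>R z)"
      for r st A gs s z x gx :: 'a and h :: real
      by (simp add: algebra_simps)
    have "dev (Suc k) (chain_step c p) = f (fst p) + e p" for p
      unfolding dev_def chain_step_def f_def grd_def e_def rwm_error_def split fst_conv snd_conv
      by (rule alg)
    then show ?thesis
      by (simp add: l2_norm_distr) (simp add: l2_norm_power2)
  qed
  also have "\<dots> = (l2_norm ?M f)\<^sup>2 + 2 * (\<integral>\<omega>. f \<omega> \<bullet> ?me \<omega> \<partial>?M) + ?V"
    using l2_norm_add_noise[OF prob_space_chain prob_space_rwm_noise f_sq e_sq]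
    by (simp add: ebar l2_norm_power2)
  also have "\<dots> \<le> (l2_norm ?M f)\<^sup>2 + 2 * (l2_norm ?M f * l2_norm gibbs (rwm_mean_error c)) + ?V"
    using l2_norm_cauchy_schwarz[OF f_sq me_sq] by (simp add: l2_norm_current)
  also have "\<dots> \<le> (l2_norm ?M f + l2_norm gibbs (rwm_mean_error c))\<^sup>2 + ?V"
    by (simp add: power2_sum)
  also have "\<dots> \<le> (l2_norm ?M (dev k) + (c\<^sup>2 / 2 * L * l2_norm ?M displacement
          + l2_norm gibbs (rwm_mean_error c)))\<^sup>2 + ?V"
    using f_norm by (intro add_right_mono power_mono) auto
  finally show ?thesis
    by (simp add: e_norm)
qed

text \<open>With \<open>n c\<^sup>2 = 2 \<eta>\<close> fixed and \<open>n\<close> tending to infinity, the errors of the Metropolis steps vanish. There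
  remain the displacement bound \<open>sqrt (2 \<eta> d)\<close> and its effect on the gradient over the time \<open>\<eta>\<close>.\<close>

lemma chain_langevin_error:
  assumes \<eta>: "0 < \<eta>" and \<epsilon>: "0 < \<epsilon>"
  obtains n c where "0 < n" "0 < c" "c * sqrt (real n) = sqrt (2 * \<eta>)"
    "l2_norm (chain c n) (\<lambda>\<omega>. current \<omega> - start \<omega> + \<eta> *\<^sub>R g (start \<omega>) - c *\<^sub>R noise_sum \<omega>)
      \<le> L * \<eta> * sqrt (2 * \<eta> * DIM('a)) + \<epsilon>"
proof -
  obtain C where C: "0 \<le> C"
    and C_mean: "\<And>c. 0 < c \<Longrightarrow> c \<le> 1 \<Longrightarrow> l2_norm gibbs (rwm_mean_error c) \<le> C * c ^ 3"
    and C_sq: "\<And>c. 0 < c \<Longrightarrow> c \<le> 1 \<Longrightarrow> square_integrable (gibbs \<Otimes>\<^sub>M rwm_noise) (\<lambda>(x, r). rwm_error c x r)"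
    and C_var: "\<And>c. 0 < c \<Longrightarrow> c \<le> 1 \<Longrightarrow>
      rwm_error_variance c \<le> C * c ^ 3"
    using rwm_error_bounds by metis
  \<comment> \<open>A bound for the total error after \<open>n\<close> steps when \<open>n c\<^sup>2 = 2 \<eta>\<close>.\<close>
  define B where "B c = \<eta> * L * (2 * \<eta> * C * c + sqrt (2 * \<eta> * DIM('a))) + 2 * \<eta> * C * c + sqrt (2 * \<eta> * C * c)" for c
  define cs where "cs n = sqrt (2 * \<eta> / real n)" for n :: nat
  have cs0: "cs \<longlonglongrightarrow> 0"
  proof -
    have "(\<lambda>n. sqrt (2 * \<eta> / real n)) \<longlonglongrightarrow> sqrt 0"
      by (intro tendsto_real_sqrt lim_const_over_n)
    then show ?thesis by (simp add: cs_def[abs_def])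
  qed
  have "(\<lambda>n. B (cs n)) \<longlonglongrightarrow> \<eta> * L * (2 * \<eta> * C * 0 + sqrt (2 * \<eta> * DIM('a))) + 2 * \<eta> * C * 0 + sqrt (2 * \<eta> * C * 0)"
    unfolding B_def by (intro tendsto_intros cs0)
  then have "(\<lambda>n. B (cs n)) \<longlonglongrightarrow> L * \<eta> * sqrt (2 * \<eta> * DIM('a))"
    by (simp add: mult.commute)
  then have "eventually (\<lambda>n. B (cs n) < L * \<eta> * sqrt (2 * \<eta> * DIM('a)) + \<epsilon>) sequentially"
    by (rule order_tendstoD) (use \<epsilon> in simp)
  moreover have "eventually (\<lambda>n. cs n < 1) sequentially"
    by (rule order_tendstoD[OF cs0]) simp
  ultimately have "eventually (\<lambda>n. B (cs n) < L * \<eta> * sqrt (2 * \<eta> * DIM('a)) + \<epsilon> \<and> cs n < 1 \<and> 0 < n) sequentially"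
    using eventually_gt_at_top[of 0] by eventually_elim auto
  then obtain n where n: "B (cs n) < L * \<eta> * sqrt (2 * \<eta> * DIM('a)) + \<epsilon>" "cs n < 1" "0 < n"
    by (auto dest: eventually_happens simp: trivial_limit_sequentially)
  define c where "c = cs n"
  have c: "0 < c" "c \<le> 1" and cn: "real n * c\<^sup>2 = 2 * \<eta>"
    using n \<eta> by (auto simp: c_def cs_def)
  define b where "b = l2_norm gibbs (rwm_mean_error c)"
  define \<delta> where "\<delta> = rwm_error_variance c"
  have b0: "0 \<le> b" by (simp add: b_def)
  have \<delta>0: "0 \<le> \<delta>" unfolding \<delta>_def by (intro integral_nonneg_AE) auto
  have c3: "real n * (C * c ^ 3) = 2 * \<eta> * C * c"
    unfolding cn[symmetric] by (simp add: power2_eq_square power3_eq_cube)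
  have nb: "real n * b \<le> 2 * \<eta> * C * c"
    unfolding c3[symmetric] b_def using C_mean[OF c] by (intro mult_left_mono) auto
  have n\<delta>: "real n * \<delta> \<le> 2 * \<eta> * C * c"
    unfolding c3[symmetric] \<delta>_def using C_var[OF c] by (intro mult_left_mono) auto
  define v where "v k = l2_norm (chain c k) displacement" for k
  have v0: "v 0 = 0"
    by (simp add: v_def l2_norm_distr) (simp add: l2_norm_def)
  have v: "v k \<le> 2 * \<eta> * C * c + sqrt (2 * \<eta> * DIM('a))" if "k \<le> n" for k
  proof -
    have "v k \<le> real k * b + sqrt (real k * (c\<^sup>2 * DIM('a)))"
      by (rule error_accumulation[where n=k])
         (use v0 b0 chain_displacement_step[OF c] in \<open>auto simp: v_def b_def\<close>)
    also have "\<dots> \<le> real n * b + sqrt (real n * (c\<^sup>2 * DIM('a)))"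
      using that b0 by (intro add_mono mult_right_mono real_sqrt_le_mono) auto
    also have "real n * (c\<^sup>2 * DIM('a)) = 2 * \<eta> * DIM('a)"
      using cn by (simp add: mult.assoc[symmetric])
    finally show ?thesis using nb by simp
  qed
  define V where "V = 2 * \<eta> * C * c + sqrt (2 * \<eta> * DIM('a))"
  have V0: "0 \<le> V"
    using v[of n] by (simp add: V_def v_def) (meson l2_norm_nonneg order_trans)
  define \<rho> where "\<rho> k = l2_norm (chain c k) (\<lambda>\<omega>. current \<omega> - start \<omega> + (real k * (c\<^sup>2 / 2)) *\<^sub>R g (start \<omega>) - c *\<^sub>R noise_sum \<omega>)" for k
  have \<rho>0: "\<rho> 0 = 0"
    by (simp add: \<rho>_def l2_norm_distr) (simp add: l2_norm_def)
  have "\<rho> n \<le> real n * (c\<^sup>2 / 2 * L * V + b) + sqrt (real n * \<delta>)"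
  proof (rule error_accumulation[where n=n])
    show "(\<rho> (Suc k))\<^sup>2 \<le> (\<rho> k + (c\<^sup>2 / 2 * L * V + b))\<^sup>2 + \<delta>" if "k < n" for k
    proof -
      have "(\<rho> (Suc k))\<^sup>2 \<le> (\<rho> k + (c\<^sup>2 / 2 * L * v k + b))\<^sup>2 + \<delta>"
        using chain_error_step[OF c C_sq[OF c], of k] by (simp only: \<rho>_def v_def b_def \<delta>_def)
      also have "\<dots> \<le> (\<rho> k + (c\<^sup>2 / 2 * L * V + b))\<^sup>2 + \<delta>"
        using v[of k] that L_pos b0
        by (intro add_right_mono power_mono add_left_mono mult_left_mono) (auto simp: V_def \<rho>_def v_def)
      finally show ?thesis .
    qed
  qed (use \<rho>0 V0 L_pos b0 \<delta>0 in \<open>auto simp: \<rho>_def\<close>)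
  also have "real n * (c\<^sup>2 / 2 * L * V + b) = \<eta> * L * V + real n * b"
  proof -
    have "real n * (c\<^sup>2 / 2 * L * V + b) = (real n * c\<^sup>2) / 2 * (L * V) + real n * b"
      by (simp add: algebra_simps)
    then show ?thesis by (simp add: cn)
  qed
  also have "\<eta> * L * V + real n * b + sqrt (real n * \<delta>) \<le> B c"
    unfolding B_def V_def using nb n\<delta> by (intro add_mono real_sqrt_le_mono) auto
  finally have "\<rho> n \<le> L * \<eta> * sqrt (2 * \<eta> * DIM('a)) + \<epsilon>"
    using n(1) by (simp add: c_def)
  moreover have "real n * (c\<^sup>2 / 2) = \<eta>"
    using cn by simp
  ultimately have "l2_norm (chain c n) (\<lambda>\<omega>. current \<omega> - start \<omega> + \<eta> *\<^sub>R g (start \<omega>) - c *\<^sub>R noise_sum \<omega>)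
      \<le> L * \<eta> * sqrt (2 * \<eta> * DIM('a)) + \<epsilon>"
    by (simp only: \<rho>_def)
  moreover have "c * sqrt (real n) = sqrt (2 * \<eta>)"
    using n(3) by (simp add: c_def cs_def real_sqrt_divide)
  ultimately show thesis
    using that n(3) c(1) by blast
qed

end

section \<open>The local error of the randomized midpoint method\<close>

lemma nn_integral_PiM_coordinates:
  assumes I: "finite I" "i \<in> I" "j \<in> I" "i \<noteq> j" and M: "prob_space M"
    and [measurable]: "F \<in> borel_measurable M" "F' \<in> borel_measurable M"
  shows "(\<integral>\<^sup>+x. F (x i) \<partial>(\<Pi>\<^sub>M k\<in>I. M)) = (\<integral>\<^sup>+x. F x \<partial>M)"
    and "(\<integral>\<^sup>+x. F (x i) * F' (x j) \<partial>(\<Pi>\<^sub>M k\<in>I. M)) = (\<integral>\<^sup>+x. F x \<partial>M) * (\<integral>\<^sup>+x. F' x \<partial>M)"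
proof -
  interpret M: prob_space M by (rule M)
  interpret product_sigma_finite "\<lambda>_. M" by standard
  have coord: "(\<Prod>k\<in>I. if k = i then a k else if k = j then b k else 1) = a i * b j" for a b :: "_ \<Rightarrow> ennreal"
    using I by (subst prod.remove[of _ i], simp, simp, subst prod.remove[of _ j]) (auto intro!: prod.neutral)
  have prod: "(\<integral>\<^sup>+x. (\<Prod>k\<in>I. (if k = i then A (x k) else if k = j then B (x k) else 1)) \<partial>(\<Pi>\<^sub>M k\<in>I. M))
      = (\<Prod>k\<in>I. if k = i then (\<integral>\<^sup>+x. A x \<partial>M) else if k = j then (\<integral>\<^sup>+x. B x \<partial>M) else 1)"
    if [measurable]: "A \<in> borel_measurable M" "B \<in> borel_measurable M" for A B
  proof -
    have "(\<integral>\<^sup>+x. (\<Prod>k\<in>I. (\<lambda>y. if k = i then A y else if k = j then B y else 1) (x k)) \<partial>(\<Pi>\<^sub>M k\<in>I. M))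
      = (\<Prod>k\<in>I. (\<integral>\<^sup>+y. (if k = i then A y else if k = j then B y else 1) \<partial>M))"
      using I by (intro product_nn_integral_prod) auto
    also have "\<dots> = (\<Prod>k\<in>I. if k = i then (\<integral>\<^sup>+x. A x \<partial>M) else if k = j then (\<integral>\<^sup>+x. B x \<partial>M) else 1)"
      by (intro prod.cong refl) (auto simp: M.emeasure_space_1)
    finally show ?thesis by simp
  qed
  show "(\<integral>\<^sup>+x. F (x i) * F' (x j) \<partial>(\<Pi>\<^sub>M k\<in>I. M)) = (\<integral>\<^sup>+x. F x \<partial>M) * (\<integral>\<^sup>+x. F' x \<partial>M)"
    using prod[of F F'] unfolding coord by simp
  show "(\<integral>\<^sup>+x. F (x i) \<partial>(\<Pi>\<^sub>M k\<in>I. M)) = (\<integral>\<^sup>+x. F x \<partial>M)"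
    using prod[of F "\<lambda>_. 1"] unfolding coord by (simp add: M.emeasure_space_1)
qed

lemma nn_integral_PiM_coordinate:
  assumes I: "finite I" "i \<in> I" and M: "prob_space M" and F [measurable]: "F \<in> borel_measurable M"
  shows "(\<integral>\<^sup>+x. F (x i) \<partial>(\<Pi>\<^sub>M k\<in>I. M)) = (\<integral>\<^sup>+x. F x \<partial>M)"
proof (cases "I = {i}")
  case True
  interpret M: prob_space M by (rule M)
  interpret product_sigma_finite "\<lambda>_. M" by standard
  show ?thesis
    unfolding True using product_nn_integral_singleton[of F i] by simp
next
  case False
  then obtain j where "j \<in> I" "i \<noteq> j" using I by auto
  then show ?thesis
    using nn_integral_PiM_coordinates(1)[OF I(1,2) _ _ M F F] by blast
qed

abbreviation selection_noise :: "nat \<Rightarrow> (nat \<Rightarrow> bool) measure" where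
  "selection_noise K \<equiv> (\<Pi>\<^sub>M i\<in>{..<K}. measure_pmf (bernoulli_pmf (1 / real K)))"

abbreviation midpoint_noise :: "nat \<Rightarrow> (nat \<Rightarrow> 'a::euclidean_space) measure" where
  "midpoint_noise K \<equiv> (\<Pi>\<^sub>M i\<in>{..<K}. std_gaussian)"

lemma prob_space_selection_noise: "prob_space (selection_noise K)"
  by (intro prob_space_PiM) (rule measure_pmf.prob_space_axioms)

lemma prob_space_midpoint_noise: "prob_space (midpoint_noise K)"
  by (intro prob_space_PiM prob_space_std_gaussian)

lemma prob_space_prlmc_noise: "prob_space (prlmc_noise K)"
  unfolding prlmc_noise_def
  by (intro prob_space_pair prob_space_selection_noise prob_space_midpoint_noise prob_space_std_gaussian)

lemma sets_prlmc_noise: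
  "sets (prlmc_noise K :: ((nat \<Rightarrow> bool) \<times> (nat \<Rightarrow> 'a::euclidean_space) \<times> 'a) measure)
    = sets (selection_noise K \<Otimes>\<^sub>M (midpoint_noise K \<Otimes>\<^sub>M borel))"
  unfolding prlmc_noise_def by (intro sets_pair_measure_cong refl) auto

lemma nn_integral_prlmc_noise:
  fixes f :: "(nat \<Rightarrow> bool) \<times> (nat \<Rightarrow> 'a::euclidean_space) \<times> 'a \<Rightarrow> ennreal"
  assumes [measurable]: "f \<in> borel_measurable (selection_noise K \<Otimes>\<^sub>M (midpoint_noise K \<Otimes>\<^sub>M borel))"
  shows "(\<integral>\<^sup>+q. f q \<partial>prlmc_noise K)
    = (\<integral>\<^sup>+\<xi>. \<integral>\<^sup>+q. f (fst q, snd q, \<xi>) \<partial>(selection_noise K \<Otimes>\<^sub>M midpoint_noise K) \<partial>std_gaussian)"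
proof -
  let ?A = "selection_noise K" and ?B = "midpoint_noise K :: (nat \<Rightarrow> 'a) measure" and ?G = "std_gaussian :: 'a measure"
  interpret A: prob_space ?A by (rule prob_space_selection_noise)
  interpret B: prob_space ?B by (rule prob_space_midpoint_noise)
  interpret G: prob_space ?G by (rule prob_space_std_gaussian)
  interpret BG: pair_prob_space ?B ?G ..
  interpret AG: pair_prob_space ?A ?G ..
  interpret AB: pair_prob_space ?A ?B ..
  have [measurable]: "f \<in> borel_measurable (?A \<Otimes>\<^sub>M (?B \<Otimes>\<^sub>M ?G))"
    by measurable
  have "(\<integral>\<^sup>+q. f q \<partial>prlmc_noise K) = (\<integral>\<^sup>+H. \<integral>\<^sup>+r. f (H, r) \<partial>(?B \<Otimes>\<^sub>M ?G) \<partial>?A)"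
    unfolding prlmc_noise_def by (rule BG.nn_integral_fst[symmetric]) measurable
  also have "\<dots> = (\<integral>\<^sup>+H. \<integral>\<^sup>+z. \<integral>\<^sup>+\<xi>. f (H, z, \<xi>) \<partial>?G \<partial>?B \<partial>?A)"
    by (intro nn_integral_cong G.nn_integral_fst[symmetric]) measurable
  also have "\<dots> = (\<integral>\<^sup>+H. \<integral>\<^sup>+\<xi>. \<integral>\<^sup>+z. f (H, z, \<xi>) \<partial>?B \<partial>?G \<partial>?A)"
    by (intro nn_integral_cong BG.Fubini'[symmetric]) measurable
  also have "\<dots> = (\<integral>\<^sup>+\<xi>. \<integral>\<^sup>+H. \<integral>\<^sup>+z. f (H, z, \<xi>) \<partial>?B \<partial>?A \<partial>?G)"
    by (intro AG.Fubini'[symmetric]) measurable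
  also have "\<dots> = (\<integral>\<^sup>+\<xi>. \<integral>\<^sup>+q. f (fst q, snd q, \<xi>) \<partial>(?A \<Otimes>\<^sub>M ?B) \<partial>?G)"
  proof (rule nn_integral_cong)
    fix \<xi> :: 'a
    show "(\<integral>\<^sup>+H. \<integral>\<^sup>+z. f (H, z, \<xi>) \<partial>?B \<partial>?A) = (\<integral>\<^sup>+q. f (fst q, snd q, \<xi>) \<partial>(?A \<Otimes>\<^sub>M ?B))"
      by (subst B.nn_integral_fst[symmetric]) auto
  qed
  finally show ?thesis .
qed

lemma nn_integral_pair_mult:
  assumes "sigma_finite_measure N"
    and [measurable]: "F \<in> borel_measurable M" "F' \<in> borel_measurable N"
  shows "(\<integral>\<^sup>+p. F (fst p) * F' (snd p) \<partial>(M \<Otimes>\<^sub>M N)) = (\<integral>\<^sup>+x. F x \<partial>M) * (\<integral>\<^sup>+y. F' y \<partial>N)"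
proof -
  interpret sigma_finite_measure N by fact
  show ?thesis
    by (subst nn_integral_fst[symmetric]) (auto simp: nn_integral_cmult nn_integral_multc)
qed

lemma sum_lessThan_le:
  shows "(\<Sum>i<K. real i) \<le> (real K)\<^sup>2 / 2" and "(\<Sum>i<K. (real i)\<^sup>2) \<le> (real K) ^ 3 / 3"
proof -
  show "(\<Sum>i<K. real i) \<le> (real K)\<^sup>2 / 2"
    by (induction K) (auto simp: power2_eq_square field_simps)
  show "(\<Sum>i<K. (real i)\<^sup>2) \<le> (real K) ^ 3 / 3"
    by (induction K) (auto simp: power2_eq_square power3_eq_cube field_simps)
qed

context strongly_convex_smooth
begin

definition midpoint_sum :: "real \<Rightarrow> nat \<Rightarrow> 'a \<Rightarrow> (nat \<Rightarrow> bool) \<times> (nat \<Rightarrow> 'a) \<Rightarrow> 'a" where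
  "midpoint_sum \<eta> K y q =
    (\<Sum>i<K. of_bool (fst q i) *\<^sub>R (g y - g (prlmc_midpoint g \<eta> K y i (snd q i))))"

lemma prlmc_step_eq:
  "prlmc_step g \<eta> K y (H, z, \<xi>) =
    y - \<eta> *\<^sub>R g y + \<eta> *\<^sub>R midpoint_sum \<eta> K y (H, z) + sqrt (2 * \<eta>) *\<^sub>R \<xi>"
  by (simp add: prlmc_step_def midpoint_sum_def)

lemma measurable_midpoint_sum [measurable]:
  "(\<lambda>(y, q). midpoint_sum \<eta> K y q) \<in> borel_measurable (borel \<Otimes>\<^sub>M (selection_noise K \<Otimes>\<^sub>M midpoint_noise K))"
  unfolding midpoint_sum_def prlmc_midpoint_def by measurable

lemma measurable_prlmc_step [measurable]:
  "(\<lambda>(y, q). prlmc_step g \<eta> K y q)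
    \<in> borel_measurable (borel \<Otimes>\<^sub>M (selection_noise K \<Otimes>\<^sub>M (midpoint_noise K \<Otimes>\<^sub>M borel)))"
proof -
  let ?S = "borel \<Otimes>\<^sub>M (selection_noise K \<Otimes>\<^sub>M (midpoint_noise K \<Otimes>\<^sub>M (borel :: 'a measure)))"
  have [measurable]: "(\<lambda>p. midpoint_sum \<eta> K (fst p) (fst (snd p), fst (snd (snd p)))) \<in> borel_measurable ?S"
    using measurable_compose[of "\<lambda>p. (fst p, (fst (snd p), fst (snd (snd p))))" ?S
        "borel \<Otimes>\<^sub>M (selection_noise K \<Otimes>\<^sub>M midpoint_noise K)" "\<lambda>(y, q). midpoint_sum \<eta> K y q" borel]
    by simp
  have "(\<lambda>(y, q). prlmc_step g \<eta> K y q) = (\<lambda>p. fst p - \<eta> *\<^sub>R g (fst p)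
      + \<eta> *\<^sub>R midpoint_sum \<eta> K (fst p) (fst (snd p), fst (snd (snd p))) + sqrt (2 * \<eta>) *\<^sub>R snd (snd (snd p)))"
    by (auto simp: prlmc_step_eq)
  then show ?thesis
    by simp
qed

lemma power2_norm_midpoint_diff_le:
  assumes "0 \<le> \<eta>" "K \<ge> 1"
  shows "(norm (g y - g (prlmc_midpoint g \<eta> K y i z)))\<^sup>2
    \<le> 2 * L\<^sup>2 * ((real i * \<eta> / real K)\<^sup>2 * L\<^sup>2 * (norm y)\<^sup>2 + (2 * real i * \<eta> / real K) * (norm z)\<^sup>2)"
proof -
  let ?t = "real i * \<eta> / real K" and ?s = "2 * real i * \<eta> / real K"
  have "(norm (g y - g (prlmc_midpoint g \<eta> K y i z)))\<^sup>2 \<le> (L * norm (y - prlmc_midpoint g \<eta> K y i z))\<^sup>2"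
    by (intro power_mono gradient_lipschitz) auto
  also have "\<dots> = L\<^sup>2 * (norm (?t *\<^sub>R g y + - (sqrt ?s *\<^sub>R z)))\<^sup>2"
    by (simp add: prlmc_midpoint_def power_mult_distrib)
  also have "\<dots> \<le> L\<^sup>2 * (2 * (norm (?t *\<^sub>R g y))\<^sup>2 + 2 * (norm (- (sqrt ?s *\<^sub>R z)))\<^sup>2)"
    by (intro mult_left_mono power2_norm_add_le) auto
  also have "\<dots> = 2 * L\<^sup>2 * (?t\<^sup>2 * (norm (g y))\<^sup>2 + ?s * (norm z)\<^sup>2)"
  proof -
    have "(norm (?t *\<^sub>R g y))\<^sup>2 = ?t\<^sup>2 * (norm (g y))\<^sup>2"
      by (simp only: norm_scaleR power_mult_distrib power2_abs)
    moreover have "(norm (- (sqrt ?s *\<^sub>R z)))\<^sup>2 = ?s * (norm z)\<^sup>2"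
      using assms by (simp add: power_mult_distrib)
    ultimately show ?thesis
      by (simp only: distrib_left mult.assoc mult.left_commute)
  qed
  also have "\<dots> \<le> 2 * L\<^sup>2 * (?t\<^sup>2 * (L\<^sup>2 * (norm y)\<^sup>2) + ?s * (norm z)\<^sup>2)"
    using power_mono[OF norm_gradient_le[of y], of 2]
    by (intro mult_left_mono add_right_mono) (auto simp: power_mult_distrib)
  finally show ?thesis by (simp add: mult.assoc)
qed

text \<open>The Cauchy-Schwarz inequality, with the indicators of selection as weights.\<close>

lemma power2_norm_midpoint_sum_le:
  "(norm (midpoint_sum \<eta> K y q))\<^sup>2 \<le> (\<Sum>i<K. \<Sum>j<K. of_bool (fst q i) * of_bool (fst q j)
     * (norm (g y - g (prlmc_midpoint g \<eta> K y i (snd q i))))\<^sup>2)"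
proof -
  let ?H = "\<lambda>i. of_bool (fst q i) :: real" and ?D = "\<lambda>i. norm (g y - g (prlmc_midpoint g \<eta> K y i (snd q i)))"
  have "norm (midpoint_sum \<eta> K y q) \<le> (\<Sum>i<K. ?H i * ?D i)"
    unfolding midpoint_sum_def by (intro order_trans[OF norm_sum] sum_mono) simp
  then have "(norm (midpoint_sum \<eta> K y q))\<^sup>2 \<le> (\<Sum>i<K. ?H i * (?H i * ?D i))\<^sup>2"
    by (intro power_mono) (auto simp: mult.assoc[symmetric] simp flip: of_bool_conj)
  also have "\<dots> \<le> (\<Sum>i<K. (?H i)\<^sup>2) * (\<Sum>i<K. (?H i * ?D i)\<^sup>2)"
    by (rule Cauchy_Schwarz_ineq_sum)
  also have "\<dots> = (\<Sum>i<K. \<Sum>j<K. ?H i * ?H j * (?D i)\<^sup>2)"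
  proof -
    have H2: "(?H i)\<^sup>2 = ?H i" for i
      by simp
    show ?thesis
      unfolding power_mult_distrib H2
      by (subst mult.commute, subst sum_product) (simp only: mult_ac)
  qed
  finally show ?thesis .
qed

text \<open>Given that a fixed midpoint is selected, the mean number of selected midpoints is
  \<open>1 + (K - 1) / K = 2 - 1 / K\<close>. The factor \<open>4 - 2 / K\<close> is twice this number, the other factor two being
  lost when the displacement of a midpoint is split into its drift and its noise. The drifts at the times
  \<open>i \<eta> / K\<close> give the factor \<open>1 / 3\<close> through the sum of the squares of \<open>i\<close>.\<close>

lemma nn_integral_midpoint_sum_le:
  assumes \<eta>: "0 < \<eta>" and K: "K \<ge> 1"
  shows "(\<integral>\<^sup>+q. ennreal ((norm (midpoint_sum \<eta> K y q))\<^sup>2) \<partial>(selection_noise K \<Otimes>\<^sub>M midpoint_noise K))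
    \<le> ennreal ((4 - 2 / real K) * L\<^sup>2 * \<eta> * (\<eta> * L\<^sup>2 * (norm y)\<^sup>2 / 3 + DIM('a)))"
proof -
  let ?A = "selection_noise K" and ?B = "midpoint_noise K :: (nat \<Rightarrow> 'a) measure"
  let ?p = "1 / real K"
  interpret A: prob_space ?A by (rule prob_space_selection_noise)
  interpret B: prob_space ?B by (rule prob_space_midpoint_noise)
  define D where "D i z = (norm (g y - g (prlmc_midpoint g \<eta> K y i z)))\<^sup>2" for i z
  define E where "E i = 2 * L\<^sup>2 * ((real i * \<eta> / real K)\<^sup>2 * L\<^sup>2 * (norm y)\<^sup>2 + (2 * real i * \<eta> / real K) * DIM('a))" for i
  define w where "w i j = (if i = j then ?p else ?p\<^sup>2)" for i j :: nat
  let ?F = "\<lambda>i j q. ennreal (of_bool (fst q i) * of_bool (fst q j)) * ennreal (D i (snd q i))"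
  have p: "0 \<le> ?p" "?p \<le> 1" using K by auto
  have D_meas [measurable]: "D i \<in> borel_measurable borel" for i
    unfolding D_def prlmc_midpoint_def by measurable
  have E0: "0 \<le> E i" for i
    using \<eta> by (simp add: E_def)
  have w0: "0 \<le> w i j" for i j by (simp add: w_def)
  have sel: "(\<integral>\<^sup>+H. ennreal (of_bool (H i) * of_bool (H j)) \<partial>?A) = ennreal (w i j)" if "i < K" "j < K" for i j
  proof (cases "i = j")
    case True
    have "(\<integral>\<^sup>+H. ennreal (of_bool (H i) * of_bool (H j)) \<partial>?A) = (\<integral>\<^sup>+H. (\<lambda>b. ennreal (of_bool b)) (H i) \<partial>?A)"
      by (simp add: True flip: of_bool_conj)
    also have "\<dots> = (\<integral>\<^sup>+b. ennreal (of_bool b) \<partial>measure_pmf (bernoulli_pmf ?p))"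
      using that by (intro nn_integral_PiM_coordinate) (auto intro: measure_pmf.prob_space_axioms)
    finally show ?thesis
      using p True by (simp add: w_def)
  next
    case False
    have "(\<integral>\<^sup>+H. ennreal (of_bool (H i) * of_bool (H j)) \<partial>?A)
        = (\<integral>\<^sup>+H. (\<lambda>b. ennreal (of_bool b)) (H i) * (\<lambda>b. ennreal (of_bool b)) (H j) \<partial>?A)"
      by (simp add: ennreal_mult)
    also have "\<dots> = (\<integral>\<^sup>+b. ennreal (of_bool b) \<partial>measure_pmf (bernoulli_pmf ?p))
        * (\<integral>\<^sup>+b. ennreal (of_bool b) \<partial>measure_pmf (bernoulli_pmf ?p))"
      using that False by (intro nn_integral_PiM_coordinates(2)) (auto intro: measure_pmf.prob_space_axioms)
    finally show ?thesis
      using p False by (simp add: w_def power2_eq_square flip: ennreal_mult)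
  qed
  have mid: "(\<integral>\<^sup>+z. ennreal (D i (z i)) \<partial>?B) \<le> ennreal (E i)" if "i < K" for i
  proof -
    let ?a = "2 * L\<^sup>2 * ((real i * \<eta> / real K)\<^sup>2 * L\<^sup>2 * (norm y)\<^sup>2)" and ?b = "2 * L\<^sup>2 * (2 * real i * \<eta> / real K)"
    interpret G: prob_space gaussian by (rule prob_space_std_gaussian)
    have int: "integrable gaussian (\<lambda>z. ?a + ?b * (norm z)\<^sup>2)"
      using square_integrableD(2)[OF square_integrable_std_gaussian_id]
      by (intro Bochner_Integration.integrable_add integrable_mult_right) auto
    have "(\<integral>\<^sup>+z. ennreal (D i (z i)) \<partial>?B) = (\<integral>\<^sup>+z. ennreal (D i z) \<partial>gaussian)"
      using that by (intro nn_integral_PiM_coordinate[where F="\<lambda>z. ennreal (D i z)"] prob_space_std_gaussian) auto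
    also have "\<dots> \<le> (\<integral>\<^sup>+z. ennreal (?a + ?b * (norm z)\<^sup>2) \<partial>gaussian)"
      using power2_norm_midpoint_diff_le[of \<eta> K y i] \<eta> K
      by (intro nn_integral_mono ennreal_leI) (auto simp: D_def algebra_simps)
    also have "\<dots> = ennreal (\<integral>z. ?a + ?b * (norm z)\<^sup>2 \<partial>gaussian)"
      using \<eta> by (intro nn_integral_eq_integral int AE_I2) auto
    also have "(\<integral>z. ?a + ?b * (norm z)\<^sup>2 \<partial>gaussian) = ?a + ?b * DIM('a)"
      using square_integrableD(2)[OF square_integrable_std_gaussian_id[where ?'a='a]] G.prob_space
      by (subst Bochner_Integration.integral_add)
         (auto simp: integral_std_gaussian_norm_power2 simp del: times_divide_eq_left)
    also have "?a + ?b * DIM('a) = E i"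
      by (simp add: E_def algebra_simps)
    finally show ?thesis .
  qed
  have "(\<integral>\<^sup>+q. ennreal ((norm (midpoint_sum \<eta> K y q))\<^sup>2) \<partial>(?A \<Otimes>\<^sub>M ?B))
      \<le> (\<integral>\<^sup>+q. (\<Sum>i<K. \<Sum>j<K. ?F i j q) \<partial>(?A \<Otimes>\<^sub>M ?B))"
  proof (rule nn_integral_mono)
    fix q
    have "ennreal ((norm (midpoint_sum \<eta> K y q))\<^sup>2)
        \<le> ennreal (\<Sum>i<K. \<Sum>j<K. of_bool (fst q i) * of_bool (fst q j) * D i (snd q i))"
      unfolding D_def by (intro ennreal_leI power2_norm_midpoint_sum_le)
    also have "\<dots> = (\<Sum>i<K. \<Sum>j<K. ennreal (of_bool (fst q i) * of_bool (fst q j) * D i (snd q i)))"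
      by (subst sum_ennreal[symmetric], force simp: D_def intro!: sum_nonneg)
         (intro sum.cong refl sum_ennreal[symmetric]; simp add: D_def)
    also have "\<dots> = (\<Sum>i<K. \<Sum>j<K. ?F i j q)"
      by (intro sum.cong refl ennreal_mult) (auto simp: D_def)
    finally show "ennreal ((norm (midpoint_sum \<eta> K y q))\<^sup>2)
        \<le> (\<Sum>i<K. \<Sum>j<K. ?F i j q)" .
  qed
  also have "\<dots> = (\<Sum>i<K. \<Sum>j<K. (\<integral>\<^sup>+H. ennreal (of_bool (H i) * of_bool (H j)) \<partial>?A) * (\<integral>\<^sup>+z. ennreal (D i (z i)) \<partial>?B))"
  proof -
    have [measurable]: "(\<lambda>H. ennreal (of_bool (H i) * of_bool (H j))) \<in> borel_measurable ?A" if "i \<in> {..<K}" "j \<in> {..<K}" for i j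
      using that by measurable
    have [measurable]: "(\<lambda>z. ennreal (D i (z i))) \<in> borel_measurable ?B" if "i \<in> {..<K}" for i
      using that by measurable
    have pm: "(\<lambda>q. ?F i j q) \<in> borel_measurable (?A \<Otimes>\<^sub>M ?B)"
      if "i \<in> {..<K}" "j \<in> {..<K}" for i j
      using that by measurable
    have "(\<integral>\<^sup>+q. (\<Sum>i<K. \<Sum>j<K. ?F i j q) \<partial>(?A \<Otimes>\<^sub>M ?B))
      = (\<Sum>i<K. (\<integral>\<^sup>+q. (\<Sum>j<K. ?F i j q) \<partial>(?A \<Otimes>\<^sub>M ?B)))"
      by (rule nn_integral_sum) (intro borel_measurable_sum pm)
    also have "\<dots> = (\<Sum>i<K. \<Sum>j<K. (\<integral>\<^sup>+q. ?F i j q \<partial>(?A \<Otimes>\<^sub>M ?B)))"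
      by (intro sum.cong refl nn_integral_sum pm)
    also have "\<dots> = (\<Sum>i<K. \<Sum>j<K. (\<integral>\<^sup>+H. ennreal (of_bool (H i) * of_bool (H j)) \<partial>?A) * (\<integral>\<^sup>+z. ennreal (D i (z i)) \<partial>?B))"
      by (intro sum.cong refl nn_integral_pair_mult[where F="\<lambda>H. ennreal (of_bool (H _) * of_bool (H _))"
            and F'="\<lambda>z. ennreal (D _ (z _))"] B.sigma_finite_measure_axioms) auto
    finally show ?thesis .
  qed
  also have "\<dots> \<le> (\<Sum>i<K. \<Sum>j<K. ennreal (w i j) * ennreal (E i))"
    by (intro sum_mono mult_mono) (auto simp: sel mid)
  also have "\<dots> = ennreal (\<Sum>i<K. \<Sum>j<K. w i j * E i)"
    using w0 E0 by (simp add: sum_nonneg flip: ennreal_mult sum_ennreal)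
  also have "(\<Sum>i<K. \<Sum>j<K. w i j * E i) \<le> (4 - 2 / real K) * L\<^sup>2 * \<eta> * (\<eta> * L\<^sup>2 * (norm y)\<^sup>2 / 3 + DIM('a))"
  proof -
    have w_sum: "(\<Sum>j<K. w i j) = ?p * (2 - ?p)" if "i < K" for i
    proof -
      have "(\<Sum>j<K. w i j) = w i i + (\<Sum>j\<in>{..<K} - {i}. w i j)"
        using that by (intro sum.remove) auto
      also have "\<dots> = ?p + (real K - 1) * ?p\<^sup>2"
        using that K by (simp add: w_def of_nat_diff)
      also have "\<dots> = ?p * (2 - ?p)"
        using K by (simp add: field_simps power2_eq_square)
      finally show ?thesis .
    qed
    have "(\<Sum>i<K. \<Sum>j<K. w i j * E i) = ?p * (2 - ?p) * (\<Sum>i<K. E i)"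
      by (simp add: sum_distrib_right[symmetric] w_sum sum_distrib_left)
    also have "(\<Sum>i<K. E i) = 2 * L\<^sup>2 * \<eta> * (\<eta> * L\<^sup>2 * (norm y)\<^sup>2 * ((\<Sum>i<K. (real i)\<^sup>2) / (real K)\<^sup>2)
        + 2 * DIM('a) * ((\<Sum>i<K. real i) / real K))"
      by (simp add: E_def sum_distrib_left sum_divide_distrib sum.distrib power_divide power_mult_distrib
          power2_eq_square algebra_simps)
    also have "?p * (2 - ?p) * \<dots> \<le> ?p * (2 - ?p) * (2 * L\<^sup>2 * \<eta> * (\<eta> * L\<^sup>2 * (norm y)\<^sup>2 * ((real K ^ 3 / 3) / (real K)\<^sup>2)
        + 2 * DIM('a) * (((real K)\<^sup>2 / 2) / real K)))"
      using p \<eta> by (intro mult_left_mono add_mono divide_right_mono sum_lessThan_le) auto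
    also have "\<dots> = (4 - 2 / real K) * L\<^sup>2 * \<eta> * (\<eta> * L\<^sup>2 * (norm y)\<^sup>2 / 3 + DIM('a))"
      using K by (simp add: field_simps power2_eq_square power3_eq_cube)
    finally show ?thesis .
  qed
  finally show ?thesis
    by (simp add: ennreal_leI)
qed

end

section \<open>Contraction of couplings and the Wasserstein distance\<close>

abbreviation transport_cost :: "('a::euclidean_space \<times> 'a) measure \<Rightarrow> ennreal" where
  "transport_cost \<gamma> \<equiv> \<integral>\<^sup>+p. ennreal ((norm (fst p - snd p))\<^sup>2) \<partial>\<gamma>"

lemma couplingsD:
  assumes "\<gamma> \<in> couplings \<mu> \<nu>"
  shows "sets \<gamma> = sets (borel \<Otimes>\<^sub>M borel)" "distr \<gamma> borel fst = \<mu>" "distr \<gamma> borel snd = \<nu>"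
  using assms by (auto simp: couplings_def)

lemma ennreal_sqrt_power2: "0 \<le> r \<Longrightarrow> ennreal_sqrt (ennreal (r\<^sup>2)) = ennreal r"
  by (simp add: ennreal_sqrt_def)

text \<open>Let \<open>w\<close> be the infimum of the \<open>L\<^sup>2\<close> costs. Couplings of cost close to \<open>w\<close> show that
  \<open>w \<le> \<kappa> w + E\<close>. A coupling of finite cost is assumed because this inequality says nothing for
  \<open>w = \<infinity>\<close>.\<close>

lemma wasserstein2_le_of_contraction:
  assumes \<kappa>: "0 \<le> \<kappa>" "\<kappa> < 1" and E: "0 \<le> E"
    and finite_cost: "\<exists>\<gamma>\<in>couplings \<mu> \<nu>. transport_cost \<gamma> < \<infinity>"
    and contraction: "\<And>\<gamma> r \<epsilon>. \<gamma> \<in> couplings \<mu> \<nu> \<Longrightarrow> 0 \<le> r \<Longrightarrow> 0 < \<epsilon> \<Longrightarrow>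
      transport_cost \<gamma> \<le> ennreal (r\<^sup>2) \<Longrightarrow>
      \<exists>\<gamma>'\<in>couplings \<mu> \<nu>. transport_cost \<gamma>' \<le> ennreal ((\<kappa> * r + E + \<epsilon>)\<^sup>2)"
  shows "wasserstein2 \<mu> \<nu> \<le> ennreal (E / (1 - \<kappa>))"
proof -
  define I where "I = (INF \<gamma>\<in>couplings \<mu> \<nu>. transport_cost \<gamma>)"
  have "I < \<infinity>"
    using finite_cost by (auto simp: I_def INF_less_iff)
  then obtain i where i: "0 \<le> i" "I = ennreal i"
    by (cases I) auto
  define w where "w = sqrt i"
  have w: "0 \<le> w" "I = ennreal (w\<^sup>2)"
    using i by (auto simp: w_def)
  have "w \<le> E / (1 - \<kappa>)"
  proof (rule ccontr)
    assume "\<not> w \<le> E / (1 - \<kappa>)"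
    then have gap: "\<kappa> * w + E < w"
      using \<kappa> by (simp add: field_simps)
    \<comment> \<open>A third of the gap: the slack enters once through the coupling, with a factor \<open>\<kappa> < 1\<close>, and once
        through \<open>\<epsilon>\<close>, so that the inequality stays strict.\<close>
    define \<delta> where "\<delta> = (w - \<kappa> * w - E) / 3"
    have \<delta>: "0 < \<delta>" "\<kappa> * (w + \<delta>) + E + \<delta> < w"
    proof -
      show "0 < \<delta>" using gap by (simp add: \<delta>_def)
      have "\<kappa> * \<delta> \<le> \<delta>"
        using \<kappa> \<open>0 < \<delta>\<close> by (simp add: mult_le_cancel_right1)
      then show "\<kappa> * (w + \<delta>) + E + \<delta> < w"
        using \<open>0 < \<delta>\<close> by (simp add: \<delta>_def field_simps)
    qed
    have "I < ennreal ((w + \<delta>)\<^sup>2)"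
      using w \<delta>(1) by (auto simp: ennreal_less_iff intro!: power_strict_mono)
    then obtain \<gamma> where \<gamma>: "\<gamma> \<in> couplings \<mu> \<nu>" "transport_cost \<gamma> < ennreal ((w + \<delta>)\<^sup>2)"
      by (auto simp: I_def INF_less_iff)
    obtain \<gamma>' where \<gamma>': "\<gamma>' \<in> couplings \<mu> \<nu>" "transport_cost \<gamma>' \<le> ennreal ((\<kappa> * (w + \<delta>) + E + \<delta>)\<^sup>2)"
      using contraction[OF \<gamma>(1) _ \<delta>(1) less_imp_le[OF \<gamma>(2)]] w(1) \<delta>(1) by auto
    have "I \<le> transport_cost \<gamma>'"
      unfolding I_def using \<gamma>'(1) by (rule INF_lower)
    also note \<gamma>'(2)
    also have "ennreal ((\<kappa> * (w + \<delta>) + E + \<delta>)\<^sup>2) < ennreal (w\<^sup>2)"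
      using \<delta> \<kappa> E w(1) by (auto simp: ennreal_less_iff intro!: power_strict_mono)
    finally show False
      using w(2) by simp
  qed
  then show ?thesis
    unfolding wasserstein2_def I_def[symmetric] w(2) ennreal_sqrt_power2[OF w(1)]
    by (rule ennreal_leI)
qed

lemma finite_cost_coupling:
  fixes \<mu> \<nu> :: "'a::euclidean_space measure"
  assumes \<mu>: "prob_space \<mu>" "sets \<mu> = sets borel" "square_integrable \<mu> (\<lambda>x. x)"
    and \<nu>: "prob_space \<nu>" "sets \<nu> = sets borel" "square_integrable \<nu> (\<lambda>x. x)"
  shows "\<exists>\<gamma>\<in>couplings \<mu> \<nu>. transport_cost \<gamma> < \<infinity>"
proof
  interpret M: prob_space \<mu> by fact
  interpret N: prob_space \<nu> by fact
  let ?P = "\<mu> \<Otimes>\<^sub>M \<nu>"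
  have sets_P [measurable_cong]: "sets ?P = sets (borel \<Otimes>\<^sub>M borel)"
    using \<mu> \<nu> by (intro sets_pair_measure_cong)
  have fst: "distr ?P borel fst = \<mu>"
    using N.distr_pair_fst[of \<mu>] \<mu>(2) by (metis distr_cong)
  have snd: "distr ?P borel snd = \<nu>"
    using distr_pair_snd[OF \<mu>(1) \<nu>(1)] \<nu>(2) by (metis distr_cong)
  have "square_integrable (distr ?P borel fst) (\<lambda>x. x)"
    unfolding fst by (rule \<mu>(3))
  then have f: "square_integrable ?P fst"
    by (subst (asm) square_integrable_distr) auto
  have "square_integrable (distr ?P borel snd) (\<lambda>x. x)"
    unfolding snd by (rule \<nu>(3))
  then have s: "square_integrable ?P snd"
    by (subst (asm) square_integrable_distr) auto
  show "(\<integral>\<^sup>+p. ennreal ((norm (fst p - snd p))\<^sup>2) \<partial>?P) < \<infinity>"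
    using square_integrableD(2)[OF square_integrable_diff[OF f s]]
    by (subst nn_integral_eq_integral) auto
  show "?P \<in> couplings \<mu> \<nu>"
    using sets_P fst snd by (simp add: couplings_def)
qed

lemma (in strongly_convex_smooth) measurable_prlmc_kernel:
  "prlmc_kernel g \<eta> K \<in> measurable borel (subprob_algebra borel)"
proof -
  have "(\<lambda>y. distr (prlmc_noise K) borel (prlmc_step g \<eta> K y)) \<in> measurable borel (subprob_algebra borel)"
  proof (rule measurable_distr2)
    from measurable_cong_sets[OF sets_pair_measure_cong[OF refl sets_prlmc_noise] refl]
    show "(\<lambda>(y, q). prlmc_step g \<eta> K y q) \<in> borel_measurable (borel \<Otimes>\<^sub>M prlmc_noise K)"
      using measurable_prlmc_step by blast
    show "(\<lambda>y. prlmc_noise K) \<in> measurable borel (subprob_algebra (prlmc_noise K))"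
      using prob_space_prlmc_noise
      by (intro measurable_const) (auto simp: space_subprob_algebra intro: prob_space_imp_subprob_space)
  qed
  then show ?thesis
    by (simp add: prlmc_kernel_def[abs_def])
qed

text \<open>A coupling is transported by many Metropolis steps in the second component and by one step of the
  randomized midpoint method, driven by the sum of their Gaussian variables, in the first one. The
  three terms of the bound come from the contracting gradient steps, from the deviation of the Metropolis
  chain from its Euler step, and from the random midpoints.\<close>

lemma (in coupled_chain) coupled_step:
  assumes \<eta>: "0 < \<eta>" "\<eta> < 2 / (m + L)" and K: "K \<ge> 1" and \<epsilon>: "0 < \<epsilon>"
    and \<mu>: "distr \<gamma> borel fst = \<mu>" and stationary: "stationary_distribution (prlmc_kernel g \<eta> K) \<mu>"
    and int: "integrable \<mu> (\<lambda>y. (norm y)\<^sup>2)"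
    and r: "0 \<le> r" and cost: "transport_cost \<gamma> \<le> ennreal (r\<^sup>2)"
  shows "\<exists>\<gamma>'\<in>couplings \<mu> gibbs. transport_cost \<gamma>' \<le> ennreal (((1 - m * \<eta>) * r
    + (L * \<eta> * sqrt (2 * \<eta> * DIM('a))
      + \<eta> * sqrt ((4 - 2 / real K) * L\<^sup>2 * \<eta> * (\<eta> * L\<^sup>2 * (\<integral>y. (norm y)\<^sup>2 \<partial>\<mu>) / 3 + DIM('a)))) + \<epsilon>)\<^sup>2)"
proof -
  have sets_\<mu> [measurable_cong]: "sets \<mu> = sets borel"
    and invariant: "\<mu> \<bind> prlmc_kernel g \<eta> K = \<mu>" and prob_\<mu>: "prob_space \<mu>"
    using stationary unfolding stationary_distribution_def by blast+
  obtain n c where n: "0 < n" and c: "0 < c" "c * sqrt (real n) = sqrt (2 * \<eta>)"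
    and dev: "l2_norm (chain c n) (\<lambda>\<omega>. current \<omega> - start \<omega> + \<eta> *\<^sub>R g (start \<omega>) - c *\<^sub>R noise_sum \<omega>)
      \<le> L * \<eta> * sqrt (2 * \<eta> * DIM('a)) + \<epsilon>"
    by (rule chain_langevin_error[OF \<eta>(1) \<epsilon>])
  let ?Q = "selection_noise K \<Otimes>\<^sub>M (midpoint_noise K :: (nat \<Rightarrow> 'a) measure)"
  interpret Q: prob_space ?Q
    by (intro prob_space_pair prob_space_selection_noise prob_space_midpoint_noise)
  define P where "P = chain c n \<Otimes>\<^sub>M ?Q"
  have sets_P [measurable_cong]: "sets P = sets (coupled_space \<Otimes>\<^sub>M ?Q)"
    unfolding P_def by (intro sets_pair_measure_cong) auto
  define other where "other \<omega> = fst (fst \<omega>)" for \<omega> :: "'a coupled_state"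
  have other_meas [measurable]: "other \<in> borel_measurable coupled_space"
    unfolding other_def by measurable
  define Y where "Y p = prlmc_step g \<eta> K (other (fst p))
      (fst (snd p), snd (snd p), (1 / sqrt (real n)) *\<^sub>R noise_sum (fst p))" for p :: "'a coupled_state \<times> (nat \<Rightarrow> bool) \<times> (nat \<Rightarrow> 'a)"
  define S where "S p = midpoint_sum \<eta> K (other (fst p)) (snd p)" for p :: "'a coupled_state \<times> (nat \<Rightarrow> bool) \<times> (nat \<Rightarrow> 'a)"
  have Y_meas [measurable]: "Y \<in> borel_measurable P"
  proof -
    have "(\<lambda>p. (other (fst p), (fst (snd p), snd (snd p), (1 / sqrt (real n)) *\<^sub>R noise_sum (fst p))))
        \<in> measurable P (borel \<Otimes>\<^sub>M (selection_noise K \<Otimes>\<^sub>M (midpoint_noise K \<Otimes>\<^sub>M borel)))"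
      by measurable
    from measurable_compose[OF this measurable_prlmc_step[of \<eta> K]] show ?thesis
      by (simp add: Y_def[abs_def])
  qed
  have S_meas [measurable]: "S \<in> borel_measurable P"
  proof -
    have "(\<lambda>p. (other (fst p), snd p)) \<in> measurable P (borel \<Otimes>\<^sub>M ?Q)"
      by measurable
    from measurable_compose[OF this measurable_midpoint_sum[of \<eta> K]] show ?thesis
      by (simp add: S_def[abs_def])
  qed
  have distr_P_fst: "distr P (chain c n) fst = chain c n"
    unfolding P_def by (rule Q.distr_pair_fst)
  have distr_other: "distr (chain c n) borel other = \<mu>"
  proof -
    have "distr (chain c n) borel other = distr (distr (chain c n) (borel \<Otimes>\<^sub>M borel) fst) borel fst"
      by (subst distr_distr) (auto simp: comp_def other_def[abs_def])
    then show ?thesis by (simp add: chain_coupling \<mu>)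
  qed

  \<comment> \<open>Given the other starting point, the rescaled noise is standard Gaussian and independent of the
      selection and midpoint noise, so \<open>Y\<close> has the law of a step from \<open>\<mu>\<close>.\<close>
  have law_Y: "distr P borel Y = \<mu>"
  proof (rule measure_eqI)
    fix A assume "A \<in> sets (distr P borel Y)"
    then have A [measurable]: "A \<in> sets borel" by simp
    let ?f = "indicator A :: 'a \<Rightarrow> ennreal"
    let ?step = "\<lambda>y q \<xi>. ?f (prlmc_step g \<eta> K y (fst q, snd q, \<xi>))"
    have step_meas: "(\<lambda>p. ?step (fst (fst p)) (snd (fst p)) (snd p)) \<in> borel_measurable ((borel \<Otimes>\<^sub>M ?Q) \<Otimes>\<^sub>M borel)"
    proof -
      have "(\<lambda>p. (fst (fst p), (fst (snd (fst p)), snd (snd (fst p)), snd p))) \<in> measurable ((borel \<Otimes>\<^sub>M ?Q) \<Otimes>\<^sub>M borel)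
          (borel \<Otimes>\<^sub>M (selection_noise K \<Otimes>\<^sub>M (midpoint_noise K \<Otimes>\<^sub>M (borel :: 'a measure))))"
        by measurable
      from measurable_compose[OF this measurable_prlmc_step[of \<eta> K]]
      have "(\<lambda>p. prlmc_step g \<eta> K (fst (fst p)) (fst (snd (fst p)), snd (snd (fst p)), snd p)) \<in> borel_measurable ((borel \<Otimes>\<^sub>M ?Q) \<Otimes>\<^sub>M borel)"
        by simp
      from measurable_compose[OF this borel_measurable_indicator[OF A]] show ?thesis by simp
    qed
    define F where "F p s = (\<integral>\<^sup>+q. ?step (fst p) q ((1 / sqrt (real n)) *\<^sub>R s) \<partial>?Q)" for p :: "'a \<times> 'a" and s
    have F_meas: "(\<lambda>(p, s). F p s) \<in> borel_measurable ((borel \<Otimes>\<^sub>M borel) \<Otimes>\<^sub>M borel)"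
    proof -
      have "(\<lambda>r :: (('a \<times> 'a) \<times> 'a) \<times> ((nat \<Rightarrow> bool) \<times> (nat \<Rightarrow> 'a)). (((fst (fst (fst r))), snd r), (1 / sqrt (real n)) *\<^sub>R snd (fst r)))
          \<in> measurable (((borel \<Otimes>\<^sub>M borel) \<Otimes>\<^sub>M borel) \<Otimes>\<^sub>M ?Q) ((borel \<Otimes>\<^sub>M ?Q) \<Otimes>\<^sub>M borel)"
        by measurable
      from measurable_compose[OF this step_meas]
      have "(\<lambda>(w :: ('a \<times> 'a) \<times> 'a, q). ?step (fst (fst w)) q ((1 / sqrt (real n)) *\<^sub>R snd w))
          \<in> borel_measurable (((borel \<Otimes>\<^sub>M (borel :: 'a measure)) \<Otimes>\<^sub>M borel) \<Otimes>\<^sub>M ?Q)"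
        by (simp add: split_beta')
      from Q.borel_measurable_nn_integral[OF this] show ?thesis
        by (simp add: F_def split_beta')
    qed
    have "emeasure (distr P borel Y) A = (\<integral>\<^sup>+p. ?f (Y p) \<partial>P)"
      by (subst nn_integral_indicator[symmetric], simp, subst nn_integral_distr) auto
    also have "\<dots> = (\<integral>\<^sup>+\<omega>. \<integral>\<^sup>+q. ?f (Y (\<omega>, q)) \<partial>?Q \<partial>chain c n)"
      unfolding P_def by (rule Q.nn_integral_fst[symmetric]) (simp add: P_def[symmetric])
    also have "\<dots> = (\<integral>\<^sup>+\<omega>. F (fst \<omega>) (noise_sum \<omega>) \<partial>chain c n)"
      by (simp add: F_def Y_def other_def)
    also have "\<dots> = (\<integral>\<^sup>+p. \<integral>\<^sup>+z. F p (sqrt (real n) *\<^sub>R z) \<partial>std_gaussian \<partial>\<gamma>)"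
      by (rule nn_integral_chain_noise[OF F_meas])
    also have "\<dots> = (\<integral>\<^sup>+p. emeasure (prlmc_kernel g \<eta> K (fst p)) A \<partial>\<gamma>)"
    proof (rule nn_integral_cong)
      fix p :: "'a \<times> 'a"
      have step1: "prlmc_step g \<eta> K (fst p) \<in> borel_measurable (selection_noise K \<Otimes>\<^sub>M (midpoint_noise K \<Otimes>\<^sub>M borel))"
        using measurable_Pair2[OF measurable_prlmc_step, of "fst p"] by simp
      then have step2: "prlmc_step g \<eta> K (fst p) \<in> borel_measurable (prlmc_noise K)"
        using measurable_cong_sets[OF sets_prlmc_noise refl] by blast
      have "(\<integral>\<^sup>+z. F p (sqrt (real n) *\<^sub>R z) \<partial>std_gaussian) = (\<integral>\<^sup>+\<xi>. \<integral>\<^sup>+q. ?step (fst p) q \<xi> \<partial>?Q \<partial>std_gaussian)"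
        using n by (simp add: F_def)
      also have "\<dots> = (\<integral>\<^sup>+q. ?f (prlmc_step g \<eta> K (fst p) q) \<partial>prlmc_noise K)"
        by (rule nn_integral_prlmc_noise[symmetric])
           (rule measurable_compose[OF step1 borel_measurable_indicator[OF A]])
      also have "\<dots> = emeasure (prlmc_kernel g \<eta> K (fst p)) A"
        unfolding prlmc_kernel_def
        by (subst nn_integral_indicator[symmetric], simp, subst nn_integral_distr[OF step2]) auto
      finally show "(\<integral>\<^sup>+z. F p (sqrt (real n) *\<^sub>R z) \<partial>std_gaussian) = emeasure (prlmc_kernel g \<eta> K (fst p)) A" .
    qed
    also have "\<dots> = (\<integral>\<^sup>+y. emeasure (prlmc_kernel g \<eta> K y) A \<partial>\<mu>)"
      unfolding \<mu>[symmetric]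
      by (subst nn_integral_distr)
         (auto intro!: measurable_compose[OF measurable_prlmc_kernel measurable_emeasure_subprob_algebra])
    also have "\<dots> = emeasure (\<mu> \<bind> prlmc_kernel g \<eta> K) A"
    proof (rule emeasure_bind[symmetric, where N=borel])
      show "space \<mu> \<noteq> {}"
        using prob_space.not_empty[OF prob_\<mu>] .
      show "prlmc_kernel g \<eta> K \<in> measurable \<mu> (subprob_algebra borel)"
        using measurable_prlmc_kernel measurable_cong_sets[OF sets_\<mu> refl] by blast
    qed (rule A)
    finally show "emeasure (distr P borel Y) A = emeasure \<mu> A"
      by (simp add: invariant)
  qed (simp add: sets_\<mu>)

  have law_X: "distr P borel (\<lambda>p. current (fst p)) = gibbs"
  proof -
    have "distr P borel (\<lambda>p. current (fst p)) = distr (distr P (chain c n) fst) borel current"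
      by (subst distr_distr) (auto simp: comp_def P_def)
    then show ?thesis by (simp add: distr_P_fst chain_current)
  qed

  let ?D = "\<lambda>p :: 'a \<times> 'a. fst p - snd p - \<eta> *\<^sub>R (g (fst p) - g (snd p))"
  define A where "A p = ?D (fst (fst p))" for p :: "'a coupled_state \<times> (nat \<Rightarrow> bool) \<times> (nat \<Rightarrow> 'a)"
  define dv where "dv \<omega> = current \<omega> - start \<omega> + \<eta> *\<^sub>R g (start \<omega>) - c *\<^sub>R noise_sum \<omega>" for \<omega> :: "'a coupled_state"
  \<comment> \<open>The noise terms cancel, as \<open>sqrt (2 \<eta>) / sqrt n = c\<close>.\<close>
  have decomposition: "Y p - current (fst p) = A p + \<eta> *\<^sub>R S p + (-1) *\<^sub>R dv (fst p)" for p
  proof -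
    have "sqrt (2 * \<eta>) * (1 / sqrt (real n)) = c"
      using n unfolding c(2)[symmetric] by simp
    then have "sqrt (2 * \<eta>) *\<^sub>R ((1 / sqrt (real n)) *\<^sub>R z) = c *\<^sub>R z" for z :: 'a
      by (simp only: scaleR_scaleR)
    then show ?thesis
      by (simp add: Y_def A_def S_def dv_def other_def prlmc_step_eq scaleR_diff_right)
  qed

  have sq_D: "square_integrable \<gamma> (\<lambda>p. fst p - snd p)" and l2_D: "l2_norm \<gamma> (\<lambda>p. fst p - snd p) \<le> r"
  proof -
    have *: "integrable \<gamma> (\<lambda>p. (norm (fst p - snd p))\<^sup>2) \<and> (\<integral>p. (norm (fst p - snd p))\<^sup>2 \<partial>\<gamma>) \<le> r\<^sup>2"
      by (rule integral_le_of_nn_integral_le[OF _ _ cost]) auto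
    then show "square_integrable \<gamma> (\<lambda>p. fst p - snd p)"
      by (auto simp: square_integrable_def)
    show "l2_norm \<gamma> (\<lambda>p. fst p - snd p) \<le> r"
      using * r by (simp add: l2_norm_def real_le_lsqrt)
  qed
  note m\<eta> = step_size_bounds(2)[OF \<eta>]
  have coupling_P: "distr P (borel \<Otimes>\<^sub>M borel) (\<lambda>p. fst (fst p)) = \<gamma>"
  proof -
    have "distr P (borel \<Otimes>\<^sub>M borel) (\<lambda>p. fst (fst p)) = distr (distr P (chain c n) fst) (borel \<Otimes>\<^sub>M borel) fst"
      by (subst distr_distr) (auto simp: comp_def P_def)
    then show ?thesis by (simp add: distr_P_fst chain_coupling)
  qed
  have sq_cD: "square_integrable \<gamma> (\<lambda>p. (1 - m * \<eta>) *\<^sub>R (fst p - snd p))"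
    by (rule square_integrable_scaleR[OF sq_D])
  have D_le: "norm (?D p) \<le> norm ((1 - m * \<eta>) *\<^sub>R (fst p - snd p))" for p
    using gradient_step_contraction[OF \<eta>, of "fst p" "snd p"] m\<eta> by simp
  have sq_A: "square_integrable P A" and l2_A: "l2_norm P A \<le> (1 - m * \<eta>) * r"
  proof -
    have D_meas: "?D \<in> borel_measurable \<gamma>" by measurable
    have "square_integrable (distr P (borel \<Otimes>\<^sub>M borel) (\<lambda>p. fst (fst p))) ?D"
      unfolding coupling_P by (rule square_integrable_mono[OF sq_cD D_meas]) (rule D_le)
    then show "square_integrable P A"
      unfolding A_def by (subst (asm) square_integrable_distr) auto
    have "l2_norm P A = l2_norm (distr P (borel \<Otimes>\<^sub>M borel) (\<lambda>p. fst (fst p))) ?D"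
      unfolding A_def by (subst l2_norm_distr) auto
    also have "\<dots> \<le> l2_norm \<gamma> (\<lambda>p. (1 - m * \<eta>) *\<^sub>R (fst p - snd p))"
      unfolding coupling_P by (rule l2_norm_mono[OF sq_cD D_meas]) (rule D_le)
    also have "\<dots> \<le> (1 - m * \<eta>) * r"
      using l2_D m\<eta> by (simp only: l2_norm_scaleR) (simp add: mult_left_mono)
    finally show "l2_norm P A \<le> (1 - m * \<eta>) * r" .
  qed

  let ?b = "\<lambda>t. (4 - 2 / real K) * L\<^sup>2 * \<eta> * (\<eta> * L\<^sup>2 * t / 3 + DIM('a))"
  have K2: "0 \<le> 4 - 2 / real K"
    using K by (simp add: field_simps)
  have b_nonneg: "0 \<le> ?b t" if "0 \<le> t" for t
    using that K2 \<eta> by (intro mult_nonneg_nonneg) auto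
  have sq_S: "square_integrable P S" and l2_S: "l2_norm P S \<le> sqrt (?b (\<integral>y. (norm y)\<^sup>2 \<partial>\<mu>))"
  proof -
    have "(\<integral>\<^sup>+p. ennreal ((norm (S p))\<^sup>2) \<partial>P) = (\<integral>\<^sup>+\<omega>. \<integral>\<^sup>+q. ennreal ((norm (S (\<omega>, q)))\<^sup>2) \<partial>?Q \<partial>chain c n)"
      unfolding P_def by (rule Q.nn_integral_fst[symmetric]) (simp add: P_def[symmetric])
    also have "\<dots> \<le> (\<integral>\<^sup>+\<omega>. ennreal (?b ((norm (other \<omega>))\<^sup>2)) \<partial>chain c n)"
      unfolding S_def using nn_integral_midpoint_sum_le[OF \<eta>(1) K] by (intro nn_integral_mono) auto
    also have "\<dots> = (\<integral>\<^sup>+y. ennreal (?b ((norm y)\<^sup>2)) \<partial>\<mu>)"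
      unfolding distr_other[symmetric] by (subst nn_integral_distr) auto
    also have "\<dots> = ennreal (\<integral>y. ?b ((norm y)\<^sup>2) \<partial>\<mu>)"
    proof (rule nn_integral_eq_integral)
      interpret M: prob_space \<mu> by (rule prob_\<mu>)
      show "integrable \<mu> (\<lambda>y. ?b ((norm y)\<^sup>2))"
        using int by (intro integrable_mult_right Bochner_Integration.integrable_add integrable_divide) auto
    qed (intro AE_I2 b_nonneg, simp)
    also have "(\<integral>y. ?b ((norm y)\<^sup>2) \<partial>\<mu>) = ?b (\<integral>y. (norm y)\<^sup>2 \<partial>\<mu>)"
    proof -
      interpret M: prob_space \<mu> by (rule prob_\<mu>)
      show ?thesis
        using int M.prob_space by simp
    qed
    finally have "(\<integral>\<^sup>+p. ennreal ((norm (S p))\<^sup>2) \<partial>P) \<le> ennreal (?b (\<integral>y. (norm y)\<^sup>2 \<partial>\<mu>))" .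
    then have *: "integrable P (\<lambda>p. (norm (S p))\<^sup>2) \<and> (\<integral>p. (norm (S p))\<^sup>2 \<partial>P) \<le> ?b (\<integral>y. (norm y)\<^sup>2 \<partial>\<mu>)"
      by (rule integral_le_of_nn_integral_le[rotated 2]) (auto intro!: b_nonneg)
    show "square_integrable P S"
      using * by (auto simp: square_integrable_def)
    show "l2_norm P S \<le> sqrt (?b (\<integral>y. (norm y)\<^sup>2 \<partial>\<mu>))"
      unfolding l2_norm_def using * by (intro real_sqrt_le_mono) simp
  qed

  have sq_dv: "square_integrable P (\<lambda>p. dv (fst p))" and l2_dv: "l2_norm P (\<lambda>p. dv (fst p)) \<le> L * \<eta> * sqrt (2 * \<eta> * DIM('a)) + \<epsilon>"
  proof -
    have dv_meas: "dv \<in> borel_measurable (chain c n)"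
      unfolding dv_def by measurable
    have fst_meas: "fst \<in> measurable P (chain c n)"
      unfolding P_def by measurable
    have "square_integrable (chain c n) dv"
      unfolding dv_def
      by (intro square_integrable_diff square_integrable_add square_integrable_scaleR
          square_integrable_current[where f="\<lambda>x. x"] square_integrable_start[where f="\<lambda>x. x"]
          square_integrable_gibbs_id square_integrable_start square_integrable_gradient
          square_integrable_noise_sum)
    then show "square_integrable P (\<lambda>p. dv (fst p))"
      using square_integrable_distr[OF fst_meas dv_meas] unfolding distr_P_fst by blast
    show "l2_norm P (\<lambda>p. dv (fst p)) \<le> L * \<eta> * sqrt (2 * \<eta> * DIM('a)) + \<epsilon>"
      using l2_norm_distr[OF fst_meas dv_meas] dev unfolding distr_P_fst dv_def[abs_def] by simp
  qed

  let ?T = "(1 - m * \<eta>) * r + (L * \<eta> * sqrt (2 * \<eta> * DIM('a)) + \<eta> * sqrt (?b (\<integral>y. (norm y)\<^sup>2 \<partial>\<mu>))) + \<epsilon>"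
  have sq_sum: "square_integrable P (\<lambda>p. A p + \<eta> *\<^sub>R S p + (-1) *\<^sub>R dv (fst p))"
    by (intro square_integrable_add square_integrable_scaleR sq_A sq_S sq_dv)
  have "l2_norm P (\<lambda>p. A p + \<eta> *\<^sub>R S p + (-1) *\<^sub>R dv (fst p))
      \<le> l2_norm P (\<lambda>p. A p + \<eta> *\<^sub>R S p) + l2_norm P (\<lambda>p. (-1) *\<^sub>R dv (fst p))"
    by (intro l2_norm_triangle square_integrable_add square_integrable_scaleR sq_A sq_S sq_dv)
  also have "\<dots> \<le> l2_norm P A + l2_norm P (\<lambda>p. \<eta> *\<^sub>R S p) + l2_norm P (\<lambda>p. (-1) *\<^sub>R dv (fst p))"
    by (intro add_right_mono l2_norm_triangle square_integrable_scaleR sq_A sq_S)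
  also have "\<dots> = l2_norm P A + \<eta> * l2_norm P S + l2_norm P (\<lambda>p. dv (fst p))"
    using \<eta> by (simp only: l2_norm_scaleR)
  also have "\<dots> \<le> (1 - m * \<eta>) * r + \<eta> * sqrt (?b (\<integral>y. (norm y)\<^sup>2 \<partial>\<mu>)) + (L * \<eta> * sqrt (2 * \<eta> * DIM('a)) + \<epsilon>)"
    using \<eta> by (intro add_mono mult_left_mono l2_A l2_S l2_dv) auto
  finally have total: "l2_norm P (\<lambda>p. A p + \<eta> *\<^sub>R S p + (-1) *\<^sub>R dv (fst p)) \<le> ?T"
    by linarith

  define \<gamma>' where "\<gamma>' = distr P (borel \<Otimes>\<^sub>M borel) (\<lambda>p. (Y p, current (fst p)))"
  have YX_meas: "(\<lambda>p. (Y p, current (fst p))) \<in> measurable P (borel \<Otimes>\<^sub>M borel)"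
    by measurable
  show ?thesis
  proof (rule bexI[of _ \<gamma>'])
    have "distr \<gamma>' borel fst = distr P borel Y" "distr \<gamma>' borel snd = distr P borel (\<lambda>p. current (fst p))"
      unfolding \<gamma>'_def by (subst distr_distr[OF _ YX_meas]; simp add: comp_def)+
    then show "\<gamma>' \<in> couplings \<mu> gibbs"
      by (simp add: couplings_def \<gamma>'_def law_Y law_X)
    have "transport_cost \<gamma>' = (\<integral>\<^sup>+p. ennreal ((norm (Y p - current (fst p)))\<^sup>2) \<partial>P)"
      unfolding \<gamma>'_def by (subst nn_integral_distr[OF YX_meas]) auto
    also have "\<dots> = ennreal ((l2_norm P (\<lambda>p. A p + \<eta> *\<^sub>R S p + (-1) *\<^sub>R dv (fst p)))\<^sup>2)"
      unfolding decomposition l2_norm_power2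
      using square_integrableD(2)[OF sq_sum] by (intro nn_integral_eq_integral) auto
    also have "\<dots> \<le> ennreal (?T\<^sup>2)"
      using total by (intro ennreal_leI power_mono) auto
    finally show "transport_cost \<gamma>' \<le> ennreal (?T\<^sup>2)" .
  qed
qed

theorem proposition2p4:
  fixes U :: "real ^ 'n \<Rightarrow> real"
    and grad_U :: "real ^ 'n \<Rightarrow> real ^ 'n"
    and m L :: real
    and K :: nat
    and \<eta>\<^sub>0 :: "real \<Rightarrow> real \<Rightarrow> real"
    and stat :: "real \<Rightarrow> (real ^ 'n) measure"
  assumes grad: "\<And>x. GDERIV U x :> grad_U x"
    and grad_cont: "continuous_on UNIV grad_U"
    and grad_0: "grad_U 0 = 0"
    and m_pos: "0 < m"
    and m_le_L: "m \<le> L"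
    and lower: "\<And>x y. m / 2 * (norm (x - y))\<^sup>2 \<le> U y - U x - grad_U x \<bullet> (y - x)"
    and upper: "\<And>x y. U y - U x - grad_U x \<bullet> (y - x) \<le> L / 2 * (norm (x - y))\<^sup>2"
    and K: "K \<ge> 1"
    and eta0: "0 < \<eta>\<^sub>0 m L" "\<eta>\<^sub>0 m L < 1"
    and stat: "\<And>\<eta>. 0 < \<eta> \<Longrightarrow> \<eta> < \<eta>\<^sub>0 m L \<Longrightarrow>
      stationary_distribution (prlmc_kernel grad_U \<eta> K) (stat \<eta>)"
    and stat_unique: "\<And>\<eta> \<mu>. 0 < \<eta> \<Longrightarrow> \<eta> < \<eta>\<^sub>0 m L \<Longrightarrow>
      stationary_distribution (prlmc_kernel grad_U \<eta> K) \<mu> \<Longrightarrow> \<mu> = stat \<eta>"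
    and stat_integrable: "\<And>\<eta>. 0 < \<eta> \<Longrightarrow> \<eta> < \<eta>\<^sub>0 m L \<Longrightarrow>
      integrable (stat \<eta>) (\<lambda>x. (norm x)\<^sup>2)"
    and stat_moment: "\<And>\<eta>. 0 < \<eta> \<Longrightarrow> \<eta> < \<eta>\<^sub>0 m L \<Longrightarrow>
      (\<integral>x. (norm x)\<^sup>2 \<partial>stat \<eta>) \<le> real CARD('n) / m *
        (2 + 4 * \<eta>\<^sup>2 * L\<^sup>2 * (2 - 1 / real K) + L\<^sup>2 * (1 - 1 / real K))"
  shows "\<forall>\<eta>. 0 < \<eta> \<and> \<eta> < min (\<eta>\<^sub>0 m L) (2 / (m + L)) \<longrightarrow>
    wasserstein2 (stat \<eta>) (gibbs_measure U) \<le> ennreal (L / m * sqrt \<eta> *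
      (sqrt (2 * real CARD('n) + 4 * \<eta>\<^sup>2 * L * real CARD('n) + 8 * L\<^sup>2 * \<eta>\<^sup>2 * real CARD('n))
       + sqrt (4 - 2 / real K) *
         sqrt (\<eta> * L\<^sup>2 * (\<integral>x. (norm x)\<^sup>2 \<partial>stat \<eta>) / 3 + real CARD('n))))"
proof (intro allI impI)
  fix \<eta> :: real
  assume "0 < \<eta> \<and> \<eta> < min (\<eta>\<^sub>0 m L) (2 / (m + L))"
  then have \<eta>: "0 < \<eta>" "\<eta> < \<eta>\<^sub>0 m L" "\<eta> < 2 / (m + L)"
    by auto
  have "continuous_on UNIV U"
    using grad by (intro continuous_at_imp_continuous_on)
      (auto simp: gderiv_def intro: has_derivative_continuous)
  then have "U \<in> borel_measurable borel"
    by (rule borel_measurable_continuous_onI)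
  then interpret strongly_convex_smooth U grad_U m L
    using m_pos m_le_L grad_0 lower upper by unfold_locales
  define d where "d = real CARD('n)"
  define \<mu> where "\<mu> = stat \<eta>"
  define M where "M = (\<integral>x. (norm x)\<^sup>2 \<partial>\<mu>)"
  have d: "real DIM(real ^ 'n) = d" "0 \<le> d"
    by (simp_all add: d_def)
  have stationary: "stationary_distribution (prlmc_kernel grad_U \<eta> K) \<mu>"
    unfolding \<mu>_def using \<eta> by (intro stat)
  then have \<mu>: "prob_space \<mu>" "sets \<mu> = sets borel"
    unfolding stationary_distribution_def by blast+
  have int: "integrable \<mu> (\<lambda>x. (norm x)\<^sup>2)"
    unfolding \<mu>_def using \<eta> by (intro stat_integrable)
  have "(\<lambda>x. x) \<in> borel_measurable \<mu>"
    by (rule measurable_ident_sets[OF \<mu>(2)])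
  then have sq_\<mu>: "square_integrable \<mu> (\<lambda>x. x)"
    using int by (simp add: square_integrable_def)
  have M: "0 \<le> M"
    unfolding M_def by (intro integral_nonneg_AE) auto
  define E where "E = L * \<eta> * sqrt (2 * \<eta> * d)
      + \<eta> * sqrt ((4 - 2 / real K) * L\<^sup>2 * \<eta> * (\<eta> * L\<^sup>2 * M / 3 + d))"
  have K2: "0 \<le> 4 - 2 / real K"
    using K by (simp add: field_simps)
  have E: "0 \<le> E"
    using \<eta> L_pos K2 M d unfolding E_def by (intro add_nonneg_nonneg mult_nonneg_nonneg) auto
  have m\<eta>: "0 \<le> 1 - m * \<eta>" "1 - m * \<eta> < 1"
    using step_size_bounds(2)[OF \<eta>(1,3)] m_pos \<eta> by simp_all
  have "wasserstein2 \<mu> gibbs \<le> ennreal (E / (1 - (1 - m * \<eta>)))"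
  proof (rule wasserstein2_le_of_contraction[OF m\<eta> E])
    show "\<exists>\<gamma>\<in>couplings \<mu> gibbs. transport_cost \<gamma> < \<infinity>"
      by (intro finite_cost_coupling \<mu> sq_\<mu> prob_space_gibbs square_integrable_gibbs_id) simp
  next
    fix \<gamma> :: "((real ^ 'n) \<times> (real ^ 'n)) measure" and r \<epsilon> :: real
    assume \<gamma>: "\<gamma> \<in> couplings \<mu> gibbs" and r: "0 \<le> r" and \<epsilon>: "0 < \<epsilon>"
      and cost: "transport_cost \<gamma> \<le> ennreal (r\<^sup>2)"
    note \<gamma>D = couplingsD[OF \<gamma>]
    have "fst \<in> borel_measurable \<gamma>"
      using measurable_cong_sets[OF \<gamma>D(1) refl] measurable_fst by blast
    then have "prob_space \<gamma>"
      by (rule prob_space_distrD) (simp add: \<gamma>D \<mu>)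
    then interpret coupled_chain U grad_U m L \<gamma>
      using \<gamma>D by (intro coupled_chain.intro coupled_chain_axioms.intro strongly_convex_smooth_axioms)
    show "\<exists>\<gamma>'\<in>couplings \<mu> gibbs. transport_cost \<gamma>'
        \<le> ennreal (((1 - m * \<eta>) * r + E + \<epsilon>)\<^sup>2)"
      using coupled_step[OF \<eta>(1,3) K \<epsilon> \<gamma>D(2) stationary int r cost]
      unfolding d E_def M_def .
  qed
  also have "ennreal (E / (1 - (1 - m * \<eta>))) \<le> ennreal (L / m * sqrt \<eta> *
      (sqrt (2 * d + 4 * \<eta>\<^sup>2 * L * d + 8 * L\<^sup>2 * \<eta>\<^sup>2 * d)
       + sqrt (4 - 2 / real K) * sqrt (\<eta> * L\<^sup>2 * M / 3 + d)))"
  proof (rule ennreal_leI)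
    have "E = \<eta> * (L * sqrt \<eta> * (sqrt (2 * d) + sqrt (4 - 2 / real K) * sqrt (\<eta> * L\<^sup>2 * M / 3 + d)))"
    proof -
      have r1: "sqrt (a * L\<^sup>2 * \<eta> * b) = L * sqrt \<eta> * (sqrt a * sqrt b)" for a b
        using L_pos by (simp add: real_sqrt_mult)
      have r2: "sqrt (2 * \<eta> * d) = sqrt \<eta> * sqrt (2 * d)"
        by (simp add: real_sqrt_mult)
      show ?thesis
        unfolding E_def r1 r2 by (simp add: algebra_simps)
    qed
    then have "E / (1 - (1 - m * \<eta>)) = L / m * sqrt \<eta> * (sqrt (2 * d) + sqrt (4 - 2 / real K) * sqrt (\<eta> * L\<^sup>2 * M / 3 + d))"
      using \<eta> m_pos by simp
    also have "\<dots> \<le> L / m * sqrt \<eta> * (sqrt (2 * d + 4 * \<eta>\<^sup>2 * L * d + 8 * L\<^sup>2 * \<eta>\<^sup>2 * d)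
       + sqrt (4 - 2 / real K) * sqrt (\<eta> * L\<^sup>2 * M / 3 + d))"
      using L_pos m_pos \<eta> d by (intro mult_left_mono add_right_mono real_sqrt_le_mono) auto
    finally show "E / (1 - (1 - m * \<eta>)) \<le> L / m * sqrt \<eta> * (sqrt (2 * d + 4 * \<eta>\<^sup>2 * L * d + 8 * L\<^sup>2 * \<eta>\<^sup>2 * d)
       + sqrt (4 - 2 / real K) * sqrt (\<eta> * L\<^sup>2 * M / 3 + d))" .
  qed
  finally show "wasserstein2 (stat \<eta>) gibbs \<le> ennreal (L / m * sqrt \<eta> *
      (sqrt (2 * real CARD('n) + 4 * \<eta>\<^sup>2 * L * real CARD('n) + 8 * L\<^sup>2 * \<eta>\<^sup>2 * real CARD('n))
       + sqrt (4 - 2 / real K) *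
         sqrt (\<eta> * L\<^sup>2 * (\<integral>x. (norm x)\<^sup>2 \<partial>stat \<eta>) / 3 + real CARD('n))))"
    unfolding d_def M_def \<mu>_def .
qed

end
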